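(* Fix an integer $l\geq 0$ and reals $\epsilon_1,\epsilon_2>0$. There exists $M(\epsilon_1,\epsilon_2)>0$ such that for all $g>M(\epsilon_1,\epsilon_2)$ and all subsets of integers \[C\subseteq \big[1,(\gamma-\epsilon_1)g\big) \cup \big((\gamma+\epsilon_1)g,(2\gamma-\epsilon_1)g\big) \cup \big((2\gamma+\epsilon_1)g,2g\big]\] with $|C|=l$, we have \[\left|\mathbb{P}_g[C\subseteq S]-\prod_{n\in C}f_{1}\left(\frac{n}{g}\right)\right|<\epsilon_2.\]
   Context: A numerical semigroup is a submonoid of $\mathbb{N}_0$ with finite complement; its genus is the size of the complement. $\mathcal{S}_g$ is the set of numerical semigroups of genus $g$ and $\mathbb{P}_g$ is the uniform probability on $\mathcal{S}_g$, $S$ denoting a random element. Let $\gamma=\frac{5+\sqrt5}{10}$ and define $f_1:[0,2]\setminus\{\gamma,2\gamma\}\to[0,1]$ by $f_1(x)=0$ if $0\le x<\gamma$, $f_1(x)=\frac{\sqrt5-1}{2}$ if $\gamma<x<2\gamma$, and $f_1(x)=1$ if $2\gamma<x\le 2$. *)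

theory Defs
  imports "HOL-Analysis.Analysis"
begin

definition numerical_semigroup :: "nat set \<Rightarrow> bool" where
  "numerical_semigroup S \<longleftrightarrow> 0 \<in> S \<and> (\<forall>a\<in>S. \<forall>b\<in>S. a + b \<in> S) \<and> finite (- S)"

definition genus :: "nat set \<Rightarrow> nat" where
  "genus S = card (- S)"

definition semigroups_of_genus :: "nat \<Rightarrow> nat set set" where
  "semigroups_of_genus g = {S. numerical_semigroup S \<and> genus S = g}"

definition prob_genus :: "nat \<Rightarrow> (nat set \<Rightarrow> bool) \<Rightarrow> real" where
  "prob_genus g P = real (card {S \<in> semigroups_of_genus g. P S}) / real (card (semigroups_of_genus g))"

definition gamma :: real where
  "gamma = (5 + sqrt 5) / 10"

text \<open>f_1; its values at gamma and 2 gamma are irrelevant (not in its domain in the paper).\<close>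
definition f1 :: "real \<Rightarrow> real" where
  "f1 x = (if x < gamma then 0 else if x < 2 * gamma then (sqrt 5 - 1) / 2 else 1)"

end

theory Submission
  imports Defs "HOL-Number_Theory.Fib" "HOL-Real_Asymp.Real_Asymp"
begin

text \<open>
  A semigroup of multiplicity \<open>m\<close> and Frobenius number \<open>2 m + k\<close> with \<open>k < m\<close> is a bounded pattern near \<open>m\<close> and
  \<open>2 m\<close> together with an arbitrary subset of the numbers in between. For a fixed pattern the number of
  such semigroups of genus \<open>g\<close> is a diagonal sum of binomial coefficients, hence a Fibonacci number,
  concentrated on \<open>m \<approx> gamma g\<close>; forcing \<open>c\<close> prescribed numbers into the middle part shifts the Fibonacci
  index by \<open>c\<close> and so multiplies the count by \<open>phi ^ (- c)\<close> asymptotically.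

  It remains to see that \<open>k\<close> is bounded with probability close to 1. Given the shape
  \<open>A = (S - m) \<inter> [0, k]\<close>, the semigroups number at most \<open>phi ^ (g - k - 2 + |A| - \<sigma>)\<close>, where \<open>\<sigma>\<close> counts the
  elements of \<open>A + A\<close> in \<open>(k - m, k)\<close>. With \<open>d\<close> the least nonzero element of \<open>A\<close>, one has \<open>A + A \<supseteq> A \<union> (A + d)\<close>,
  while \<open>k \<notin> A + A\<close> forbids \<open>A\<close> to contain both \<open>a\<close> and \<open>k - a\<close>. Reading the pairs \<open>(a, k - a)\<close> along steps of
  length \<open>d\<close> turns the weighted sum over \<open>A\<close> into a transfer-matrix product whose eigenvalue per pair is
  less than \<open>phi\<^sup>2\<close>, so the sum over all shapes decays exponentially in \<open>k\<close>.
\<close>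

section \<open>A transfer-matrix bound\<close>

text \<open>Smallness is measured against \<open>phi ^ g\<close> with a constant fixed beforehand,
  so the tail over \<open>k\<close> tolerates no factor growing with \<open>g\<close>. For
  \<open>k < m\<close> neither the admissible shapes nor their forced sums depend on
  \<open>m\<close>; summing over \<open>m\<close> inside one shape gives a single Fibonacci diagonal
  and costs nothing. For \<open>k \<ge> m\<close> all gaps are at most
  \<open>2 * m + k \<le> 3 * k\<close>, so \<open>k \<ge> g / 3\<close> and exponential decay
  absorbs the polynomially many pairs \<open>(m, k)\<close>.

  Grouping residue classes into mirror pairs wastes up to a factor 2.6 for each of the
  \<open>k div m\<close> layers. This is harmless once \<open>m\<close> exceeds a large constant;
  smaller multiplicities admit only polynomially many semigroups.

  Treating the pairs as independent would fail: with one layer, a class and its mirror have three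
  admissible states of weight 1, and 3 exceeds \<open>phi\<^sup>2\<close>. The saving comes from
  sums with \<open>d\<close>, which couple classes at distance \<open>d\<close>.\<close>

definition phi :: real where
  "phi = (1 + sqrt 5) / 2"

lemma phi_bounds: "1.618 < phi" "phi < 1.6181"
proof -
  have "2.236 < sqrt 5"
    by (rule real_less_rsqrt) (simp add: power2_eq_square)
  moreover have "sqrt 5 < 2.2362"
    by (rule real_less_lsqrt) (simp_all add: power2_eq_square)
  ultimately show "1.618 < phi" "phi < 1.6181"
    by (simp_all add: phi_def)
qed

lemma phi_gt_1: "1 < phi" and phi_pos: "0 < phi" and phi_ge_1: "1 \<le> phi"
  using phi_bounds by auto

lemma phi_sq: "phi * phi = phi + 1"
proof -
  have "sqrt 5 * sqrt 5 = (5 :: real)" by simp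
  then show ?thesis by (simp add: phi_def field_simps)
qed

lemma phi_sq_left: "phi * (phi * x) = phi * x + x"
  using phi_sq by (simp add: mult.assoc[symmetric] distrib_right)

lemma inverse_phi: "1 / phi = phi - 1"
  using phi_sq phi_pos by (simp add: field_simps)

text \<open>The potential \<open>u i\<close> of a state at position \<open>i\<close> bounds the total weight of the continuations of
  its chain \<open>i, i + d, i + 2 d, \<dots>\<close>; only the last state of each of the \<open>d\<close> chains carries a potential
  while the positions are filled in increasing order.\<close>

lemma chain_sum_le:
  fixes Q :: "nat \<Rightarrow> 'a set" and w :: "'a \<Rightarrow> real" and T :: "'a \<Rightarrow> 'a \<Rightarrow> real"
    and u :: "nat \<Rightarrow> 'a \<Rightarrow> real" and c :: "nat \<Rightarrow> real"
  assumes fin: "\<And>i. finite (Q i)"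
    and nonneg: "\<And>b. 0 \<le> w b" "\<And>a b. 0 \<le> T a b" "\<And>i b. 0 \<le> u i b" "\<And>i. 0 \<le> c i"
    and start: "\<And>i. i < h \<Longrightarrow> i < d \<Longrightarrow> (\<Sum>b\<in>Q i. w b * u i b) \<le> c i"
    and step: "\<And>i a. i < h \<Longrightarrow> d \<le> i \<Longrightarrow> a \<in> Q (i - d)
                 \<Longrightarrow> (\<Sum>b\<in>Q i. T a b * u i b) \<le> c i * u (i - d) a"
    and last: "\<And>i b. i < h \<Longrightarrow> h \<le> i + d \<Longrightarrow> b \<in> Q i \<Longrightarrow> 1 \<le> u i b"
    and d: "0 < d"
  shows "(\<Sum>s\<in>PiE {..<h} Q. \<Prod>i<h. if i < d then w (s i) else T (s (i - d)) (s i)) \<le> (\<Prod>i<h. c i)"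
proof -
  define f where "f s i = (if i < d then w (s i) else T (s (i - d)) (s i))" for s :: "nat \<Rightarrow> 'a" and i
  have f0: "0 \<le> f s i" for s i by (simp add: f_def nonneg)
  have main: "(\<Sum>s\<in>PiE {..<t} Q. (\<Prod>i<t. f s i) * (\<Prod>i\<in>{t - d..<t}. u i (s i))) \<le> (\<Prod>i<t. c i)"
    if "t \<le> h" for t
    using that
  proof (induction t)
    case 0
    then show ?case by simp
  next
    case (Suc t)
    have t: "t < h" using Suc.prems by simp
    define P where "P s = (\<Prod>i<t. f s i) * (\<Prod>i\<in>{t - d..<t}. u i (s i))" for s
    have inj: "inj_on (\<lambda>(y, g). g(t := y)) (Q t \<times> PiE {..<t} Q)"
    proof (rule inj_onI, clarsimp)
      fix y g y' g'
      assume g: "g \<in> PiE {..<t} Q" "g' \<in> PiE {..<t} Q" and eq: "g(t := y) = g'(t := y')"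
      have "y = y'" using fun_cong[OF eq, of t] by simp
      moreover have "g x = g' x" for x
        using fun_cong[OF eq, of x] g by (cases "x = t") (auto simp: PiE_def extensional_def)
      ultimately show "y = y' \<and> g = g'" by auto
    qed
    have inner: "(\<Sum>y\<in>Q t. (\<Prod>i<Suc t. f (g(t := y)) i)
                    * (\<Prod>i\<in>{Suc t - d..<Suc t}. u i ((g(t := y)) i))) \<le> c t * P g"
      if g: "g \<in> PiE {..<t} Q" for g
    proof -
      have same: "(\<Prod>i<t. f (g(t := y)) i) = (\<Prod>i<t. f g i)" for y
        by (rule prod.cong) (auto simp: f_def)
      have Pf: "0 \<le> (\<Prod>i<t. f g i)" by (intro prod_nonneg) (simp add: f0)
      show ?thesis
      proof (cases "t < d")
        case True
        have s1: "{Suc t - d..<Suc t} = insert t {t - d..<t}" using True by auto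
        have "(\<Prod>i\<in>{Suc t - d..<Suc t}. u i ((g(t := y)) i)) = u t y * (\<Prod>i\<in>{t - d..<t}. u i (g i))" for y
          unfolding s1 by (subst prod.insert) (auto intro!: prod.cong)
        then have "(\<Sum>y\<in>Q t. (\<Prod>i<Suc t. f (g(t := y)) i) * (\<Prod>i\<in>{Suc t - d..<Suc t}. u i ((g(t := y)) i)))
           = (\<Sum>y\<in>Q t. P g * (w y * u t y))"
          using True by (auto simp: same f_def P_def intro!: sum.cong)
        also have "\<dots> = P g * (\<Sum>y\<in>Q t. w y * u t y)" by (simp add: sum_distrib_left)
        also have "\<dots> \<le> P g * c t"
          by (intro mult_left_mono start t True) (auto simp: P_def intro!: mult_nonneg_nonneg prod_nonneg f0 nonneg)
        finally show ?thesis by (simp add: mult.commute)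
      next
        case False
        \<comment> \<open>\<open>R\<close> collects the potentials of the chains not touched by
          position \<open>t\<close>; on the remaining chain \<open>u (t - d)\<close> is traded for
          \<open>u t\<close>.\<close>
        define R where "R = (\<Prod>i\<in>{Suc t - d..<t}. u i (g i))"
        have s1: "{Suc t - d..<Suc t} = insert t {Suc t - d..<t}" using False d by auto
        have s2: "{t - d..<t} = insert (t - d) {Suc t - d..<t}" using False d by auto
        have "(\<Prod>i\<in>{Suc t - d..<Suc t}. u i ((g(t := y)) i)) = u t y * R" for y
          unfolding s1 R_def by (subst prod.insert) (auto intro!: prod.cong)
        moreover have "t - d \<noteq> t" using False d by auto
        then have "f (g(t := y)) t = T (g (t - d)) y" for y
          using False by (simp add: f_def)
        ultimately have "(\<Sum>y\<in>Q t. (\<Prod>i<Suc t. f (g(t := y)) i) * (\<Prod>i\<in>{Suc t - d..<Suc t}. u i ((g(t := y)) i)))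
           = (\<Sum>y\<in>Q t. ((\<Prod>i<t. f g i) * R) * (T (g (t - d)) y * u t y))"
          by (auto simp: same mult_ac intro!: sum.cong)
        also have "\<dots> = ((\<Prod>i<t. f g i) * R) * (\<Sum>y\<in>Q t. T (g (t - d)) y * u t y)"
          by (simp add: sum_distrib_left)
        also have "\<dots> \<le> ((\<Prod>i<t. f g i) * R) * (c t * u (t - d) (g (t - d)))"
        proof (rule mult_left_mono[OF step])
          show "g (t - d) \<in> Q (t - d)" using g False d by (auto simp: PiE_def Pi_def)
          show "0 \<le> (\<Prod>i<t. f g i) * R"
            by (auto simp: R_def intro!: mult_nonneg_nonneg prod_nonneg f0 nonneg)
        qed (use t False in auto)
        also have "\<dots> = c t * P g"
          unfolding P_def R_def s2 by (subst prod.insert) (use False d in auto)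
        finally show ?thesis .
      qed
    qed
    have "(\<Sum>s\<in>PiE {..<Suc t} Q. (\<Prod>i<Suc t. f s i) * (\<Prod>i\<in>{Suc t - d..<Suc t}. u i (s i)))
       = (\<Sum>(y, g)\<in>Q t \<times> PiE {..<t} Q. (\<Prod>i<Suc t. f (g(t := y)) i)
                    * (\<Prod>i\<in>{Suc t - d..<Suc t}. u i ((g(t := y)) i)))"
      unfolding lessThan_Suc PiE_insert_eq by (subst sum.reindex[OF inj]) (simp only: o_def case_prod_unfold)
    also have "\<dots> = (\<Sum>g\<in>PiE {..<t} Q. \<Sum>y\<in>Q t. (\<Prod>i<Suc t. f (g(t := y)) i)
                    * (\<Prod>i\<in>{Suc t - d..<Suc t}. u i ((g(t := y)) i)))"
      by (subst sum.cartesian_product[symmetric], subst sum.swap) simp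
    also have "\<dots> \<le> (\<Sum>g\<in>PiE {..<t} Q. c t * P g)"
      by (intro sum_mono inner)
    also have "\<dots> = c t * (\<Sum>g\<in>PiE {..<t} Q. P g)" by (simp add: sum_distrib_left)
    also have "\<dots> \<le> c t * (\<Prod>i<t. c i)"
      unfolding P_def using t by (intro mult_left_mono Suc.IH nonneg) auto
    finally show ?case by (simp add: mult.commute)
  qed
  have "(\<Sum>s\<in>PiE {..<h} Q. \<Prod>i<h. f s i)
      \<le> (\<Sum>s\<in>PiE {..<h} Q. (\<Prod>i<h. f s i) * (\<Prod>i\<in>{h - d..<h}. u i (s i)))"
  proof (rule sum_mono)
    fix s assume s: "s \<in> PiE {..<h} Q"
    have "1 \<le> (\<Prod>i\<in>{h - d..<h}. u i (s i))"
      using s by (intro prod_ge_1 last) (auto simp: PiE_def Pi_def)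
    then show "(\<Prod>i<h. f s i) \<le> (\<Prod>i<h. f s i) * (\<Prod>i\<in>{h - d..<h}. u i (s i))"
      using mult_left_mono[of 1 _ "\<Prod>i<h. f s i"] f0 by (simp add: prod_nonneg)
  qed
  also have "\<dots> \<le> (\<Prod>i<h. c i)" by (rule main) simp
  finally show ?thesis by (simp add: f_def)
qed

section \<open>Weights and potentials for one pair of mirror classes\<close>

text \<open>A state \<open>(b, c)\<close> records how many elements of the shape lie in a residue class modulo the multiplicity
  and in its mirror class. Elements below the top one of a class weigh \<open>phi\<close>; a step by \<open>d\<close> from an
  occupied to an empty top position costs \<open>1 / phi = phi - 1\<close>. Mirror classes are read backwards.\<close>

definition wt :: "nat \<times> nat \<Rightarrow> real" where
  "wt s = phi ^ ((fst s - 1) + (snd s - 1))"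

definition trans_wt :: "nat \<times> nat \<Rightarrow> nat \<times> nat \<Rightarrow> real" where
  "trans_wt s t = wt t * (phi - 1) ^ (of_bool (1 \<le> fst s \<and> fst t = 0) + of_bool (snd s = 0 \<and> 1 \<le> snd t))"

definition states :: "nat \<Rightarrow> (nat \<times> nat) set" where
  "states L = {(b, c). b + c \<le> L}"

text \<open>Numerically found superharmonic potentials for the eigenvalue bound \<open>2.6 ^ L\<close>. What matters is that
  \<open>2.6 < phi\<^sup>2\<close>: the trivial bound on a pair of classes exceeds \<open>phi ^ (2 * L)\<close> for \<open>L = 1, 2\<close>.\<close>

definition pot :: "nat \<Rightarrow> nat \<times> nat \<Rightarrow> real" where
  "pot L s = (if L = 1 then if 1 \<le> fst s then 0.77 else if 1 \<le> snd s then 1.16 else 1.01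
     else if L = 2 then if 1 \<le> fst s then if 1 \<le> snd s then 0.87 else 0.72
                        else if 1 \<le> snd s then 1.08 else 0.87
     else 1)"

text \<open>The chains starting in residues below the least nonzero element \<open>d\<close> of the shape gain a factor \<open>gain\<close>, the
  other chains may lose a factor \<open>loss\<close>; \<open>gain (Suc L) * loss L \<le> 1\<close> lets the former pay for the latter.\<close>

definition gain :: "nat \<Rightarrow> real" where "gain L = (if L = 2 \<or> L = 3 then 0.84 else 1)"
definition loss :: "nat \<Rightarrow> real" where "loss L = (if L = 1 \<or> L = 2 then 1.16 else 1)"

lemma states_eq: "states L = (SIGMA b:{..L}. {..L - b})"
  by (auto simp: states_def)

lemma finite_states [simp]: "finite (states L)"
  unfolding states_eq by (rule finite_SigmaI) auto

lemma sum_states: "(\<Sum>s\<in>states L. f s) = (\<Sum>b\<le>L. \<Sum>c\<le>L - b. f (b, c))"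
  unfolding states_eq by (simp add: sum.Sigma)

lemma wt_nonneg: "0 \<le> wt s" using phi_pos by (simp add: wt_def)
lemma trans_wt_nonneg: "0 \<le> trans_wt s t" using phi_pos phi_gt_1 by (simp add: trans_wt_def wt_def)
lemma pot_nonneg: "0 \<le> pot L s" by (simp add: pot_def)

lemma trans_wt_le: "trans_wt s t \<le> wt t"
  unfolding trans_wt_def using phi_bounds
  by (intro mult_left_le power_le_one) (auto simp: wt_nonneg)

lemma sum_states_Suc:
  "(\<Sum>s\<in>states (Suc L). wt s) = (\<Sum>s\<in>states L. wt s) + (\<Sum>b\<le>Suc L. wt (b, Suc L - b))"
proof -
  have e: "states (Suc L) = states L \<union> (\<lambda>b. (b, Suc L - b)) ` {..Suc L}"
    by (auto simp: states_def image_iff)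
  have "(\<Sum>s\<in>states (Suc L). wt s) = (\<Sum>s\<in>states L. wt s) + sum wt ((\<lambda>b. (b, Suc L - b)) ` {..Suc L})"
    unfolding e by (rule sum.union_disjoint) (simp_all, auto simp: states_def)
  also have "sum wt ((\<lambda>b. (b, Suc L - b)) ` {..Suc L}) = (\<Sum>b\<le>Suc L. wt (b, Suc L - b))"
    by (subst sum.reindex) (auto simp: inj_on_def)
  finally show ?thesis .
qed

text \<open>From three layers on the crude total fits: about 15.71 against 17.58 for
  \<open>L = 3\<close>. Passing to \<open>Suc L\<close> adds an antidiagonal, whose two ends weigh
  \<open>phi ^ L\<close> each and whose \<open>L\<close> inner states weigh
  \<open>phi ^ (L - 1)\<close>.\<close>

lemma sum_wt_states_le: "(\<Sum>s\<in>states L. wt s) \<le> 2.6 ^ L" if "3 \<le> L"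
  using that
proof (induction L rule: dec_induct)
  case base
  have "(\<Sum>s\<in>states 3. wt s) = 4 + 4 * phi + 2 * (phi * phi)"
    by (simp add: sum_states wt_def eval_nat_numeral)
  also have "\<dots> \<le> 2.6 ^ 3" unfolding phi_sq using phi_bounds by (simp add: eval_nat_numeral)
  finally show ?case .
next
  case (step L)
  \<comment> \<open>\<open>1.6 * 2.6 ^ L\<close> is the room \<open>2.6 ^ Suc L - 2.6 ^ L\<close>
    left for the antidiagonal.\<close>
  have aux: "phi ^ (L - 1) * (2 * phi + real L) \<le> 1.6 * 2.6 ^ L"
    using step.hyps(1)
  proof (induction L rule: dec_induct)
    case base
    have "phi ^ (3 - 1) * (2 * phi + real 3) = 5 * phi * phi + 2 * phi"
      using phi_sq by (simp add: eval_nat_numeral algebra_simps)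
    also have "\<dots> \<le> 1.6 * 2.6 ^ 3" using phi_bounds phi_sq by (simp add: eval_nat_numeral)
    finally show ?case .
  next
    case (step n)
    have "phi ^ (Suc n - 1) * (2 * phi + real (Suc n)) = phi * phi ^ (n - 1) * (2 * phi + real n + 1)"
      using step.hyps by (cases n) auto
    also have "\<dots> \<le> phi * phi ^ (n - 1) * (1.4 * (2 * phi + real n))"
      using step.hyps phi_bounds by (intro mult_left_mono) auto
    also have "\<dots> = 1.4 * phi * (phi ^ (n - 1) * (2 * phi + real n))" by simp
    also have "\<dots> \<le> 2.6 * (1.6 * 2.6 ^ n)"
      using phi_bounds by (intro mult_mono step.IH) auto
    finally show ?case by simp
  qed
  have "(\<Sum>b\<le>Suc L. wt (b, Suc L - b)) = (\<Sum>b<L. wt (Suc b, L - b)) + wt (0, Suc L) + wt (Suc L, 0)"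
    unfolding lessThan_Suc_atMost[symmetric] sum.lessThan_Suc_shift[of _ "Suc L"] by simp
  also have "(\<Sum>b<L. wt (Suc b, L - b)) = (\<Sum>b<L. phi ^ (L - 1))"
    by (rule sum.cong) (auto simp: wt_def)
  also have "wt (0, Suc L) = phi * phi ^ (L - 1)"
    using step.hyps by (cases L; simp add: wt_def)
  also have "wt (Suc L, 0) = phi * phi ^ (L - 1)"
    using step.hyps by (cases L; simp add: wt_def)
  finally have "(\<Sum>b\<le>Suc L. wt (b, Suc L - b)) = phi ^ (L - 1) * (2 * phi + real L)"
    by (simp add: algebra_simps)
  then show ?case
    using step.IH aux by (simp add: sum_states_Suc)
qed

lemma one_two_eq_Suc: "(1::nat) = Suc 0" "(2::nat) = Suc (Suc 0)" by auto

text \<open>The second inequality carries a chain onwards; the first closes it, with the potential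
  of the final state replaced by 1. For \<open>L \<le> 2\<close> the few states are checked one by
  one; for \<open>L \<ge> 3\<close> the penalties are dropped and the crude total suffices.\<close>

lemma pot_step:
  assumes "s \<in> states L"
  shows "(\<Sum>t\<in>states L. trans_wt s t) \<le> 2.6 ^ L * pot L s"
    and "(\<Sum>t\<in>states L. trans_wt s t * pot L t) \<le> 2.6 ^ L * pot L s"
proof -
  consider "L = 0" | "L = 1" | "L = 2" | "3 \<le> L" by linarith
  then have "(\<Sum>t\<in>states L. trans_wt s t) \<le> 2.6 ^ L * pot L s \<and>
             (\<Sum>t\<in>states L. trans_wt s t * pot L t) \<le> 2.6 ^ L * pot L s"
  proof cases
    case 1
    then show ?thesis using assms
      by (simp add: sum_states wt_def trans_wt_def pot_def states_def split: prod.splits)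
  next
    case 2
    have "s \<in> {(0, 0), (1, 0), (0, 1)}" using assms 2 by (auto simp: states_def)
    then show ?thesis using 2 phi_bounds phi_sq inverse_phi
      by (auto simp: sum_states wt_def trans_wt_def pot_def power2_eq_square phi_sq_left algebra_simps
          diff_divide_distrib add_divide_distrib)
  next
    case 3
    have "s \<in> {(0, 0), (1, 0), (0, 1), (2, 0), (0, 2), (1, 1)}" using assms 3
      by (cases s) (auto simp: states_def)
    then show ?thesis using 3 phi_bounds phi_sq inverse_phi
      by (auto simp: sum_states wt_def trans_wt_def pot_def power2_eq_square phi_sq_left algebra_simps
          one_two_eq_Suc diff_divide_distrib add_divide_distrib)
  next
    case 4
    have "(\<Sum>t\<in>states L. trans_wt s t) \<le> (\<Sum>t\<in>states L. wt t)"
      by (intro sum_mono trans_wt_le)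
    then show ?thesis using sum_wt_states_le[OF 4] 4 by (simp add: pot_def)
  qed
  then show "(\<Sum>t\<in>states L. trans_wt s t) \<le> 2.6 ^ L * pot L s"
    and "(\<Sum>t\<in>states L. trans_wt s t * pot L t) \<le> 2.6 ^ L * pot L s" by auto
qed

text \<open>A chain opens with an unpenalised state. In each pair of bounds, the one without
  \<open>pot\<close> serves chains that consist of a single state. For \<open>L > 0\<close>, knowing
  that a class is not full removes exactly the state \<open>(L, 0)\<close>, or its mirror image, and
  yields one factor \<open>gain\<close>.\<close>

lemma pot_start:
  shows "(\<Sum>t\<in>states L. wt t) \<le> 2.6 ^ L * loss L"
    and "(\<Sum>t\<in>states L. wt t * pot L t) \<le> 2.6 ^ L * loss L"
    and "(\<Sum>t\<in>states L \<inter> {t. fst t \<le> L - 1}. wt t) \<le> 2.6 ^ L * gain L"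
    and "(\<Sum>t\<in>states L \<inter> {t. fst t \<le> L - 1}. wt t * pot L t) \<le> 2.6 ^ L * gain L"
    and "(\<Sum>t\<in>states L \<inter> {t. fst t \<le> L - 1 \<and> snd t \<le> L - 1}. wt t) \<le> 2.6 ^ L * (gain L)\<^sup>2"
    and "(\<Sum>t\<in>states L \<inter> {t. fst t \<le> L - 1 \<and> snd t \<le> L - 1}. wt t * pot L t) \<le> 2.6 ^ L * (gain L)\<^sup>2"
proof -
  let ?A = "states L" and ?B = "states L \<inter> {t. fst t \<le> L - 1}"
    and ?C = "states L \<inter> {t. fst t \<le> L - 1 \<and> snd t \<le> L - 1}"
  have restr: "(\<Sum>t\<in>states L \<inter> {t. P t}. f t) = (\<Sum>t\<in>states L. if P t then f t else 0)"
    for f :: "nat \<times> nat \<Rightarrow> real" and P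
    by (simp add: sum.If_cases)
  consider "L = 0" | "L = 1" | "L = 2" | "L = 3" | "4 \<le> L" by linarith
  then have "sum wt ?A \<le> 2.6 ^ L * loss L \<and> (\<Sum>t\<in>?A. wt t * pot L t) \<le> 2.6 ^ L * loss L
    \<and> sum wt ?B \<le> 2.6 ^ L * gain L \<and> (\<Sum>t\<in>?B. wt t * pot L t) \<le> 2.6 ^ L * gain L
    \<and> sum wt ?C \<le> 2.6 ^ L * (gain L)\<^sup>2 \<and> (\<Sum>t\<in>?C. wt t * pot L t) \<le> 2.6 ^ L * (gain L)\<^sup>2"
    (is ?thesis)
  proof cases
    case 1
    then show ?thesis unfolding restr sum_states by (simp add: wt_def pot_def loss_def gain_def)
  next
    case 2
    then show ?thesis unfolding restr sum_states by (simp add: wt_def pot_def loss_def gain_def)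
  next
    case 3
    then show ?thesis unfolding restr sum_states using phi_bounds
      by (simp add: wt_def pot_def loss_def gain_def one_two_eq_Suc power2_eq_square)
  next
    case 4
    then show ?thesis unfolding restr sum_states using phi_bounds phi_sq
      by (simp add: wt_def pot_def loss_def gain_def eval_nat_numeral)
  next
    case 5
    have "sum wt ?B \<le> sum wt ?A" "sum wt ?C \<le> sum wt ?A"
      by (intro sum_mono2; auto simp: wt_nonneg)+
    then show ?thesis using sum_wt_states_le[of L] 5 by (simp add: pot_def loss_def gain_def)
  qed
  then show "sum wt ?A \<le> 2.6 ^ L * loss L" "(\<Sum>t\<in>?A. wt t * pot L t) \<le> 2.6 ^ L * loss L"
    "sum wt ?B \<le> 2.6 ^ L * gain L" "(\<Sum>t\<in>?B. wt t * pot L t) \<le> 2.6 ^ L * gain L"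
    "sum wt ?C \<le> 2.6 ^ L * (gain L)\<^sup>2" "(\<Sum>t\<in>?C. wt t * pot L t) \<le> 2.6 ^ L * (gain L)\<^sup>2"
    by auto
qed

lemma gain_loss: "gain (Suc L) * loss L \<le> 1" "0 < gain L" "gain L \<le> 1" "0 < loss L" "1 \<le> loss L" "loss L \<le> 1.16"
  by (auto simp: gain_def loss_def)

section \<open>Profiles of class sizes, folded at the middle\<close>

text \<open>A profile lists the sizes of consecutive residue classes of equal height
  \<open>L\<close>. The mirror bound is the trace of \<open>k\<close> not being a sum;
  \<open>G\<close> marks the classes that miss their lowest representative because it lies strictly
  between 0 and \<open>d\<close>.\<close>

definition profiles :: "nat \<Rightarrow> nat \<Rightarrow> nat set \<Rightarrow> (nat \<Rightarrow> nat) set" where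
  "profiles n L G = {b \<in> PiE {..<n} (\<lambda>_. {..L}).
     (\<forall>r<n. b r + b (n - 1 - r) \<le> L) \<and> (\<forall>r<n. r \<in> G \<longrightarrow> b r \<le> L - 1)}"

text \<open>At a drop, adding \<open>d\<close> produces a sum in a class that contains no element of
  the shape.\<close>

definition drops :: "nat \<Rightarrow> nat \<Rightarrow> (nat \<Rightarrow> nat) \<Rightarrow> nat set" where
  "drops n d b = {r. d \<le> r \<and> r < n \<and> b r = 0 \<and> 1 \<le> b (r - d)}"

definition start_factor :: "nat \<Rightarrow> nat \<Rightarrow> nat set \<Rightarrow> nat \<Rightarrow> real" where
  "start_factor L n G i = (if i \<in> G then if n - 1 - i \<in> G then (gain L)\<^sup>2 else gain L else loss L)"

lemma finite_profiles: "finite (profiles n L G)"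
  unfolding profiles_def by (rule finite_Collect_conjI) (simp add: finite_PiE)

lemma start_sum:
  assumes u: "u = pot L \<or> u = (\<lambda>_. 1)"
  shows "(\<Sum>t\<in>{t \<in> states L. (i \<in> G \<longrightarrow> fst t \<le> L - 1) \<and> (n - 1 - i \<in> G \<longrightarrow> snd t \<le> L - 1)}. wt t * u t)
     \<le> 2.6 ^ L * start_factor L n G i" (is "sum _ ?Q \<le> _")
proof (cases "i \<in> G")
  case True
  show ?thesis
  proof (cases "n - 1 - i \<in> G")
    case 1: True
    have "?Q = states L \<inter> {t. fst t \<le> L - 1 \<and> snd t \<le> L - 1}" using True 1 by auto
    then show ?thesis using u pot_start(5,6)[of L] True 1 by (auto simp: start_factor_def)
  next
    case False
    have "?Q = states L \<inter> {t. fst t \<le> L - 1}" using True False by auto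
    then show ?thesis using u pot_start(3,4)[of L] True False by (auto simp: start_factor_def)
  qed
next
  case False
  have "sum (\<lambda>t. wt t * u t) ?Q \<le> (\<Sum>t\<in>states L. wt t * u t)"
    using u by (intro sum_mono2) (auto simp: wt_nonneg pot_nonneg)
  then show ?thesis using u pot_start(1,2)[of L] False by (auto simp: start_factor_def)
qed

text \<open>Folding turns a profile into states \<open>(b i, b (n - 1 - i))\<close>, to which the
  chain bound applies. It can only increase the weight: for odd \<open>n\<close> the central class
  is counted twice, and drops across the middle are ignored, although each of them would contribute
  a factor \<open>phi - 1 < 1\<close>.\<close>

lemma profile_sum_le:
  assumes d: "0 < d"
  shows "(\<Sum>b\<in>profiles n L G. phi ^ (\<Sum>r<n. b r - 1) * (phi - 1) ^ card (drops n d b))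
      \<le> (\<Prod>i<(n + 1) div 2. 2.6 ^ L * (if i < d then start_factor L n G i else 1))"
proof -
  define h where "h = (n + 1) div 2"
  define Q where "Q i = {t \<in> states L. (i \<in> G \<longrightarrow> fst t \<le> L - 1) \<and> (n - 1 - i \<in> G \<longrightarrow> snd t \<le> L - 1)}" for i
  define u where "u i = (if i + d < h then pot L else (\<lambda>_. 1))" for i
  define c where "c i = 2.6 ^ L * (if i < d then start_factor L n G i else 1)" for i
  define F where "F s = (\<Prod>i<h. if i < d then wt (s i) else trans_wt (s (i - d)) (s i))" for s
  define enc where "enc b = (\<lambda>i\<in>{..<h}. (b i, b (n - 1 - i)))" for b :: "nat \<Rightarrow> nat"
  have F0: "0 \<le> F s" for s by (auto simp: F_def wt_nonneg trans_wt_nonneg intro!: prod_nonneg)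
  have finQ: "finite (Q i)" for i by (simp add: Q_def)
  have chain: "(\<Sum>s\<in>PiE {..<h} Q. F s) \<le> (\<Prod>i<h. c i)"
    unfolding F_def
  proof (rule chain_sum_le[where u = u])
    show "0 \<le> u i b" for i b by (simp add: u_def pot_nonneg)
    show "0 \<le> c i" for i using gain_loss(2,4)[of L] by (auto simp: c_def start_factor_def)
    show "(\<Sum>b\<in>Q i. wt b * u i b) \<le> c i" if "i < d" for i
      unfolding Q_def c_def using start_sum[of "u i" L i G n] that by (auto simp: u_def)
    show "(\<Sum>b\<in>Q i. trans_wt a b * u i b) \<le> c i * u (i - d) a"
      if i: "i < h" "d \<le> i" and a: "a \<in> Q (i - d)" for i a
    proof -
      have "(\<Sum>b\<in>Q i. trans_wt a b * u i b) \<le> (\<Sum>b\<in>states L. trans_wt a b * u i b)"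
        by (intro sum_mono2) (auto simp: Q_def u_def pot_nonneg trans_wt_nonneg)
      also have "\<dots> \<le> 2.6 ^ L * pot L a"
        using a pot_step[of a L] by (auto simp: u_def Q_def)
      finally show ?thesis using i by (simp add: u_def c_def)
    qed
  qed (use d in \<open>auto simp: finQ wt_nonneg trans_wt_nonneg u_def\<close>)
  have weight: "phi ^ (\<Sum>r<n. b r - 1) * (phi - 1) ^ card (drops n d b) \<le> F (enc b)" for b
  proof -
    define pen where "pen i = (if i < d then 0 else
        of_bool (1 \<le> b (i - d) \<and> b i = 0) + of_bool (b (n - 1 - (i - d)) = 0 \<and> 1 \<le> b (n - 1 - i)) :: nat)" for i
    define e where "e i = (b i - 1) + (b (n - 1 - i) - 1)" for i
    have "F (enc b) = (\<Prod>i<h. phi ^ e i * (phi - 1) ^ pen i)"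
      unfolding F_def by (rule prod.cong) (auto simp: enc_def e_def pen_def wt_def trans_wt_def)
    also have "\<dots> = phi ^ (\<Sum>i<h. e i) * (phi - 1) ^ (\<Sum>i<h. pen i)"
      by (simp add: prod.distrib power_sum)
    finally have F_eq: "F (enc b) = phi ^ (\<Sum>i<h. e i) * (phi - 1) ^ (\<Sum>i<h. pen i)" .
    have "(\<Sum>r<n. b r - 1) \<le> (\<Sum>r\<in>{..<h} \<union> (\<lambda>i. n - 1 - i) ` {..<h}. b r - 1)"
    proof (rule sum_mono2)
      show "{..<n} \<subseteq> {..<h} \<union> (\<lambda>i. n - 1 - i) ` {..<h}"
      proof
        fix r assume r: "r \<in> {..<n}"
        show "r \<in> {..<h} \<union> (\<lambda>i. n - 1 - i) ` {..<h}"
        proof (cases "r < h")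
          case False
          then have "r = n - 1 - (n - 1 - r)" "n - 1 - r < h" using r by (auto simp: h_def)
          then show ?thesis by blast
        qed simp
      qed
    qed auto
    also have "\<dots> \<le> (\<Sum>r<h. b r - 1) + (\<Sum>r\<in>(\<lambda>i. n - 1 - i) ` {..<h}. b r - 1)"
      by (rule sum_Un_nat[THEN eq_refl, THEN order_trans]) auto
    also have "(\<Sum>r\<in>(\<lambda>i. n - 1 - i) ` {..<h}. b r - 1) \<le> (\<Sum>i<h. b (n - 1 - i) - 1)"
      by (rule sum_image_le[unfolded o_def]) auto
    finally have e_le: "(\<Sum>r<n. b r - 1) \<le> (\<Sum>i<h. e i)"
      by (simp add: e_def sum.distrib)
    define X where "X = {d..<h} \<inter> {i. 1 \<le> b (i - d) \<and> b i = 0}"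
    define Y where "Y = {d..<h} \<inter> {i. b (n - 1 - (i - d)) = 0 \<and> 1 \<le> b (n - 1 - i)}"
    have "(\<Sum>i<h. pen i) = (\<Sum>i\<in>{d..<h}. pen i)"
      by (rule sum.mono_neutral_right) (auto simp: pen_def)
    also have "\<dots> = (\<Sum>i\<in>{d..<h}. of_bool (1 \<le> b (i - d) \<and> b i = 0))
        + (\<Sum>i\<in>{d..<h}. of_bool (b (n - 1 - (i - d)) = 0 \<and> 1 \<le> b (n - 1 - i)))"
      by (simp add: pen_def sum.distrib)
    also have "\<dots> = card X + card Y"
      by (simp only: X_def Y_def sum_of_bool_eq finite_atLeastLessThan of_nat_id)
    \<comment> \<open>A drop read backwards between steps \<open>i - d\<close> and \<open>i\<close>
      sits at position \<open>n - 1 - (i - d)\<close>. This is at least \<open>h\<close> because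
      \<open>d > 0\<close>, hence distinct from the positions in \<open>X\<close>.\<close>
    also have "card Y = card ((\<lambda>i. n - 1 - (i - d)) ` Y)"
      by (rule card_image[symmetric]) (auto simp: inj_on_def Y_def h_def)
    also have "card X + card ((\<lambda>i. n - 1 - (i - d)) ` Y) = card (X \<union> (\<lambda>i. n - 1 - (i - d)) ` Y)"
      using d by (intro card_Un_disjoint[symmetric]) (auto simp: X_def Y_def h_def)
    also have "\<dots> \<le> card (drops n d b)"
    proof (rule card_mono)
      show "X \<union> (\<lambda>i. n - 1 - (i - d)) ` Y \<subseteq> drops n d b"
      proof (intro Un_least image_subsetI)
        show "X \<subseteq> drops n d b" by (auto simp: X_def drops_def h_def)
      next
        fix i assume i: "i \<in> Y"
        then have "n - 1 - (i - d) - d = n - 1 - i" by (auto simp: Y_def)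
        then show "n - 1 - (i - d) \<in> drops n d b"
          using i d by (auto simp: Y_def drops_def h_def)
      qed
      show "finite (drops n d b)" by (rule finite_subset[of _ "{..<n}"]) (auto simp: drops_def)
    qed
    finally have "(\<Sum>i<h. pen i) \<le> card (drops n d b)" .
    then show ?thesis
      unfolding F_eq using phi_bounds e_le
      by (intro mult_mono power_increasing power_decreasing) auto
  qed
  have inj: "inj_on enc (profiles n L G)"
  proof (rule inj_onI)
    fix b b' assume b: "b \<in> profiles n L G" "b' \<in> profiles n L G" and eq: "enc b = enc b'"
    have *: "b i = b' i" "b (n - 1 - i) = b' (n - 1 - i)" if "i < h" for i
      using fun_cong[OF eq, of i] that by (auto simp: enc_def)
    have "b r = b' r" if r: "r < n" for r
    proof (cases "r < h")
      case False
      then have "r = n - 1 - (n - 1 - r)" "n - 1 - r < h" using r by (auto simp: h_def)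
      then show ?thesis using *(2) by metis
    qed (use * in auto)
    then show "b = b'" using b unfolding profiles_def by (auto intro: PiE_ext)
  qed
  have img: "enc ` profiles n L G \<subseteq> PiE {..<h} Q"
    by (auto simp: enc_def profiles_def Q_def states_def h_def)
  have "(\<Sum>b\<in>profiles n L G. phi ^ (\<Sum>r<n. b r - 1) * (phi - 1) ^ card (drops n d b))
      \<le> (\<Sum>b\<in>profiles n L G. F (enc b))"
    by (intro sum_mono weight)
  also have "\<dots> = (\<Sum>s\<in>enc ` profiles n L G. F s)"
    by (simp add: sum.reindex[OF inj])
  also have "\<dots> \<le> (\<Sum>s\<in>PiE {..<h} Q. F s)"
    by (intro sum_mono2 img finite_PiE) (auto simp: finQ F0)
  also note chain
  finally show ?thesis by (simp add: c_def h_def)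
qed

section \<open>Shapes of the small elements\<close>

text \<open>For a semigroup of multiplicity \<open>m\<close> and Frobenius number \<open>2 m + k\<close> the shape is
  \<open>A = {a \<le> k. m + a \<in> S}\<close>. Of the \<open>m - 1\<close> numbers strictly between \<open>m + k\<close> and \<open>2 m + k\<close>, exactly
  \<open>forced A m k\<close> are sums of two elements of \<open>m + A\<close>. The parameter \<open>d\<close> of \<open>shapes\<close> is the least nonzero
  element of \<open>A\<close>, or \<open>k + 1\<close> if there is none.\<close>

definition forced :: "nat set \<Rightarrow> nat \<Rightarrow> nat \<Rightarrow> nat" where
  "forced A m k = card {y. (\<exists>a\<in>A. \<exists>b\<in>A. y = a + b) \<and> y < k \<and> k < y + m}"

definition shapes :: "nat \<Rightarrow> nat \<Rightarrow> nat \<Rightarrow> nat set set" where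
  "shapes m k d = {A. A \<subseteq> {..k} \<and> 0 \<in> A \<and> (\<forall>a\<in>A. a + m \<le> k \<longrightarrow> a + m \<in> A) \<and> (\<forall>a\<in>A. k - a \<notin> A)
      \<and> (\<forall>a. 0 < a \<and> a < d \<longrightarrow> a \<notin> A) \<and> (d \<le> k \<longrightarrow> d \<in> A)}"

definition rescount :: "nat \<Rightarrow> nat set \<Rightarrow> nat \<Rightarrow> nat" where
  "rescount m A r = card {a \<in> A. a mod m = r}"

definition height :: "nat \<Rightarrow> nat \<Rightarrow> nat \<Rightarrow> nat" where
  "height m k r = (if r \<le> k mod m then Suc (k div m) else k div m)"

lemma sum_lessThan_add:
  fixes f :: "nat \<Rightarrow> nat"
  shows "(\<Sum>r<a + c. f r) = (\<Sum>r<a. f r) + (\<Sum>i<c. f (a + i))"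
  by (induction c) auto

lemma upward_closed_eq:
  assumes "J \<subseteq> {..<L::nat}" "\<And>j. j \<in> J \<Longrightarrow> Suc j < L \<Longrightarrow> Suc j \<in> J"
  shows "J = {L - card J..<L}"
proof (cases "J = {}")
  case False
  have fin: "finite J" using assms(1) finite_subset by blast
  define j0 where "j0 = Min J"
  have j0: "j0 \<in> J" using False fin by (simp add: j0_def)
  then have lt: "j0 < L" using assms(1) by auto
  have "j0 + i \<in> J" if "j0 + i < L" for i
    using that by (induction i) (use j0 assms(2) in auto)
  then have "{j0..<L} \<subseteq> J" by (metis atLeastLessThan_iff le_add_diff_inverse subsetI)
  moreover have "J \<subseteq> {j0..<L}" using assms(1) fin by (auto simp: j0_def)
  ultimately have "J = {j0..<L}" by blast
  then show ?thesis using lt by auto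
qed (use assms in auto)

lemma row_le_iff:
  assumes "r < m"
  shows "r + j * m \<le> k \<longleftrightarrow> j < height m k r"
proof -
  define q l where "q = k mod m" and "l = k div m"
  have k: "k = q + l * m" by (simp add: q_def l_def)
  have q: "q < m" using assms by (simp add: q_def)
  show ?thesis
  proof (cases "j < Suc l")
    case True
    show ?thesis
    proof (cases "j = l")
      case False
      then have "Suc j * m \<le> l * m" using True by (intro mult_right_mono) auto
      then have "r + j * m \<le> k" using assms k by simp
      then show ?thesis using True False by (auto simp: height_def l_def[symmetric])
    next
      case True
      then show ?thesis unfolding height_def q_def[symmetric] l_def[symmetric] using k by simp
    qed
  next
    case False
    then have "Suc l * m \<le> j * m" by (intro mult_right_mono) auto
    then have "\<not> r + j * m \<le> k" using q k by simp
    then show ?thesis using False by (auto simp: height_def l_def[symmetric])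
  qed
qed

text \<open>Adding \<open>m\<close> stays inside the shape as long as \<open>k\<close> is not
  exceeded, so each class is a top segment of its representatives and is determined by its
  size.\<close>

lemma row_structure:
  assumes A: "A \<in> shapes m k d" and r: "r < m"
  shows "{a \<in> A. a mod m = r} = (\<lambda>j. r + j * m) ` {height m k r - rescount m A r..<height m k r}"
    and "rescount m A r \<le> height m k r"
proof -
  define J where "J = {j. r + j * m \<in> A}"
  have Ak: "A \<subseteq> {..k}" and up: "\<And>a. a \<in> A \<Longrightarrow> a + m \<le> k \<Longrightarrow> a + m \<in> A"
    using A by (auto simp: shapes_def)
  have JL: "J \<subseteq> {..<height m k r}"
    using Ak row_le_iff[OF r] by (auto simp: J_def)
  have img: "{a \<in> A. a mod m = r} = (\<lambda>j. r + j * m) ` J"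
  proof (rule set_eqI, rule iffI)
    fix a assume "a \<in> {a \<in> A. a mod m = r}"
    moreover from this have "a = r + (a div m) * m" by (auto simp: mult.commute)
    ultimately show "a \<in> (\<lambda>j. r + j * m) ` J" unfolding J_def by (metis (mono_tags, lifting) image_eqI mem_Collect_eq)
  qed (use r in \<open>auto simp: J_def\<close>)
  have inj: "inj_on (\<lambda>j. r + j * m) J" using r by (auto simp: inj_on_def)
  have c: "rescount m A r = card J" unfolding rescount_def img by (rule card_image[OF inj])
  have "J = {height m k r - card J..<height m k r}"
  proof (rule upward_closed_eq[OF JL])
    fix j assume "j \<in> J" "Suc j < height m k r"
    then show "Suc j \<in> J"
      using up[of "r + j * m"] row_le_iff[OF r, of "Suc j" k] by (simp add: J_def algebra_simps)
  qed
  then show "{a \<in> A. a mod m = r} = (\<lambda>j. r + j * m) ` {height m k r - rescount m A r..<height m k r}"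
    using img c by metis
  show "rescount m A r \<le> height m k r"
    unfolding c using card_mono[OF _ JL] by simp
qed

lemma row_memI:
  assumes "A \<in> shapes m k d" "r < m" "j < height m k r" "height m k r \<le> j + rescount m A r"
  shows "r + j * m \<in> A"
proof -
  have "r + j * m \<in> (\<lambda>j. r + j * m) ` {height m k r - rescount m A r..<height m k r}"
    using assms by auto
  then show ?thesis using row_structure(1)[OF assms(1,2)] by auto
qed

lemma sum_rescount:
  assumes "A \<in> shapes m k d" "0 < m"
  shows "(\<Sum>r<m. rescount m A r) = card A"
proof -
  have fin: "finite A" using assms finite_subset by (auto simp: shapes_def)
  have "card A = card (\<Union>r\<in>{..<m}. {a \<in> A. a mod m = r})"
    using assms by (intro arg_cong[of _ _ card]) auto
  also have "\<dots> = (\<Sum>r<m. rescount m A r)"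
    unfolding rescount_def by (rule card_UN_disjoint) (use fin in auto)
  finally show ?thesis by simp
qed

text \<open>If the two top segments had more than \<open>L\<close> elements together, the lowest
  element \<open>r + i * m\<close> of the one would be matched by \<open>s + j * m\<close> in the
  other with \<open>i + j = L - 1\<close>: two elements with sum \<open>k\<close>.\<close>

lemma row_pair:
  assumes A: "A \<in> shapes m k d" and r: "r < m" "s < m" and h: "height m k r = L" "height m k s = L"
    and k: "r + s + (L - 1) * m = k"
  shows "rescount m A r + rescount m A s \<le> L"
proof (rule ccontr)
  assume c: "\<not> ?thesis"
  have b: "rescount m A r \<le> L" "rescount m A s \<le> L" using row_structure(2)[OF A r(1)] row_structure(2)[OF A r(2)] h by auto
  define i j where "i = L - rescount m A r" and "j = rescount m A r - 1"
  have ij: "i + j = L - 1" using b c by (auto simp: i_def j_def)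
  have "r + i * m \<in> A" "s + j * m \<in> A"
    by (rule row_memI[OF A]; use b c r h in \<open>auto simp: i_def j_def\<close>)+
  moreover have "k - (r + i * m) = s + j * m"
    unfolding k[symmetric] ij[symmetric] by (simp add: algebra_simps)
  ultimately show False using A by (auto simp: shapes_def)
qed

lemma row_good:
  assumes A: "A \<in> shapes m k d" and r: "0 < r" "r < d" "r < m"
  shows "rescount m A r \<le> height m k r - 1"
proof (rule ccontr)
  assume c: "\<not> ?thesis"
  then have "r + 0 * m \<in> A" by (intro row_memI[OF A]) (use r row_structure(2)[OF A r(3)] in auto)
  then show False using A r by (auto simp: shapes_def)
qed

text \<open>Residues \<open>r \<le> k mod m\<close> have \<open>k div m + 1\<close> representatives up to \<open>k\<close>, the others \<open>k div m\<close>; the reflection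
  \<open>a \<mapsto> k - a\<close> preserves both kinds.\<close>

definition low_rows where "low_rows m k A = (\<lambda>r\<in>{..<k mod m + 1}. rescount m A r)"
definition high_rows where "high_rows m k A = (\<lambda>i\<in>{..<m - 1 - k mod m}. rescount m A (k mod m + 1 + i))"

lemma low_rows_profiles:
  assumes A: "A \<in> shapes m k d" and "0 < m"
  shows "low_rows m k A \<in> profiles (k mod m + 1) (k div m + 1) {1..<d}"
proof -
  have q: "k mod m < m" using assms by simp
  have "rescount m A r + rescount m A (k mod m - r) \<le> Suc (k div m)" if "r \<le> k mod m" for r
    by (rule row_pair[OF A]) (use that q in \<open>auto simp: height_def\<close>)
  moreover have "rescount m A r \<le> Suc (k div m)" if "r \<le> k mod m" for r
    using row_structure(2)[OF A, of r] that q by (simp add: height_def)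
  moreover have "rescount m A r \<le> k div m" if "r \<le> k mod m" "1 \<le> r" "r < d" for r
    using row_good[OF A, of r] that q by (simp add: height_def)
  ultimately show ?thesis by (auto simp: profiles_def low_rows_def)
qed

lemma high_rows_profiles:
  assumes A: "A \<in> shapes m k d" and "0 < m"
  shows "high_rows m k A \<in> profiles (m - 1 - k mod m) (k div m) {i. k mod m + 1 + i < d}"
proof -
  define q where "q = k mod m"
  have q: "q < m" using assms by (simp add: q_def)
  have b: "rescount m A (q + 1 + i) \<le> k div m" if "i < m - 1 - q" for i
    using row_structure(2)[OF A, of "q + 1 + i"] that q by (simp add: height_def q_def)
  have p: "rescount m A (q + 1 + i) + rescount m A (q + 1 + (m - 1 - q - 1 - i)) \<le> k div m" if "i < m - 1 - q" for i
  proof (cases "k div m = 0")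
    case True
    then show ?thesis using b[of i] b[of "m - 1 - q - 1 - i"] that by simp
  next
    case False
    then obtain l where l: "k div m = Suc l" by (cases "k div m") auto
    have k: "q + Suc l * m = k" unfolding q_def l[symmetric] by simp
    have "q + 1 + i + (q + 1 + (m - 1 - q - 1 - i)) + (k div m - 1) * m = q + Suc l * m"
      using that q l by simp
    then show ?thesis
      unfolding k by (intro row_pair[OF A]) (use that q in \<open>auto simp: height_def q_def[symmetric]\<close>)
  qed
  have g: "rescount m A (q + 1 + i) \<le> k div m - 1" if "i < m - 1 - q" "q + 1 + i < d" for i
    using row_good[OF A, of "q + 1 + i"] that q by (simp add: height_def q_def)
  show ?thesis unfolding profiles_def high_rows_def q_def[symmetric] using b p g by auto
qed

lemma finite_shapes [simp]: "finite (shapes m k d)"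
  by (rule finite_subset[of _ "Pow {..k}"]) (auto simp: shapes_def)

text \<open>Each occupied class contributes its top \<open>top r = top r + 0\<close> to the forced
  sums, and each drop contributes \<open>top (r - d) + d\<close>, the top position of an empty
  class. These sums are distinct, lie in the last period before \<open>k\<close>, and miss
  \<open>k\<close> because \<open>k\<close> is no sum. An occupied class thus pays for one of its
  elements, and the drops are a surplus.\<close>

lemma card_shape_le:
  assumes A: "A \<in> shapes m k d" and d: "0 < d" "d \<le> m"
  defines "q \<equiv> k mod m"
  shows "card A + card (drops (q + 1) d (low_rows m k A)) + card (drops (m - 1 - q) d (high_rows m k A))
     \<le> forced A m k + (\<Sum>r<q + 1. low_rows m k A r - 1) + (\<Sum>r<m - 1 - q. high_rows m k A r - 1)"
proof -
  have m: "0 < m" using d by simp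
  have q: "q < m" using m by (simp add: q_def)
  have Ak: "A \<subseteq> {..k}" "0 \<in> A" "\<And>a. a \<in> A \<Longrightarrow> k - a \<notin> A" using A by (auto simp: shapes_def)
  define b where "b = rescount m A"
  define D1 where "D1 = drops (q + 1) d (low_rows m k A)"
  define D2 where "D2 = (\<lambda>i. q + 1 + i) ` drops (m - 1 - q) d (high_rows m k A)"
  define R where "R = {r. r < m \<and> 1 \<le> b r}"
  define top where "top r = r + (height m k r - 1) * m" for r
  have D1: "r \<le> q \<and> d \<le> r \<and> b r = 0 \<and> 1 \<le> b (r - d) \<and> d \<in> A \<and> height m k (r - d) = height m k r" if "r \<in> D1" for r
  proof -
    have r: "r \<le> q" "d \<le> r" "b r = 0" "1 \<le> b (r - d)"
      using that unfolding D1_def drops_def low_rows_def b_def q_def[symmetric]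
      by (auto split: if_splits)
    moreover from this have "d \<le> k" using mod_less_eq_dividend[of k m] unfolding q_def by linarith
    ultimately show ?thesis using A by (auto simp: shapes_def height_def q_def)
  qed
  have D2: "q < r \<and> r < m \<and> d \<le> r \<and> b r = 0 \<and> 1 \<le> b (r - d) \<and> d \<in> A \<and> height m k (r - d) = height m k r" if "r \<in> D2" for r
  proof -
    obtain i where i: "r = q + 1 + i" "i \<in> drops (m - 1 - q) d (high_rows m k A)"
      using \<open>r \<in> D2\<close> unfolding D2_def by blast
    then have i': "d \<le> i" "i < m - 1 - q" "high_rows m k A i = 0" "1 \<le> high_rows m k A (i - d)"
      by (auto simp: drops_def)
    have "high_rows m k A j = b (q + 1 + j)" if "j < m - 1 - q" for j
      using that by (simp add: high_rows_def b_def q_def)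
    moreover have rd: "r - d = q + 1 + (i - d)" "i - d < m - 1 - q" using i i' by auto
    ultimately have "b r = 0" "1 \<le> b (r - d)" using i i' by (simp_all only: rd)
    moreover have "q < r - d" "r < m" "d \<le> r" using i i' rd by auto
    ultimately have r: "q < r - d" "r < m" "d \<le> r" "b r = 0" "1 \<le> b (r - d)" by auto
    \<comment> \<open>An occupied upper class has positive height, hence \<open>m \<le> k\<close>;
      then \<open>d \<le> m \<le> k\<close>, so \<open>d\<close> is a genuine element of the shape
      and not the default \<open>k + 1\<close>.\<close>
    have "b (r - d) \<le> height m k (r - d)" using row_structure(2)[OF A, of "r - d"] r by (simp add: b_def)
    then have "1 \<le> k div m" using r by (auto simp: height_def q_def split: if_splits)
    then have "m \<le> k" by (metis div_greater_zero_iff less_eq_Suc_le One_nat_def)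
    then show ?thesis using A r d by (auto simp: shapes_def height_def q_def)
  qed
  have height_pos: "1 \<le> height m k r" if "1 \<le> b r" "r < m" for r
    using row_structure(2)[OF A that(2)] that by (simp add: b_def)
  have top_mem: "top r \<in> A" if "1 \<le> b r" "r < m" for r
    unfolding top_def using that height_pos[OF that] by (intro row_memI[OF A]) (auto simp: b_def)
  have H: "\<exists>a\<in>A. \<exists>b\<in>A. top r = a + b" "1 \<le> height m k r" "r < m" if "r \<in> R \<union> (D1 \<union> D2)" for r
  proof -
    have "(\<exists>a\<in>A. \<exists>b\<in>A. top r = a + b) \<and> 1 \<le> height m k r \<and> r < m"
    proof (cases "r \<in> R")
      case True
      then have "top r \<in> A" "1 \<le> height m k r" "r < m"
        using top_mem[of r] height_pos[of r] by (auto simp: R_def)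
      moreover have "top r = top r + 0" by simp
      ultimately show ?thesis using Ak(2) by blast
    next
      case False
      then have *: "d \<le> r" "1 \<le> b (r - d)" "d \<in> A" "height m k (r - d) = height m k r" "r < m"
        using that D1[of r] D2[of r] q by auto
      have "top r = top (r - d) + d" using * by (simp add: top_def)
      then show ?thesis using * top_mem[of "r - d"] height_pos[of "r - d"] by auto
    qed
    then show "\<exists>a\<in>A. \<exists>b\<in>A. top r = a + b" "1 \<le> height m k r" "r < m" by auto
  qed
  have "card R + (card D1 + card D2) = card (R \<union> (D1 \<union> D2))"
  proof -
    have fin: "finite D1" "finite D2" "finite R"
      by (rule finite_subset[of _ "{..<m}"]; use D1 D2 q in \<open>force simp: R_def\<close>)+
    have "D1 \<inter> D2 = {}" using D1 D2 by fastforce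
    moreover have "R \<inter> (D1 \<union> D2) = {}" using D1 D2 by (fastforce simp: R_def)
    ultimately show ?thesis using fin by (simp add: card_Un_disjoint)
  qed
  also have "\<dots> = card (top ` (R \<union> (D1 \<union> D2)))"
  proof (rule card_image[symmetric], rule inj_onI)
    fix r s assume "r \<in> R \<union> (D1 \<union> D2)" "s \<in> R \<union> (D1 \<union> D2)" "top r = top s"
    moreover have "top r mod m = r" if "r < m" for r using that by (simp add: top_def)
    ultimately show "r = s" using H(3) by metis
  qed
  also have "\<dots> \<le> forced A m k"
    unfolding forced_def
  proof (rule card_mono)
    show "top ` (R \<union> (D1 \<union> D2)) \<subseteq> {y. (\<exists>a\<in>A. \<exists>b\<in>A. y = a + b) \<and> y < k \<and> k < y + m}"
    proof (rule image_subsetI)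
      fix r assume r: "r \<in> R \<union> (D1 \<union> D2)"
      have "top r \<le> k" unfolding top_def using H(2,3)[OF r] by (subst row_le_iff) auto
      moreover have "\<not> r + height m k r * m \<le> k" using H(3)[OF r] by (subst row_le_iff) auto
      then have "k < top r + m" using H(2)[OF r] by (cases "height m k r") (auto simp: top_def)
      moreover have "top r \<noteq> k" using H(1)[OF r] Ak(3) by (metis diff_add_inverse)
      ultimately show "top r \<in> {y. (\<exists>a\<in>A. \<exists>b\<in>A. y = a + b) \<and> y < k \<and> k < y + m}"
        using H(1)[OF r] by auto
    qed
  qed (auto intro: finite_subset[of _ "{..<k}"])
  finally have *: "card R + (card D1 + card D2) \<le> forced A m k" .
  have "card A = (\<Sum>r<m. b r)" using sum_rescount[OF A m] by (simp add: b_def)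
  also have "\<dots> = (\<Sum>r<m. (b r - 1) + of_bool (1 \<le> b r))" by (rule sum.cong) auto
  also have "\<dots> = (\<Sum>r<m. b r - 1) + card ({..<m} \<inter> {r. 1 \<le> b r})"
    by (simp only: sum.distrib sum_of_bool_eq finite_lessThan of_nat_id)
  also have "{..<m} \<inter> {r. 1 \<le> b r} = R" by (auto simp: R_def)
  also have "(\<Sum>r<m. b r - 1) = (\<Sum>r<(q + 1) + (m - 1 - q). b r - 1)" using q by simp
  also have "\<dots> = (\<Sum>r<q + 1. b r - 1) + (\<Sum>i<m - 1 - q. b (q + 1 + i) - 1)"
    by (rule sum_lessThan_add)
  finally have "card A = (\<Sum>r<q + 1. b r - 1) + (\<Sum>i<m - 1 - q. b (q + 1 + i) - 1) + card R" .
  moreover have "(\<Sum>r<q + 1. b r - 1) = (\<Sum>r<q + 1. low_rows m k A r - 1)"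
    by (rule sum.cong) (auto simp: low_rows_def b_def q_def)
  moreover have "(\<Sum>i<m - 1 - q. b (q + 1 + i) - 1) = (\<Sum>i<m - 1 - q. high_rows m k A i - 1)"
    by (rule sum.cong) (auto simp: high_rows_def b_def q_def)
  moreover have "card D2 = card (drops (m - 1 - q) d (high_rows m k A))"
    unfolding D2_def by (rule card_image) (auto simp: inj_on_def)
  ultimately show ?thesis using * by (simp add: D1_def)
qed

text \<open>A shape is recovered from its class sizes. After discarding the drops between lower and
  upper classes the weight bound factorises, so the two profiles can be summed
  independently.\<close>

lemma shapes_sum_le_prod:
  fixes m k d :: nat
  assumes d: "0 < d" "d \<le> m"
  defines "q \<equiv> k mod m" and "l \<equiv> k div m"
  shows "(\<Sum>A\<in>shapes m k d. phi ^ card A / phi ^ forced A m k)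
    \<le> (\<Prod>i<(q + 2) div 2. 2.6 ^ (l + 1) * (if i < d then start_factor (l + 1) (q + 1) {1..<d} i else 1))
      * (\<Prod>i<(m - q) div 2. 2.6 ^ l * (if i < d then start_factor l (m - 1 - q) {i. q + 1 + i < d} i else 1))"
proof -
  define V where "V n b = phi ^ (\<Sum>r<n. b r - 1) * (phi - 1) ^ card (drops n d b)" for n b
  define enc where "enc A = (low_rows m k A, high_rows m k A)" for A
  define P1 P2 where "P1 = profiles (q + 1) (l + 1) {1..<d}" and "P2 = profiles (m - 1 - q) l {i. q + 1 + i < d}"
  have m: "0 < m" using d by simp
  have q: "q < m" using m by (simp add: q_def)
  have V0: "0 \<le> V n b" for n b using phi_gt_1 by (simp add: V_def)
  have weight: "phi ^ card A / phi ^ forced A m k \<le> V (q + 1) (low_rows m k A) * V (m - 1 - q) (high_rows m k A)"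
    if A: "A \<in> shapes m k d" for A
  proof -
    define s1 s2 d1 d2 where "s1 = (\<Sum>r<q + 1. low_rows m k A r - 1)" and "s2 = (\<Sum>r<m - 1 - q. high_rows m k A r - 1)"
      and "d1 = card (drops (q + 1) d (low_rows m k A))" and "d2 = card (drops (m - 1 - q) d (high_rows m k A))"
    have "card A + d1 + d2 \<le> forced A m k + s1 + s2"
      using card_shape_le[OF A d] by (simp add: s1_def s2_def d1_def d2_def q_def)
    then have "phi ^ (card A + d1 + d2) \<le> phi ^ (forced A m k + s1 + s2)"
      using phi_ge_1 by (rule power_increasing)
    then show ?thesis
      unfolding V_def s1_def[symmetric] s2_def[symmetric] d1_def[symmetric] d2_def[symmetric] inverse_phi[symmetric]
      using phi_pos by (simp add: power_add power_divide field_simps)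
  qed
  have inj: "inj_on enc (shapes m k d)"
  proof (rule inj_onI)
    fix A B assume AB: "A \<in> shapes m k d" "B \<in> shapes m k d" and eq: "enc A = enc B"
    have low: "low_rows m k A = low_rows m k B" and high: "high_rows m k A = high_rows m k B"
      using eq by (auto simp: enc_def)
    have row_eq: "rescount m A r = rescount m B r" if r: "r < m" for r
    proof (cases "r \<le> q")
      case True
      then show ?thesis using fun_cong[OF low, of r] by (simp add: low_rows_def q_def)
    next
      case False
      then have "r - (q + 1) < m - 1 - q" "q + 1 + (r - (q + 1)) = r" using r by auto
      then show ?thesis
        using fun_cong[OF high, of "r - (q + 1)"] unfolding high_rows_def q_def[symmetric] by auto
    qed
    have "{a \<in> A. a mod m = r} = {a \<in> B. a mod m = r}" if r: "r < m" for r
      using row_structure(1)[OF AB(1) r] row_structure(1)[OF AB(2) r] row_eq[OF r] by simp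
    then have "a \<in> A \<longleftrightarrow> a \<in> B" for a using mod_less_divisor[OF m, of a] by blast
    then show "A = B" by blast
  qed
  have img: "enc ` shapes m k d \<subseteq> P1 \<times> P2"
    using low_rows_profiles[OF _ m] high_rows_profiles[OF _ m]
    by (auto simp: enc_def P1_def P2_def q_def l_def)
  have "(\<Sum>A\<in>shapes m k d. phi ^ card A / phi ^ forced A m k)
      \<le> (\<Sum>A\<in>shapes m k d. V (q + 1) (fst (enc A)) * V (m - 1 - q) (snd (enc A)))"
    using weight by (intro sum_mono) (simp add: enc_def)
  also have "\<dots> = (\<Sum>p\<in>enc ` shapes m k d. V (q + 1) (fst p) * V (m - 1 - q) (snd p))"
    by (simp add: sum.reindex[OF inj])
  also have "\<dots> \<le> (\<Sum>p\<in>P1 \<times> P2. V (q + 1) (fst p) * V (m - 1 - q) (snd p))"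
    by (intro sum_mono2 img) (auto simp: P1_def P2_def finite_profiles V0)
  also have "\<dots> = (\<Sum>b\<in>P1. V (q + 1) b) * (\<Sum>b\<in>P2. V (m - 1 - q) b)"
    by (simp add: sum_product sum.cartesian_product case_prod_unfold)
  also have "\<dots> \<le> (\<Prod>i<(q + 1 + 1) div 2. 2.6 ^ (l + 1) * (if i < d then start_factor (l + 1) (q + 1) {1..<d} i else 1))
      * (\<Prod>i<(m - 1 - q + 1) div 2. 2.6 ^ l * (if i < d then start_factor l (m - 1 - q) {i. q + 1 + i < d} i else 1))"
    unfolding V_def P1_def P2_def
  proof (intro mult_mono profile_sum_le d)
    show "0 \<le> (\<Prod>i<(q + 1 + 1) div 2. 2.6 ^ (l + 1) * (if i < d then start_factor (l + 1) (q + 1) {1..<d} i else 1))"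
      using gain_loss(2,4) by (intro prod_nonneg) (auto simp: start_factor_def less_imp_le)
  qed (rule sum_nonneg, rule V0[unfolded V_def])
  finally show ?thesis
    using arg_cong[of "q + 1 + 1" "q + 2" "\<lambda>x. x div 2"] arg_cong[of "m - 1 - q + 1" "m - q" "\<lambda>x. x div 2"] q
    by (simp only: add.assoc one_add_one)
qed

section \<open>Exponential bound for the sum over all shapes\<close>

definition tau :: real where "tau = sqrt 2.6"

lemma tau_bounds: "1.6 < tau" "tau < 1.6125" "tau * tau = 2.6"
proof -
  show "1.6 < tau" unfolding tau_def by (rule real_less_rsqrt) (simp add: power2_eq_square)
  show "tau < 1.6125" unfolding tau_def by (rule real_less_lsqrt) (simp_all add: power2_eq_square)
qed (simp add: tau_def)

text \<open>A chain of upper classes opens outside \<open>G\<close> only at positions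
  \<open>i < d\<close> with \<open>d \<le> q + 1 + i\<close>; these lie in an interval of length
  \<open>min d (q + 1)\<close>.\<close>

lemma start_factor_high_prod_le:
  "(\<Prod>i<h. if i < d then start_factor l n {i. q + 1 + i < d} i else 1) \<le> loss l ^ min d (q + 1)"
proof -
  define c :: "nat \<Rightarrow> nat" where "c i = of_bool (i < d \<and> d \<le> q + 1 + i)" for i
  have "(\<Prod>i<h. if i < d then start_factor l n {i. q + 1 + i < d} i else 1) \<le> (\<Prod>i<h. loss l ^ c i)"
  proof (rule prod_mono, intro conjI)
    fix i
    show "0 \<le> (if i < d then start_factor l n {i. q + 1 + i < d} i else 1)"
      using gain_loss(2,4)[of l] by (auto simp: start_factor_def)
    show "(if i < d then start_factor l n {i. q + 1 + i < d} i else 1) \<le> loss l ^ c i"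
      using gain_loss(2,3)[of l] by (auto simp: start_factor_def c_def power_le_one)
  qed
  also have "\<dots> = loss l ^ (\<Sum>i<h. c i)" by (simp add: power_sum)
  also have "(\<Sum>i<h. c i) = card ({..<h} \<inter> {i. i < d \<and> d \<le> q + 1 + i})"
    unfolding c_def by (simp only: sum_of_bool_eq finite_lessThan of_nat_id)
  then have "(\<Sum>i<h. c i) \<le> min d (q + 1)"
    using card_mono[of "{d - (q + 1)..<d}" "{..<h} \<inter> {i. i < d \<and> d \<le> q + 1 + i}"] by fastforce
  then have "loss l ^ (\<Sum>i<h. c i) \<le> loss l ^ min d (q + 1)"
    by (rule power_increasing) (rule gain_loss)
  finally show ?thesis .
qed

text \<open>The classes strictly between 0 and \<open>d\<close> gain. Class 0 contains 0 and costs
  one \<open>loss\<close>; neither it nor its mirror \<open>q\<close> is credited with a gain,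
  whence the shift by 2.\<close>

lemma start_factor_low_prod_le:
  fixes d q :: nat
  defines "h \<equiv> (q + 2) div 2"
  shows "(\<Prod>i<h. if i < d then start_factor L (q + 1) {1..<d} i else 1) \<le> loss L * gain L ^ (min d (q + 1) - 2)"
proof -
  define M where "M = min h d"
  define c :: "nat \<Rightarrow> nat" where "c i = 1 + of_bool (q < i + d)" for i
  have "(\<Prod>i<h. if i < d then start_factor L (q + 1) {1..<d} i else 1)
      \<le> (\<Prod>i<h. if i = 0 then loss L else if i < d then gain L ^ c i else 1)"
  proof (rule prod_mono, intro conjI)
    fix i assume i: "i \<in> {..<h}"
    show "0 \<le> (if i < d then start_factor L (q + 1) {1..<d} i else 1)"
      using gain_loss(2,4)[of L] by (auto simp: start_factor_def)
    have "1 \<le> q - i" if "0 < i" using that i by (auto simp: h_def)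
    then show "(if i < d then start_factor L (q + 1) {1..<d} i else 1)
        \<le> (if i = 0 then loss L else if i < d then gain L ^ c i else 1)"
      using gain_loss(5)[of L] by (auto simp: start_factor_def c_def power2_eq_square)
  qed
  also have "\<dots> = loss L * (\<Prod>i\<in>{1..<h}. if i < d then gain L ^ c i else 1)"
  proof -
    have "{..<h} = insert 0 {1..<h}" by (auto simp: h_def)
    then have "(\<Prod>i<h. f i) = f 0 * (\<Prod>i\<in>{1..<h}. f i)" for f :: "nat \<Rightarrow> real" by simp
    moreover have "(\<Prod>i\<in>{1..<h}. if i = 0 then loss L else if i < d then gain L ^ c i else 1)
        = (\<Prod>i\<in>{1..<h}. if i < d then gain L ^ c i else 1)"
      by (rule prod.cong) auto
    ultimately show ?thesis by simp
  qed
  also have "(\<Prod>i\<in>{1..<h}. if i < d then gain L ^ c i else 1) = (\<Prod>i\<in>{1..<M}. gain L ^ c i)"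
    by (rule prod.mono_neutral_cong_right) (auto simp: M_def)
  also have "\<dots> = gain L ^ (\<Sum>i\<in>{1..<M}. c i)" by (simp add: power_sum)
  also have "\<dots> \<le> gain L ^ (min d (q + 1) - 2)"
  proof (rule power_decreasing)
    have "(\<Sum>i\<in>{1..<M}. c i) = (M - 1) + card ({1..<M} \<inter> {i. q < i + d})"
      unfolding c_def sum.distrib by (simp only: sum_of_bool_eq finite_atLeastLessThan of_nat_id) simp
    moreover have "min d (q + 1) - 2 \<le> (M - 1) + card ({1..<M} \<inter> {i. q < i + d})"
    proof (cases "d \<le> h")
      case False
      have "card {max 1 (q + 1 - d)..<M} \<le> card ({1..<M} \<inter> {i. q < i + d})"
        by (rule card_mono) auto
      moreover have "q + 1 \<le> 2 * h" by (simp add: h_def)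
      moreover have "min d (q + 1) - 2 \<le> (h - 1) + x"
        if "h - max 1 (q + 1 - d) \<le> x" "q + 1 \<le> 2 * h" "h < d" for x
        using that by linarith
      ultimately show ?thesis using False by (simp add: M_def)
    qed (auto simp: M_def)
    ultimately show "min d (q + 1) - 2 \<le> (\<Sum>i\<in>{1..<M}. c i)" by simp
  qed (use gain_loss[of L] in auto)
  finally show ?thesis using gain_loss(4)[of L] by simp
qed

text \<open>Upper classes lose at most \<open>loss l ^ t\<close> while lower classes regain
  \<open>gain (l + 1) ^ (t - 2)\<close> for the same \<open>t\<close>. One gain times one loss is at
  most 1, so at most \<open>1.16 * 1.16\<^sup>2 < 2\<close> survives. Rounding both numbers of
  classes up to full pairs produces the term \<open>2 * (k div m)\<close>.\<close>

lemma shapes_sum_le: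
  fixes m k d :: nat
  assumes d: "0 < d" "d \<le> m"
  shows "(\<Sum>A\<in>shapes m k d. phi ^ card A / phi ^ forced A m k) \<le> 2 * tau ^ (k + 2 + 2 * (k div m))"
proof -
  define q l where "q = k mod m" and "l = k div m"
  define h1 h2 where "h1 = (q + 2) div 2" and "h2 = (m - q) div 2"
  define S1 where "S1 = (\<Prod>i<h1. if i < d then start_factor (l + 1) (q + 1) {1..<d} i else 1)"
  define S2 where "S2 = (\<Prod>i<h2. if i < d then start_factor l (m - 1 - q) {i. q + 1 + i < d} i else 1)"
  define t where "t = min d (q + 1)"
  have q: "q < m" using d by (simp add: q_def)
  have k: "k = q + l * m" by (simp add: q_def l_def)
  have "S1 * S2 \<le> (loss (l + 1) * gain (l + 1) ^ (t - 2)) * loss l ^ t"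
    unfolding S1_def S2_def h1_def t_def
    by (intro mult_mono start_factor_low_prod_le start_factor_high_prod_le)
      (use gain_loss(2,4) in \<open>auto simp: start_factor_def less_imp_le intro!: prod_nonneg mult_nonneg_nonneg\<close>)
  also have "\<dots> \<le> (loss (l + 1) * gain (l + 1) ^ (t - 2)) * loss l ^ ((t - 2) + 2)"
    using gain_loss[of l] gain_loss(2,4)[of "l + 1"] by (intro mult_left_mono power_increasing) (auto simp: less_imp_le)
  also have "\<dots> = loss (l + 1) * (gain (Suc l) * loss l) ^ (t - 2) * (loss l)\<^sup>2"
    by (simp only: power_add power_mult_distrib mult_ac Suc_eq_plus1)
  also have "\<dots> \<le> 1.16 * 1 * 1.16\<^sup>2"
    using gain_loss(1,4,5,6)[of l] gain_loss(2,4,6)[of "Suc l"]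
    by (intro mult_mono power_mono power_le_one) (auto simp: less_imp_le)
  finally have S: "S1 * S2 \<le> 2" by (simp add: power2_eq_square)
  have "(\<Sum>A\<in>shapes m k d. phi ^ card A / phi ^ forced A m k)
     \<le> ((\<Prod>i<h1. 2.6 ^ (l + 1)) * S1) * ((\<Prod>i<h2. 2.6 ^ l) * S2)"
    using shapes_sum_le_prod[OF d, of k]
    unfolding S1_def S2_def h1_def h2_def prod.distrib[symmetric] q_def l_def by simp
  also have "\<dots> = (S1 * S2) * 2.6 ^ ((l + 1) * h1 + l * h2)"
  proof -
    have "(2.6 :: real) ^ ((l + 1) * h1 + l * h2) = (2.6 ^ (l + 1)) ^ h1 * (2.6 ^ l) ^ h2"
      by (simp only: power_add[of _ "(l + 1) * h1"] power_mult)
    then show ?thesis by (simp only: prod_constant card_lessThan mult_ac)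
  qed
  also have "2.6 ^ ((l + 1) * h1 + l * h2) = tau ^ (2 * ((l + 1) * h1 + l * h2))"
    unfolding power_mult tau_bounds(3)[symmetric] power2_eq_square ..
  also have "(S1 * S2) * tau ^ (2 * ((l + 1) * h1 + l * h2)) \<le> 2 * tau ^ (k + 2 + 2 * l)"
  proof (intro mult_mono S power_increasing)
    have "2 * ((l + 1) * h1 + l * h2) = (l + 1) * (2 * h1) + l * (2 * h2)" by simp
    also have "\<dots> \<le> (l + 1) * (q + 2) + l * (m - q)"
      by (intro add_mono mult_left_mono) (auto simp: h1_def h2_def)
    also have "\<dots> = q + l * (q + (m - q)) + 2 + 2 * l" by (simp only: distrib_left distrib_right)
    also have "\<dots> = k + 2 + 2 * l" using q k by simp
    finally show "2 * ((l + 1) * h1 + l * h2) \<le> k + 2 + 2 * l" .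
  qed (use tau_bounds in auto)
  finally show ?thesis by (simp add: l_def)
qed

definition all_shapes :: "nat \<Rightarrow> nat \<Rightarrow> nat set set" where
  "all_shapes m k = {A. A \<subseteq> {..k} \<and> 0 \<in> A \<and> (\<forall>a\<in>A. a + m \<le> k \<longrightarrow> a + m \<in> A) \<and> (\<forall>a\<in>A. k - a \<notin> A)}"

lemma finite_all_shapes [simp]: "finite (all_shapes m k)"
  by (rule finite_subset[of _ "Pow {..k}"]) (auto simp: all_shapes_def)

text \<open>The parameter \<open>d\<close> never exceeds \<open>m\<close>: if
  \<open>m \<le> k\<close>, then \<open>0 + m\<close> belongs to the shape, and otherwise
  \<open>k + 1 \<le> m\<close>.\<close>

lemma all_shapes_subset:
  assumes "0 < m"
  shows "all_shapes m k \<subseteq> (\<Union>d\<in>{1..min m (k + 1)}. shapes m k d)"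
proof
  fix A assume A: "A \<in> all_shapes m k"
  define P where "P a \<longleftrightarrow> 0 < a \<and> (a \<in> A \<or> k < a)" for a
  define d where "d = (LEAST a. P a)"
  have Pk: "P (k + 1)" by (simp add: P_def)
  then have d: "P d" "d \<le> k + 1" unfolding d_def by (rule LeastI, rule Least_le)
  have min: "\<not> P a" if "a < d" for a using that unfolding d_def by (rule not_less_Least)
  have "d \<le> m"
  proof (cases "m \<le> k")
    case True
    then have "P m" using A assms by (auto simp: P_def all_shapes_def)
    then show ?thesis using min[of m] by (metis not_less)
  next
    case False
    then show ?thesis using d by simp
  qed
  moreover have "A \<in> shapes m k d"
    using A d min by (auto simp: all_shapes_def shapes_def P_def)
  ultimately show "A \<in> (\<Union>d\<in>{1..min m (k + 1)}. shapes m k d)"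
    using d by (auto simp: P_def)
qed

lemma all_shapes_sum_le:
  assumes "0 < m"
  shows "(\<Sum>A\<in>all_shapes m k. phi ^ card A / phi ^ forced A m k)
    \<le> (real k + 1) * (2 * tau ^ (k + 2 + 2 * (k div m)))"
proof -
  have "(\<Sum>A\<in>all_shapes m k. phi ^ card A / phi ^ forced A m k)
     \<le> (\<Sum>A\<in>(\<Union>d\<in>{1..min m (k + 1)}. shapes m k d). phi ^ card A / phi ^ forced A m k)"
    using phi_pos by (intro sum_mono2 all_shapes_subset assms) auto
  also have "(\<Union>d\<in>{1..min m (k + 1)}. shapes m k d) = snd ` (SIGMA d:{1..min m (k + 1)}. shapes m k d)"
    by force
  also have "(\<Sum>A\<in>\<dots>. phi ^ card A / phi ^ forced A m k)
      \<le> (\<Sum>p\<in>(SIGMA d:{1..min m (k + 1)}. shapes m k d). phi ^ card (snd p) / phi ^ forced (snd p) m k)"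
    using phi_pos by (intro sum_image_le[unfolded o_def]) auto
  also have "\<dots> = (\<Sum>d\<in>{1..min m (k + 1)}. \<Sum>A\<in>shapes m k d. phi ^ card A / phi ^ forced A m k)"
    by (simp add: sum.Sigma case_prod_unfold)
  also have "\<dots> \<le> (\<Sum>d\<in>{1..min m (k + 1)}. 2 * tau ^ (k + 2 + 2 * (k div m)))"
    by (intro sum_mono shapes_sum_le) auto
  also have "\<dots> = real (min m (k + 1)) * (2 * tau ^ (k + 2 + 2 * (k div m)))" by simp
  also have "\<dots> \<le> (real k + 1) * (2 * tau ^ (k + 2 + 2 * (k div m)))"
    using tau_bounds by (intro mult_right_mono) auto
  finally show ?thesis .
qed

section \<open>Counting semigroups with a given shape\<close>

lemma choose_le_power:
  fixes x :: real
  assumes "0 < x"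
  shows "real (n choose r) \<le> ((x + 1) / x) ^ n * x ^ r"
proof (cases "r \<le> n")
  case True
  have "real (n choose r) * (1 / x) ^ r \<le> (\<Sum>i\<le>n. real (n choose i) * (1 / x) ^ i * 1 ^ (n - i))"
    using assms True member_le_sum[of r "{..n}" "\<lambda>i. real (n choose i) * (1 / x) ^ i * 1 ^ (n - i)"] by simp
  also have "\<dots> = (1 / x + 1) ^ n" by (rule binomial_ring[symmetric])
  also have "1 / x + 1 = (x + 1) / x" using assms by (simp add: field_simps)
  finally show ?thesis using assms by (simp add: power_divide field_simps)
qed (use assms in \<open>simp add: binomial_eq_0\<close>)

text \<open>For \<open>x = phi\<close> the two bases \<open>(x + 1) / x\<close> and \<open>x\<close>
  coincide.\<close>

lemma choose_le_phi: "real (n choose r) \<le> phi ^ (n + r)"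
proof -
  have "(phi + 1) / phi = phi" using phi_sq phi_pos by (simp add: field_simps)
  then show ?thesis using choose_le_power[OF phi_pos, of n r] by (simp add: power_add)
qed

lemma fib_Suc_le_phi: "real (fib (Suc n)) \<le> phi ^ n"
proof (induction n rule: fib.induct)
  case (3 n)
  have "real (fib (Suc (Suc (Suc n)))) \<le> phi ^ Suc n + phi ^ n" using 3 by simp
  also have "\<dots> = phi ^ Suc (Suc n)" using phi_sq by (simp add: algebra_simps phi_sq_left)
  finally show ?case .
qed (use phi_gt_1 in auto)

lemma sum_choose_diagonal: "(\<Sum>n\<le>N. n choose (N - n)) = fib (Suc N)"
proof -
  have "(\<Sum>n\<le>N. n choose (N - n)) = (\<Sum>k = 0..N. (N - k) choose k)"
    by (rule sum.reindex_bij_witness[of _ "\<lambda>k. N - k" "\<lambda>k. N - k"]) auto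
  then show ?thesis by (simp add: ne_diagonal_fib)
qed

section \<open>Multiplicity, gaps and Frobenius classes\<close>

definition mult_of :: "nat set \<Rightarrow> nat" where
  "mult_of S = (LEAST x. 0 < x \<and> x \<in> S)"

lemma genus_semigroupD:
  assumes "S \<in> semigroups_of_genus g"
  shows "0 \<in> S" "\<And>a b. a \<in> S \<Longrightarrow> b \<in> S \<Longrightarrow> a + b \<in> S" "finite (- S)" "card (- S) = g"
  using assms by (auto simp: semigroups_of_genus_def numerical_semigroup_def genus_def)

text \<open>Of \<open>i\<close> and \<open>x - i\<close> at least one is a gap whenever
  \<open>x\<close> is, so two copies of the set of gaps cover \<open>{..x}\<close>.\<close>

lemma gap_less:
  assumes S: "S \<in> semigroups_of_genus g" and x: "x \<notin> S"
  shows "x < 2 * g"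
proof -
  note D = genus_semigroupD[OF S]
  have "{..x} \<subseteq> (- S) \<union> (\<lambda>i. x - i) ` (- S)"
  proof
    fix i assume i: "i \<in> {..x}"
    show "i \<in> (- S) \<union> (\<lambda>i. x - i) ` (- S)"
    proof (cases "i \<in> S")
      case True
      then have "x - i \<notin> S" using D(2)[of i "x - i"] x i by auto
      moreover have "i = x - (x - i)" using i by simp
      ultimately show ?thesis by blast
    qed simp
  qed
  then have "card {..x} \<le> card ((- S) \<union> (\<lambda>i. x - i) ` (- S))" using D(3) by (intro card_mono) auto
  also have "\<dots> \<le> card (- S) + card ((\<lambda>i. x - i) ` (- S))" by (rule card_Un_le)
  also have "\<dots> \<le> g + g" using D(3,4) card_image_le[OF D(3)] by (intro add_mono) auto
  finally show ?thesis by simp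
qed

lemma finite_semigroups_of_genus [simp]: "finite (semigroups_of_genus g)"
proof -
  have "semigroups_of_genus g \<subseteq> uminus ` Pow {..<2 * g}"
  proof
    fix S assume S: "S \<in> semigroups_of_genus g"
    then have "- S \<in> Pow {..<2 * g}" using gap_less[OF S] by auto
    then show "S \<in> uminus ` Pow {..<2 * g}" by (metis image_eqI double_complement)
  qed
  then show ?thesis by (rule finite_subset) simp
qed

lemma multD:
  assumes "S \<in> semigroups_of_genus g"
  shows "0 < mult_of S" "mult_of S \<in> S" "\<And>x. 0 < x \<Longrightarrow> x < mult_of S \<Longrightarrow> x \<notin> S"
proof -
  have "2 * g + 1 \<in> S" using gap_less[OF assms, of "2 * g + 1"] by auto
  then have "\<exists>x. 0 < x \<and> x \<in> S" by (intro exI[of _ "2 * g + 1"]) simp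
  then have "0 < mult_of S \<and> mult_of S \<in> S" unfolding mult_of_def by (rule LeastI_ex)
  then show "0 < mult_of S" "mult_of S \<in> S" by auto
  show "x \<notin> S" if "0 < x" "x < mult_of S" for x
    using that not_less_Least[of x "\<lambda>x. 0 < x \<and> x \<in> S"] by (auto simp: mult_of_def)
qed

lemma mult_le:
  assumes "S \<in> semigroups_of_genus g"
  shows "mult_of S \<le> g + 1"
proof -
  have "card {1..<mult_of S} \<le> card (- S)"
    using multD(3)[OF assms] genus_semigroupD[OF assms] by (intro card_mono) auto
  then show ?thesis using genus_semigroupD[OF assms] by simp
qed

definition frob_class :: "nat \<Rightarrow> nat \<Rightarrow> nat \<Rightarrow> nat set set" where
  "frob_class g m k = {S \<in> semigroups_of_genus g. mult_of S = m \<and> 2 * m + k \<notin> S \<and> (\<forall>x>2 * m + k. x \<in> S)}"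

definition shape :: "nat \<Rightarrow> nat \<Rightarrow> nat set \<Rightarrow> nat set" where
  "shape m k S = {a. a \<le> k \<and> m + a \<in> S}"

lemma frob_class_subset: "frob_class g m k \<subseteq> semigroups_of_genus g"
  by (auto simp: frob_class_def)

lemma finite_frob_class [simp]: "finite (frob_class g m k)"
  by (rule finite_subset[OF frob_class_subset]) simp

lemma shape_in_all_shapes:
  assumes S: "S \<in> frob_class g m k"
  shows "shape m k S \<in> all_shapes m k"
proof -
  have Sg: "S \<in> semigroups_of_genus g" and m: "mult_of S = m" and F: "2 * m + k \<notin> S"
    using S by (auto simp: frob_class_def)
  note D = genus_semigroupD[OF Sg] and M = multD[OF Sg, unfolded m]
  have "m + (a + m) \<in> S" if "m + a \<in> S" for a
    using D(2)[OF that M(2)] by (simp add: add.assoc)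
  moreover have False if "a \<le> k" "m + a \<in> S" "m + (k - a) \<in> S" for a
    using D(2)[OF that(2,3)] that(1) F by (simp add: mult_2 add_ac)
  ultimately show ?thesis using M(2) by (auto simp: shape_def all_shapes_def)
qed

lemma fiber_card:
  fixes m k :: nat
  defines "W \<equiv> {m + k<..<2 * m + k}"
  assumes S: "S \<in> frob_class g m k"
  shows "card (W - S) + m + k + 1 = g + card (shape m k S)"
proof -
  have Sg: "S \<in> semigroups_of_genus g" and m: "mult_of S = m" and F: "2 * m + k \<notin> S" "\<And>x. x > 2 * m + k \<Longrightarrow> x \<in> S"
    using S by (auto simp: frob_class_def)
  note D = genus_semigroupD[OF Sg] and M = multD[OF Sg, unfolded m]
  let ?A = "shape m k S"
  have A: "?A \<subseteq> {..k}" by (auto simp: shape_def)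
  have split: "- S = {1..<m} \<union> ((+) m ` ({..k} - ?A) \<union> ((W - S) \<union> {2 * m + k}))"
  proof (rule set_eqI)
    fix x
    consider "x < m" | "m \<le> x" "x \<le> m + k" | "x \<in> W" | "x = 2 * m + k" | "2 * m + k < x"
      unfolding W_def by fastforce
    then show "x \<in> - S \<longleftrightarrow> x \<in> {1..<m} \<union> ((+) m ` ({..k} - ?A) \<union> ((W - S) \<union> {2 * m + k}))"
    proof cases
      case 1
      then show ?thesis using M D(1) by (cases "x = 0") (auto simp: W_def)
    next
      case 2
      then have "x = m + (x - m)" "x - m \<le> k" by auto
      then have "x \<in> (+) m ` ({..k} - ?A) \<longleftrightarrow> x \<notin> S"
        by (auto simp: shape_def image_iff)
      then show ?thesis using 2 M F by (auto simp: W_def)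
    next
      case 3
      then show ?thesis by (auto simp: W_def)
    next
      case 4
      then show ?thesis using F by auto
    next
      case 5
      then show ?thesis using F(2)[OF 5] M by (auto simp: W_def)
    qed
  qed
  have "card (- S) = (m - 1) + (card ((+) m ` ({..k} - ?A)) + (card (W - S) + 1))"
    unfolding split using M(1)
    by (subst card_Un_disjoint; (subst card_Un_disjoint)?; (subst card_Un_disjoint)?)
      (auto simp: W_def)
  also have "card ((+) m ` ({..k} - ?A)) = card ({..k} - ?A)" by (rule card_image) simp
  also have "\<dots> = k + 1 - card ?A" using A by (simp add: card_Diff_subset finite_subset)
  finally show ?thesis using D(4) M(1) card_mono[OF _ A] by simp
qed

text \<open>Once the shape is fixed, a semigroup is determined by its gaps in \<open>W\<close>. The
  genus dictates their number, and they must avoid the forced sums \<open>Z\<close>; keeping only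
  this part of closure is enough for an upper bound.\<close>

lemma card_fiber_le:
  fixes g m k :: nat and A :: "nat set"
  assumes m: "0 < m"
  defines "X \<equiv> {S \<in> frob_class g m k. shape m k S = A}"
  shows "card X \<le> (m - 1 - forced A m k) choose (g + card A - (m + k + 1))"
    and "X \<noteq> {} \<Longrightarrow> forced A m k \<le> m - 1 \<and> m + k + 1 \<le> g + card A"
proof -
  define W where "W = {m + k<..<2 * m + k}"
  define Y where "Y = {y. (\<exists>a\<in>A. \<exists>b\<in>A. y = a + b) \<and> y < k \<and> k < y + m}"
  define Z where "Z = (+) (2 * m) ` Y"
  have ZW: "Z \<subseteq> W" by (auto simp: Z_def Y_def W_def)
  have cZ: "card Z = forced A m k"
    unfolding Z_def forced_def Y_def[symmetric] by (rule card_image) simp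
  have finW: "finite W" "card W = m - 1" using m by (auto simp: W_def)
  have forced_le: "forced A m k \<le> m - 1" using card_mono[OF finW(1) ZW] finW cZ by simp
  have sub: "Z \<subseteq> S" if S: "S \<in> X" for S
  proof
    fix x assume "x \<in> Z"
    then obtain a b where x: "x = (m + a) + (m + b)" "a \<in> A" "b \<in> A"
      by (auto simp: Z_def Y_def)
    have "m + a \<in> S" "m + b \<in> S" using S x by (auto simp: X_def shape_def)
    moreover have "S \<in> semigroups_of_genus g" using S by (auto simp: X_def frob_class_def)
    ultimately show "x \<in> S" using genus_semigroupD(2) x by metis
  qed
  have cW: "card (W - S) = g + card A - (m + k + 1)" "m + k + 1 \<le> g + card A" if "S \<in> X" for S
    using fiber_card[of S g m k] that by (auto simp: X_def W_def)
  show "X \<noteq> {} \<Longrightarrow> forced A m k \<le> m - 1 \<and> m + k + 1 \<le> g + card A"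
    using cW(2) forced_le by auto
  have inj: "inj_on (\<lambda>S. W - S) X"
  proof (rule inj_onI, rule set_eqI)
    fix S T x assume ST: "S \<in> X" "T \<in> X" and eq: "W - S = W - T"
    have *: "x \<in> S \<longleftrightarrow> x = 0 \<or> (m \<le> x \<and> x \<le> m + k \<and> x - m \<in> A) \<or> (x \<in> W \<and> x \<notin> W - S) \<or> 2 * m + k < x"
      if S: "S \<in> X" for S
    proof -
      have Sg: "S \<in> semigroups_of_genus g" and mS: "mult_of S = m" and F: "2 * m + k \<notin> S" "\<And>x. x > 2 * m + k \<Longrightarrow> x \<in> S"
        and A: "A = {a. a \<le> k \<and> m + a \<in> S}"
        using S by (auto simp: X_def frob_class_def shape_def)
      note D = genus_semigroupD[OF Sg] and M = multD[OF Sg, unfolded mS]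
      consider "x < m" | "m \<le> x" "x \<le> m + k" | "x \<in> W" | "x = 2 * m + k" | "2 * m + k < x"
        unfolding W_def by fastforce
      then show ?thesis
      proof cases
        case 1
        then show ?thesis using M D(1) by (cases "x = 0") (auto simp: W_def)
      qed (use F m in \<open>auto simp: A W_def\<close>)
    qed
    show "x \<in> S \<longleftrightarrow> x \<in> T" unfolding *[OF ST(1)] *[OF ST(2)] eq ..
  qed
  have "card X = card ((\<lambda>S. W - S) ` X)" by (rule card_image[OF inj, symmetric])
  also have "\<dots> \<le> card {B. B \<subseteq> W - Z \<and> card B = g + card A - (m + k + 1)}"
    using sub cW(1) finW by (intro card_mono) auto
  also have "\<dots> = card (W - Z) choose (g + card A - (m + k + 1))"
    using finW by (intro n_subsets) auto
  also have "card (W - Z) = m - 1 - forced A m k"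
    using ZW finW cZ by (simp add: card_Diff_subset finite_subset)
  finally show "card X \<le> (m - 1 - forced A m k) choose (g + card A - (m + k + 1))" .
qed

lemma poly_times_geometric_tendsto_0:
  fixes s :: real
  assumes "0 < s" "s < 1"
  shows "(\<lambda>n. (real n + 1) ^ p * s ^ n) \<longlonglongrightarrow> 0"
  using assms by real_asymp

text \<open>The two indices of the binomial coefficient add up to
  \<open>g + card A - (k + 2 + forced A m k)\<close>: the explicit \<open>m\<close> cancels.\<close>

lemma card_fiber_le_phi:
  assumes m: "0 < m"
  shows "real (card {S \<in> frob_class g m k. shape m k S = A}) \<le> phi ^ (g + card A) / phi ^ (k + 2 + forced A m k)"
proof (cases "{S \<in> frob_class g m k. shape m k S = A} = {}")
  case True
  show ?thesis unfolding True using phi_pos by simp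
next
  case False
  note F = card_fiber_le[OF m, of g k A]
  have "real (card {S \<in> frob_class g m k. shape m k S = A})
      \<le> phi ^ ((m - 1 - forced A m k) + (g + card A - (m + k + 1)))"
    using F(1) choose_le_phi order_trans of_nat_mono by blast
  also have "\<dots> = phi ^ (g + card A) / phi ^ (k + 2 + forced A m k)"
  proof -
    have "g + card A = ((m - 1 - forced A m k) + (g + card A - (m + k + 1))) + (k + 2 + forced A m k)"
      using F(2) False m by auto
    then have "phi ^ (g + card A) = phi ^ ((m - 1 - forced A m k) + (g + card A - (m + k + 1))) * phi ^ (k + 2 + forced A m k)"
      by (metis power_add)
    then show ?thesis using phi_pos by simp
  qed
  finally show ?thesis .
qed

lemma shape_weight_sum_le:
  assumes m: "0 < m"
  shows "(\<Sum>A\<in>all_shapes m k. phi ^ (g + card A) / phi ^ (k + 2 + forced A m k))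
      \<le> phi ^ g * (2 * (real k + 1) * (tau ^ (k + 2 + 2 * (k div m)) / phi ^ (k + 2)))"
proof -
  have "(\<Sum>A\<in>all_shapes m k. phi ^ (g + card A) / phi ^ (k + 2 + forced A m k))
      = (phi ^ g / phi ^ (k + 2)) * (\<Sum>A\<in>all_shapes m k. phi ^ card A / phi ^ forced A m k)"
    unfolding sum_distrib_left by (intro sum.cong) (simp_all add: power_add)
  also have "\<dots> \<le> (phi ^ g / phi ^ (k + 2)) * ((real k + 1) * (2 * tau ^ (k + 2 + 2 * (k div m))))"
    using phi_pos by (intro mult_left_mono all_shapes_sum_le m) auto
  finally show ?thesis by (simp add: field_simps)
qed

lemma card_frob_class_le:
  assumes m: "0 < m"
  shows "real (card (frob_class g m k))
      \<le> phi ^ g * (2 * (real k + 1) * (tau ^ (k + 2 + 2 * (k div m)) / phi ^ (k + 2)))"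
proof -
  have "card (frob_class g m k) = card (\<Union>A\<in>all_shapes m k. {S \<in> frob_class g m k. shape m k S = A})"
    using shape_in_all_shapes by (intro arg_cong[of _ _ card]) auto
  also have "\<dots> \<le> (\<Sum>A\<in>all_shapes m k. card {S \<in> frob_class g m k. shape m k S = A})"
    by (rule card_UN_le) simp
  finally have "real (card (frob_class g m k))
      \<le> (\<Sum>A\<in>all_shapes m k. real (card {S \<in> frob_class g m k. shape m k S = A}))"
    by (simp flip: of_nat_sum)
  also have "\<dots> \<le> (\<Sum>A\<in>all_shapes m k. phi ^ (g + card A) / phi ^ (k + 2 + forced A m k))"
    by (intro sum_mono card_fiber_le_phi m)
  also note shape_weight_sum_le[OF m]
  finally show ?thesis .
qed

lemma sum_choose_shift_le:
  fixes N \<sigma> :: nat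
  assumes "finite M" "\<And>m. m \<in> M \<Longrightarrow> \<sigma> < m \<and> m - 1 - \<sigma> \<le> N"
  shows "(\<Sum>m\<in>M. (m - 1 - \<sigma>) choose (N - (m - 1 - \<sigma>))) \<le> fib (Suc N)"
proof -
  have inj: "inj_on (\<lambda>m. m - 1 - \<sigma>) M"
  proof (rule inj_onI)
    fix x y assume "x \<in> M" "y \<in> M" "x - 1 - \<sigma> = y - 1 - \<sigma>"
    then show "x = y" using assms(2)[of x] assms(2)[of y] by auto
  qed
  have "(\<Sum>m\<in>M. (m - 1 - \<sigma>) choose (N - (m - 1 - \<sigma>))) = (\<Sum>n\<in>(\<lambda>m. m - 1 - \<sigma>) ` M. n choose (N - n))"
    by (subst sum.reindex[OF inj]) simp
  also have "\<dots> \<le> (\<Sum>n\<le>N. n choose (N - n))"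
    using assms(2) by (intro sum_mono2) auto
  finally show ?thesis by (simp add: sum_choose_diagonal)
qed

text \<open>For \<open>k < m\<close> the translation condition on shapes is vacuous and
  \<open>k < y + m\<close> holds automatically, so \<open>m = k + 1\<close> can represent all
  multiplicities. The sum over \<open>m\<close> is taken before the sum over shapes.\<close>

lemma card_frob_classes_small_le:
  "real (card (\<Union>m\<in>{k<..g + 1}. frob_class g m k))
      \<le> phi ^ g * (2 * (real k + 1) * (tau ^ (k + 2) / phi ^ (k + 2)))"
proof -
  define M where "M = {k<..g + 1}"
  define A0 where "A0 = all_shapes (k + 1) k"
  define X where "X m A = {S \<in> frob_class g m k. shape m k S = A}" for m A
  have shapes: "all_shapes m k = A0" if "m \<in> M" for m
    using that unfolding A0_def all_shapes_def M_def by auto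
  have forced_eq: "forced A m k = forced A (k + 1) k" if "m \<in> M" for m A
    unfolding forced_def using that by (intro arg_cong[of _ _ card]) (auto simp: M_def)
  have fiber_sum: "(\<Sum>m\<in>M. real (card (X m A))) \<le> phi ^ (g + card A) / phi ^ (k + 2 + forced A (k + 1) k)" for A
  proof -
    define \<sigma> where "\<sigma> = forced A (k + 1) k"
    define N where "N = g + card A - (k + 2 + \<sigma>)"
    define M' where "M' = {m \<in> M. X m A \<noteq> {}}"
    have M': "\<sigma> < m \<and> m - 1 - \<sigma> \<le> N \<and> g + card A - (m + k + 1) = N - (m - 1 - \<sigma>)
        \<and> k + 2 + \<sigma> \<le> g + card A" if "m \<in> M'" for m
    proof -
      have m: "m \<in> M" "0 < m" using that by (auto simp: M'_def M_def)
      have "\<sigma> \<le> m - 1 \<and> m + k + 1 \<le> g + card A"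
        using card_fiber_le(2)[OF m(2), of g k A] that m forced_eq[OF m(1)]
        by (auto simp: M'_def X_def \<sigma>_def)
      then show ?thesis using m by (auto simp: N_def)
    qed
    have "(\<Sum>m\<in>M. card (X m A)) = (\<Sum>m\<in>M'. card (X m A))"
      by (rule sum.mono_neutral_right) (auto simp: M'_def M_def)
    also have "\<dots> \<le> (\<Sum>m\<in>M'. (m - 1 - \<sigma>) choose (N - (m - 1 - \<sigma>)))"
    proof (rule sum_mono)
      fix m assume m: "m \<in> M'"
      then have mM: "m \<in> M" "0 < m" by (auto simp: M'_def M_def)
      show "card (X m A) \<le> (m - 1 - \<sigma>) choose (N - (m - 1 - \<sigma>))"
        using card_fiber_le(1)[OF mM(2), of g k A] M'[OF m] forced_eq[OF mM(1)]
        by (simp add: X_def \<sigma>_def)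
    qed
    also have "\<dots> \<le> fib (Suc N)"
      by (rule sum_choose_shift_le) (use M' in \<open>auto simp: M'_def M_def\<close>)
    finally have 1: "(\<Sum>m\<in>M. card (X m A)) \<le> fib (Suc N)" .
    show ?thesis
    proof (cases "M' = {}")
      case True
      then have "(\<Sum>m\<in>M. real (card (X m A))) = 0" by (auto simp: M'_def)
      then show ?thesis using phi_pos by simp
    next
      case False
      then obtain m where "m \<in> M'" by blast
      then have "g + card A = N + (k + 2 + \<sigma>)" unfolding N_def using M'[OF \<open>m \<in> M'\<close>] by linarith
      then have "phi ^ (g + card A) = phi ^ N * phi ^ (k + 2 + \<sigma>)" by (metis power_add)
      then have "phi ^ N = phi ^ (g + card A) / phi ^ (k + 2 + \<sigma>)" using phi_pos by simp
      moreover have "(\<Sum>m\<in>M. real (card (X m A))) \<le> phi ^ N"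
        using 1 fib_Suc_le_phi[of N] by (simp flip: of_nat_sum)
      ultimately show ?thesis by (simp add: \<sigma>_def)
    qed
  qed
  have "(\<Union>m\<in>M. frob_class g m k) \<subseteq> (\<Union>m\<in>M. \<Union>A\<in>A0. X m A)"
    using shape_in_all_shapes shapes by (fastforce simp: X_def)
  then have "card (\<Union>m\<in>M. frob_class g m k) \<le> card (\<Union>m\<in>M. \<Union>A\<in>A0. X m A)"
    by (intro card_mono) (auto simp: X_def M_def A0_def)
  also have "\<dots> \<le> (\<Sum>m\<in>M. card (\<Union>A\<in>A0. X m A))"
    by (rule card_UN_le) (simp add: M_def)
  also have "\<dots> \<le> (\<Sum>m\<in>M. \<Sum>A\<in>A0. card (X m A))"
    by (intro sum_mono card_UN_le) (simp add: A0_def)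
  also have "\<dots> = (\<Sum>A\<in>A0. \<Sum>m\<in>M. card (X m A))" by (rule sum.swap)
  finally have "real (card (\<Union>m\<in>M. frob_class g m k)) \<le> real (\<Sum>A\<in>A0. \<Sum>m\<in>M. card (X m A))"
    by (rule of_nat_mono)
  also have "\<dots> = (\<Sum>A\<in>A0. \<Sum>m\<in>M. real (card (X m A)))" by simp
  also have "\<dots> \<le> (\<Sum>A\<in>A0. phi ^ (g + card A) / phi ^ (k + 2 + forced A (k + 1) k))"
    by (intro sum_mono fiber_sum)
  also have "\<dots> \<le> phi ^ g * (2 * (real k + 1) * (tau ^ (k + 2) / phi ^ (k + 2)))"
  proof -
    have "k div (k + 1) = 0" by simp
    then show ?thesis
      using shape_weight_sum_le[of "k + 1" g k] unfolding A0_def by (simp only: mult_0_right add_0_right zero_less_Suc Suc_eq_plus1[symmetric])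
  qed
  finally show ?thesis by (simp add: M_def)
qed

section \<open>Tail of the Frobenius number\<close>

text \<open>The excess 0.004 in the exponent absorbs \<open>tau ^ (2 * (k div m))\<close> as soon as
  \<open>m \<ge> 500\<close>.\<close>

definition rho :: real where "rho = (tau powr 1.004) / phi"

lemma powr_power_nat:
  fixes x a :: real
  assumes "0 < x"
  shows "(x powr a) ^ n = x powr (a * real n)"
proof -
  have "x powr (a * real n) = (x powr a) powr real n" by (simp only: powr_powr)
  also have "\<dots> = (x powr a) ^ n" using assms by (intro powr_realpow) simp
  finally show ?thesis ..
qed

lemma rho_bounds: "0 < rho" "rho < 1"
proof -
  have tau: "0 < tau" using tau_bounds by simp
  show "0 < rho" using tau phi_pos by (simp add: rho_def)
  \<comment> \<open>Bernoulli's inequality turns this margin into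
    \<open>tau < (phi / tau) ^ 250\<close>, that is \<open>tau ^ 251 < phi ^ 250\<close>, and
    \<open>251 / 250 = 1.004\<close>.\<close>
  have "1.00341 * tau \<le> phi" using tau_bounds phi_bounds by simp
  then have "1.00341 \<le> phi / tau" using tau by (simp add: pos_le_divide_eq)
  moreover define x where "x = phi / tau"
  ultimately have x: "1.00341 \<le> x" by simp
  then have "tau < 1 + 250 * (x - 1)" using tau_bounds(2) by simp
  moreover obtain n :: nat where n: "real n = 250" by (rule that[of 250]) simp
  ultimately have "tau < 1 + real n * (x - 1)" by simp
  also have "\<dots> \<le> (1 + (x - 1)) ^ n"
    using x by (intro Bernoulli_inequality) simp
  finally have "tau < x ^ n" by simp
  then have "tau * tau ^ n < x ^ n * tau ^ n"
    using tau by (intro mult_strict_right_mono) auto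
  also have "x ^ n * tau ^ n = phi ^ n"
    unfolding power_mult_distrib[symmetric] x_def using tau by simp
  finally have "tau ^ Suc n < phi ^ n" by simp
  moreover have "(tau powr 1.004) ^ n = tau ^ Suc n"
  proof -
    have "(tau powr 1.004) ^ n = tau powr (1.004 * real n)"
      by (rule powr_power_nat[OF tau])
    also have "1.004 * real n = real (Suc n)" using n by simp
    finally show ?thesis using tau by (simp only: powr_realpow)
  qed
  ultimately have "tau powr 1.004 < phi"
    using phi_pos power_less_imp_less_base[of _ n phi] by simp
  then show "rho < 1" using phi_pos by (simp add: rho_def)
qed

lemma tau_phi_le_rho:
  assumes "500 * j \<le> k"
  shows "tau ^ (k + 2 + 2 * j) / phi ^ (k + 2) \<le> rho ^ k"
proof -
  have tau: "1 < tau" "tau < phi" using tau_bounds phi_bounds by auto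
  have "tau ^ (k + 2 * j) = tau powr real (k + 2 * j)"
    using tau by (subst powr_realpow) auto
  also have "\<dots> \<le> tau powr (1.004 * real k)"
    using assms tau by (intro powr_mono) auto
  also have "\<dots> = (tau powr 1.004) ^ k"
    using tau by (intro powr_power_nat[symmetric]) simp
  finally have 1: "tau ^ (k + 2 * j) \<le> (tau powr 1.004) ^ k" .
  have "tau ^ (k + 2 + 2 * j) / phi ^ (k + 2) = (tau / phi)\<^sup>2 * (tau ^ (k + 2 * j) / phi ^ k)"
    by (simp add: power_add power_divide power2_eq_square)
  also have "\<dots> \<le> 1 * ((tau powr 1.004) ^ k / phi ^ k)"
    using tau phi_pos 1 by (intro mult_mono divide_right_mono power_le_one) auto
  finally show ?thesis by (simp add: rho_def power_divide)
qed

lemma downward_closed_eq: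
  assumes "finite J" "\<And>j i. j \<in> J \<Longrightarrow> i \<le> j \<Longrightarrow> i \<in> (J :: nat set)"
  shows "J = {..<card J}"
proof -
  have "\<exists>n. n \<notin> J" using assms(1) ex_new_if_finite infinite_UNIV_nat by blast
  define n where "n = (LEAST n. n \<notin> J)"
  have "n \<notin> J" unfolding n_def using \<open>\<exists>n. n \<notin> J\<close> by (rule LeastI_ex)
  moreover have "i \<in> J" if "i < n" for i using that not_less_Least unfolding n_def by blast
  ultimately have "J = {..<n}" using assms(2) by (metis lessThan_iff linorder_not_less subsetI subset_antisym)
  then show ?thesis by simp
qed

text \<open>Kunz coordinates: as \<open>m\<close> belongs to the semigroup, the gaps in each class
  modulo \<open>m\<close> form an initial segment, so the \<open>m\<close> gap counts, each at most
  \<open>g\<close>, determine the semigroup.\<close>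

lemma card_mult_eq_le:
  assumes m: "0 < m"
  shows "card {S \<in> semigroups_of_genus g. mult_of S = m} \<le> (g + 1) ^ m"
proof -
  define X where "X = {S \<in> semigroups_of_genus g. mult_of S = m}"
  define e where "e S = (\<lambda>r\<in>{..<m}. card {j. r + j * m \<notin> S})" for S
  have J: "finite {j. r + j * m \<notin> S} \<and> card {j. r + j * m \<notin> S} \<le> g \<and> (r + j * m \<notin> S \<longleftrightarrow> j < card {j. r + j * m \<notin> S})"
    if S: "S \<in> X" for S r j
  proof -
    have Sg: "S \<in> semigroups_of_genus g" and mS: "mult_of S = m" using S by (auto simp: X_def)
    note D = genus_semigroupD[OF Sg] and M = multD[OF Sg, unfolded mS]
    have inj: "inj (\<lambda>j. r + j * m)" using m by (auto simp: inj_on_def)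
    have sub: "(\<lambda>j. r + j * m) ` {j. r + j * m \<notin> S} \<subseteq> - S" by auto
    have fin: "finite {j. r + j * m \<notin> S}"
      using finite_imageD[OF finite_subset[OF sub D(3)]] inj inj_on_subset by blast
    have "card {j. r + j * m \<notin> S} \<le> g"
      using card_mono[OF D(3) sub] card_image[OF inj_on_subset[OF inj]] D(4) by force
    moreover have up: "r + i * m \<in> S \<Longrightarrow> r + (i + d) * m \<in> S" for i d
    proof (induction d)
      case (Suc d)
      have "r + (i + d) * m + m \<in> S" by (rule D(2)[OF Suc.IH[OF Suc.prems] M(2)])
      then show ?case by (simp add: algebra_simps)
    qed simp
    have "{j. r + j * m \<notin> S} = {..<card {j. r + j * m \<notin> S}}"
      by (rule downward_closed_eq[OF fin]) (use up le_Suc_ex in blast)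
    then have "r + j * m \<notin> S \<longleftrightarrow> j < card {j. r + j * m \<notin> S}" by blast
    ultimately show ?thesis using fin by blast
  qed
  have inj: "inj_on e X"
  proof (rule inj_onI, rule set_eqI)
    fix S T x assume ST: "S \<in> X" "T \<in> X" and eq: "e S = e T"
    have "card {j. x mod m + j * m \<notin> S} = card {j. x mod m + j * m \<notin> T}"
      using fun_cong[OF eq, of "x mod m"] m by (simp add: e_def)
    then have "x mod m + (x div m) * m \<in> S \<longleftrightarrow> x mod m + (x div m) * m \<in> T"
      using J[OF ST(1), of "x mod m" "x div m"] J[OF ST(2), of "x mod m" "x div m"] by metis
    then show "x \<in> S \<longleftrightarrow> x \<in> T" by simp
  qed
  have "card X = card (e ` X)" by (rule card_image[OF inj, symmetric])
  also have "\<dots> \<le> card (PiE {..<m} (\<lambda>_. {..g}))"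
  proof (intro card_mono finite_PiE image_subsetI)
    show "e S \<in> PiE {..<m} (\<lambda>_. {..g})" if "S \<in> X" for S
      using J[OF that] unfolding e_def by (intro restrict_PiE_iff[THEN iffD2]) blast
  qed auto
  also have "\<dots> = (g + 1) ^ m" by (simp add: card_PiE)
  finally show ?thesis by (simp add: X_def)
qed

lemma summable_weighted_rho: "summable (\<lambda>k. 2 * (real k + 1) * rho ^ k)"
proof -
  have "summable (\<lambda>n. of_nat (Suc n) * rho ^ n)"
    using geometric_deriv_sums[of rho] rho_bounds by (intro sums_summable) auto
  then have "summable (\<lambda>n. 2 * (of_nat (Suc n) * rho ^ n))" by (rule summable_mult)
  then show ?thesis by (simp only: of_nat_Suc mult.assoc add.commute)
qed

lemma frob_class_cover:
  assumes S: "S \<in> semigroups_of_genus g" and x: "2 * mult_of S + K < x" "x \<notin> S"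
  obtains k where "K < k" "k < 2 * g" "g \<le> 2 * mult_of S + k" "S \<in> frob_class g (mult_of S) k"
proof -
  note D = genus_semigroupD[OF S]
  define F where "F = Max (- S)"
  have F: "F \<notin> S" "\<And>y. y \<notin> S \<Longrightarrow> y \<le> F"
    using Max_in[OF D(3)] Max_ge[OF D(3)] x by (auto simp: F_def)
  have F_ge: "2 * mult_of S + K < F" using F(2)[OF x(2)] x(1) by simp
  define k where "k = F - 2 * mult_of S"
  have Fk: "F = 2 * mult_of S + k" using F_ge by (simp add: k_def)
  have "- S \<subseteq> {1..F}" using F(2) D(1) by (auto simp: Suc_le_eq intro: gr0I)
  then have "g \<le> F" using card_mono[of "{1..F}" "- S"] D(4) by simp
  moreover have "F < 2 * g" using gap_less[OF S F(1)] .
  moreover have "y \<in> S" if "F < y" for y using F(2)[of y] that by (cases "y \<in> S") auto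
  then have "S \<in> frob_class g (mult_of S) k" using S F(1) by (auto simp: frob_class_def Fk)
  ultimately show ?thesis using that[of k] F_ge Fk by simp
qed

text \<open>Only \<open>U1\<close>, the range \<open>k < m\<close>, determines \<open>K\<close>. The
  other two parts are \<open>o(phi ^ g)\<close>: \<open>U2\<close> because
  \<open>3 * k \<ge> g\<close> there, \<open>U3\<close> because it grows polynomially.\<close>

lemma tail_bound:
  fixes \<delta> :: real
  assumes \<delta>: "0 < \<delta>"
  shows "\<exists>K. \<forall>\<^sub>F g in sequentially.
    real (card {S \<in> semigroups_of_genus g. \<exists>x>2 * mult_of S + K. x \<notin> S}) \<le> \<delta> * phi ^ g"
proof -
  define a where "a k = 2 * (real k + 1) * rho ^ k" for k
  have a0: "0 \<le> a k" for k using rho_bounds by (simp add: a_def)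
  have "summable a" unfolding a_def by (rule summable_weighted_rho)
  \<comment> \<open>The Cauchy criterion bounds every finite block beyond \<open>K\<close>, hence
    uniformly in \<open>g\<close>.\<close>
  then obtain K where K: "\<And>n. norm (sum a {Suc K..<n}) < \<delta> / 3"
    using \<delta> unfolding summable_Cauchy by (metis divide_pos_pos zero_less_numeral le_SucI le_refl)
  \<comment> \<open>The cube root matches \<open>g \<le> 3 * k\<close>, which gives
    \<open>rho ^ k \<le> s ^ g\<close>.\<close>
  define s where "s = rho powr (1 / 3)"
  have s: "0 < s" "s < 1" using rho_bounds powr_less_mono2[of "1 / 3" rho 1] by (auto simp: s_def)
  define T where "T g = {S \<in> semigroups_of_genus g. \<exists>x>2 * mult_of S + K. x \<notin> S}" for g
  define U1 where "U1 g = (\<Union>k\<in>{Suc K..<2 * g}. \<Union>m\<in>{k<..g + 1}. frob_class g m k)" for g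
  define I where "I g = {500..g + 1} \<times> {k. k < 2 * g \<and> g \<le> 3 * k}" for g :: nat
  define U2 where "U2 g = (\<Union>p\<in>I g. frob_class g (fst p) (snd p))" for g
  define U3 where "U3 g = (\<Union>m\<in>{1..<500}. {S \<in> semigroups_of_genus g. mult_of S = m})" for g
  have finI: "finite (I g)" for g unfolding I_def by (intro finite_cartesian_product) auto
  have cover: "T g \<subseteq> U1 g \<union> (U2 g \<union> U3 g)" for g
  proof
    fix S assume "S \<in> T g"
    then obtain x where S: "S \<in> semigroups_of_genus g" and x: "2 * mult_of S + K < x" "x \<notin> S"
      by (auto simp: T_def)
    obtain k where k: "K < k" "k < 2 * g" "g \<le> 2 * mult_of S + k" "S \<in> frob_class g (mult_of S) k"
      using frob_class_cover[OF S x] .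
    have m: "0 < mult_of S" "mult_of S \<le> g + 1" using multD(1)[OF S] mult_le[OF S] by auto
    consider "k < mult_of S" | "mult_of S \<le> k" "mult_of S < 500" | "mult_of S \<le> k" "500 \<le> mult_of S" by linarith
    then show "S \<in> U1 g \<union> (U2 g \<union> U3 g)"
    proof cases
      case 1
      then have "S \<in> U1 g" using k m unfolding U1_def by (intro UN_I[of k] UN_I[of "mult_of S"]) auto
      then show ?thesis by simp
    next
      case 2
      then have "S \<in> U3 g" using S m by (auto simp: U3_def)
      then show ?thesis by simp
    next
      case 3
      then have "S \<in> U2 g" using k m unfolding U2_def
        by (intro UN_I[of "(mult_of S, k)"]) (auto simp: I_def)
      then show ?thesis by simp
    qed
  qed
  have U1: "real (card (U1 g)) \<le> \<delta> / 3 * phi ^ g" for g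
  proof -
    have "card (U1 g) \<le> (\<Sum>k\<in>{Suc K..<2 * g}. card (\<Union>m\<in>{k<..g + 1}. frob_class g m k))"
      unfolding U1_def by (rule card_UN_le) simp
    then have "real (card (U1 g)) \<le> (\<Sum>k\<in>{Suc K..<2 * g}. real (card (\<Union>m\<in>{k<..g + 1}. frob_class g m k)))"
      by (simp flip: of_nat_sum)
    also have "\<dots> \<le> (\<Sum>k\<in>{Suc K..<2 * g}. phi ^ g * a k)"
    proof (rule sum_mono)
      fix k
      have "real (card (\<Union>m\<in>{k<..g + 1}. frob_class g m k))
          \<le> phi ^ g * (2 * (real k + 1) * (tau ^ (k + 2) / phi ^ (k + 2)))"
        by (rule card_frob_classes_small_le)
      also have "\<dots> \<le> phi ^ g * (2 * (real k + 1) * rho ^ k)"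
        using tau_phi_le_rho[of 0 k] phi_pos by (intro mult_left_mono) auto
      finally show "real (card (\<Union>m\<in>{k<..g + 1}. frob_class g m k)) \<le> phi ^ g * a k"
        by (simp add: a_def)
    qed
    also have "\<dots> = phi ^ g * sum a {Suc K..<2 * g}" by (simp add: sum_distrib_left)
    also have "\<dots> \<le> phi ^ g * (\<delta> / 3)"
      using K[of "2 * g"] phi_pos by (intro mult_left_mono) auto
    finally show ?thesis by (simp add: mult.commute)
  qed
  have U2: "real (card (U2 g)) \<le> phi ^ g * (16 * ((real g + 1) ^ 3 * s ^ g))" for g
  proof -
    have "card (U2 g) \<le> (\<Sum>p\<in>I g. card (frob_class g (fst p) (snd p)))"
      unfolding U2_def by (rule card_UN_le[OF finI])
    then have "real (card (U2 g)) \<le> (\<Sum>p\<in>I g. real (card (frob_class g (fst p) (snd p))))"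
      by (simp flip: of_nat_sum)
    also have "\<dots> \<le> (\<Sum>p\<in>I g. phi ^ g * (4 * (real g + 1) * s ^ g))"
    proof (rule sum_mono)
      fix p assume p: "p \<in> I g"
      obtain m k where mk: "p = (m, k)" by (cases p)
      have m: "500 \<le> m" and k: "k < 2 * g" "g \<le> 3 * k" using p by (auto simp: I_def mk)
      have "500 * (k div m) \<le> m * (k div m)" using m by simp
      also have "\<dots> \<le> k" by simp
      finally have j: "500 * (k div m) \<le> k" .
      have "rho ^ k = rho powr real k" using rho_bounds by (simp add: powr_realpow)
      also have "\<dots> \<le> rho powr (1 / 3 * real g)" using rho_bounds k by (intro powr_mono') auto
      also have "\<dots> = s ^ g" using rho_bounds by (simp only: s_def powr_power_nat)
      finally have rk: "rho ^ k \<le> s ^ g" .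
      have "real (card (frob_class g m k))
          \<le> phi ^ g * (2 * (real k + 1) * (tau ^ (k + 2 + 2 * (k div m)) / phi ^ (k + 2)))"
        using m by (intro card_frob_class_le) auto
      also have "\<dots> \<le> phi ^ g * (2 * (2 * (real g + 1)) * s ^ g)"
      proof (intro mult_left_mono[OF mult_mono])
        show "tau ^ (k + 2 + 2 * (k div m)) / phi ^ (k + 2) \<le> s ^ g"
          using tau_phi_le_rho[OF j] rk by linarith
      qed (use k phi_pos tau_bounds in auto)
      finally show "real (card (frob_class g (fst p) (snd p))) \<le> phi ^ g * (4 * (real g + 1) * s ^ g)"
        by (simp add: mk)
    qed
    also have "\<dots> = real (card (I g)) * (phi ^ g * (4 * (real g + 1) * s ^ g))" by simp
    also have "\<dots> \<le> (4 * (real g + 1)\<^sup>2) * (phi ^ g * (4 * (real g + 1) * s ^ g))"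
    proof (rule mult_right_mono)
      have "card (I g) \<le> card ({500..g + 1} \<times> {..<2 * g})"
        by (rule card_mono) (auto simp: I_def)
      also have "\<dots> \<le> (2 * (g + 1)) * (2 * (g + 1))"
        unfolding card_cartesian_product by (intro mult_mono) auto
      finally have "real (card (I g)) \<le> real ((2 * (g + 1)) * (2 * (g + 1)))" by (rule of_nat_mono)
      then show "real (card (I g)) \<le> 4 * (real g + 1)\<^sup>2" by (simp add: power2_eq_square algebra_simps)
    qed (use phi_pos s in auto)
    also have "\<dots> = phi ^ g * (16 * ((real g + 1) ^ 3 * s ^ g))"
      by (simp only: power2_eq_square power3_eq_cube) simp
    finally show ?thesis .
  qed
  have U3: "real (card (U3 g)) \<le> phi ^ g * (500 * ((real g + 1) ^ 500 * (1 / phi) ^ g))" for g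
  proof -
    have "card (U3 g) \<le> (\<Sum>m\<in>{1..<500}. card {S \<in> semigroups_of_genus g. mult_of S = m})"
      unfolding U3_def by (rule card_UN_le) simp
    also have "\<dots> \<le> (\<Sum>m\<in>{1..<500::nat}. (g + 1) ^ 500)"
    proof (rule sum_mono)
      fix m :: nat assume m: "m \<in> {1..<500}"
      have "card {S \<in> semigroups_of_genus g. mult_of S = m} \<le> (g + 1) ^ m"
        using m by (intro card_mult_eq_le) auto
      also have "\<dots> \<le> (g + 1) ^ 500" using m by (intro power_increasing) auto
      finally show "card {S \<in> semigroups_of_genus g. mult_of S = m} \<le> (g + 1) ^ 500" .
    qed
    also have "\<dots> = 499 * (g + 1) ^ 500" by simp
    also have "\<dots> \<le> 500 * (g + 1) ^ 500" by (rule mult_right_mono) auto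
    finally have "real (card (U3 g)) \<le> real (500 * (g + 1) ^ 500)" by (rule of_nat_mono)
    also have "\<dots> = 500 * (real g + 1) ^ 500"
      by (simp only: of_nat_mult of_nat_power of_nat_add of_nat_1 of_nat_numeral)
    also have "\<dots> = phi ^ g * (500 * ((real g + 1) ^ 500 * (1 / phi) ^ g))"
      using phi_pos by (simp only: power_divide power_one) (simp add: mult.assoc)
    finally show ?thesis .
  qed
  have "(\<lambda>g. 16 * ((real g + 1) ^ 3 * s ^ g)) \<longlonglongrightarrow> 16 * 0"
    by (intro tendsto_mult_left poly_times_geometric_tendsto_0 s)
  then have E2: "\<forall>\<^sub>F g in sequentially. 16 * ((real g + 1) ^ 3 * s ^ g) < \<delta> / 3"
    by (rule order_tendstoD) (use \<delta> in simp)
  have "(\<lambda>g. 500 * ((real g + 1) ^ 500 * (1 / phi) ^ g)) \<longlonglongrightarrow> 500 * 0"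
    using phi_gt_1 by (intro tendsto_mult_left poly_times_geometric_tendsto_0) auto
  then have E3: "\<forall>\<^sub>F g in sequentially. 500 * ((real g + 1) ^ 500 * (1 / phi) ^ g) < \<delta> / 3"
    by (rule order_tendstoD) (use \<delta> in simp)
  have "\<forall>\<^sub>F g in sequentially. real (card (T g)) \<le> \<delta> * phi ^ g"
    using E2 E3
  proof eventually_elim
    case (elim g)
    have fin: "finite (U1 g \<union> (U2 g \<union> U3 g))" using finI by (auto simp: U1_def U2_def U3_def)
    have "card (T g) \<le> card (U1 g) + (card (U2 g) + card (U3 g))"
      using card_mono[OF fin cover] card_Un_le[of "U1 g" "U2 g \<union> U3 g"] card_Un_le[of "U2 g" "U3 g"]
      by linarith
    then have "real (card (T g)) \<le> real (card (U1 g)) + (real (card (U2 g)) + real (card (U3 g)))"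
      by (simp flip: of_nat_add)
    also have "\<dots> \<le> \<delta> / 3 * phi ^ g + (phi ^ g * (\<delta> / 3) + phi ^ g * (\<delta> / 3))"
      using elim phi_pos
      by (intro add_mono U1 order_trans[OF U2] order_trans[OF U3] mult_left_mono) auto
    finally show ?case by (simp add: algebra_simps)
  qed
  then show ?thesis unfolding T_def by blast
qed

section \<open>Large deviations of binomial diagonals\<close>

lemma gamma_bounds: "0.7 < gamma" "gamma < 0.73"
  using phi_bounds by (simp_all add: gamma_def phi_def)

text \<open>At \<open>x = phi\<close> the derivative of the Chernoff exponent
  \<open>ln x - gamma * (2 * ln x - ln (x + 1))\<close> vanishes.\<close>

lemma gamma_critical: "gamma * (2 / phi - 1 / (phi + 1)) = 1 / phi"
proof -
  have 1: "1 / (phi + 1) = 2 - phi"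
    using phi_sq phi_pos by (simp add: field_simps)
  have 2: "gamma * (2 * (phi - 1) - (2 - phi)) = phi - 1"
  proof -
    have "sqrt 5 * sqrt 5 = (5 :: real)" by simp
    then show ?thesis unfolding gamma_def phi_def by (simp add: field_simps)
  qed
  have 3: "2 / phi = 2 * (phi - 1)" using inverse_phi by (simp add: field_simps)
  show ?thesis unfolding 1 3 inverse_phi by (rule 2)
qed

text \<open>The Chernoff bound optimises \<open>choose_le_power\<close> over its free parameter; at \<open>phi\<close> the bound
  equals \<open>phi ^ N\<close>, and it is stationary there exactly when \<open>n / N = gamma\<close>.\<close>

lemma chernoff_parameters:
  fixes \<eta> :: real
  assumes \<eta>: "0 < \<eta>"
  obtains x y where "1 < x" "x < phi" "x * (x\<^sup>2 / (x + 1)) powr (- (gamma - \<eta>)) < phi"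
    "phi < y" "y * (y\<^sup>2 / (y + 1)) powr (- (gamma + \<eta>)) < phi"
proof -
  \<comment> \<open>\<open>f \<nu> x\<close> is the exponential rate of the bound when
    \<open>n = \<nu> * N\<close>. Its value at \<open>phi\<close> is \<open>ln phi\<close> for every
    \<open>\<nu>\<close>, so the sign of the derivative there tells on which side of
    \<open>phi\<close> the bound improves.\<close>
  define f where "f \<nu> x = ln x - \<nu> * (2 * ln x - ln (x + 1))" for \<nu> x :: real
  have deriv: "DERIV (f \<nu>) phi :> 1 / phi - \<nu> * (2 / phi - 1 / (phi + 1))" for \<nu>
    unfolding f_def using phi_pos by (auto intro!: derivative_eq_intros)
  have "ln (phi + 1) = 2 * ln phi"
    using phi_pos by (simp add: ln_mult flip: phi_sq)
  then have f_phi: "f \<nu> phi = ln phi" for \<nu> by (simp add: f_def)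
  have "1 / (phi + 1) < 2 / phi" using phi_pos by (simp add: divide_simps)
  then have pos: "0 < 2 / phi - 1 / (phi + 1)" by simp
  have powr_eq: "x * (x\<^sup>2 / (x + 1)) powr (- \<nu>) = exp (f \<nu> x)" if "0 < x" for x \<nu>
    using that by (simp add: f_def powr_def ln_div ln_realpow exp_diff exp_add exp_minus field_simps)
  have "0 < 1 / phi - (gamma - \<eta>) * (2 / phi - 1 / (phi + 1))"
    using gamma_critical mult_pos_pos[OF \<eta> pos] by (simp add: left_diff_distrib)
  from DERIV_pos_inc_left[OF deriv this]
  obtain d1 where d1: "0 < d1" "\<And>h. 0 < h \<Longrightarrow> h < d1 \<Longrightarrow> f (gamma - \<eta>) (phi - h) < ln phi"
    by (auto simp: f_phi)
  have "1 / phi - (gamma + \<eta>) * (2 / phi - 1 / (phi + 1)) < 0"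
    using gamma_critical mult_pos_pos[OF \<eta> pos] by (simp add: distrib_right)
  from DERIV_neg_dec_right[OF deriv this]
  obtain d2 where d2: "0 < d2" "\<And>h. 0 < h \<Longrightarrow> h < d2 \<Longrightarrow> f (gamma + \<eta>) (phi + h) < ln phi"
    by (auto simp: f_phi)
  \<comment> \<open>The cap 0.1 keeps \<open>phi - h1\<close> above 1.\<close>
  define h1 where "h1 = min (d1 / 2) 0.1"
  define h2 where "h2 = d2 / 2"
  have h: "0 < h1" "h1 < d1" "h1 \<le> 0.1" "0 < h2" "h2 < d2"
    using d1(1) d2(1) by (auto simp: h1_def h2_def)
  have "exp (f (gamma - \<eta>) (phi - h1)) < exp (ln phi)" "exp (f (gamma + \<eta>) (phi + h2)) < exp (ln phi)"
    using d1(2)[of h1] d2(2)[of h2] h by auto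
  then show ?thesis
    using that[of "phi - h1" "phi + h2"] h phi_bounds powr_eq[of "phi - h1" "gamma - \<eta>"]
      powr_eq[of "phi + h2" "gamma + \<eta>"] by (simp only: exp_ln[OF phi_pos]) simp
qed

text \<open>\<open>z\<^sup>2 / (z + 1)\<close> crosses 1 at \<open>z = phi\<close>, so the bound
  increases in \<open>n\<close> for \<open>z = x < phi\<close> and decreases for
  \<open>z = y > phi\<close>. Hence \<open>x\<close> serves all \<open>n\<close> below the window
  and \<open>y\<close> all \<open>n\<close> above it; the fixed offsets affect only
  \<open>B\<close>.\<close>

lemma choose_off_window_le:
  fixes \<eta> :: real
  assumes \<eta>: "0 < \<eta>" "\<eta> < gamma"
  obtains q B where "0 < q" "q < phi" "0 \<le> B"
    "\<And>n g. n \<le> g + s - t \<Longrightarrow> t \<le> g + s \<Longrightarrow> \<bar>real (n + u) - gamma * real g\<bar> \<ge> \<eta> * real g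
       \<Longrightarrow> real (n choose (g + s - t - n)) \<le> B * q ^ g"
proof -
  obtain x y where x: "1 < x" "x < phi" and qx: "x * (x\<^sup>2 / (x + 1)) powr (- (gamma - \<eta>)) < phi"
    and y: "phi < y" and qy: "y * (y\<^sup>2 / (y + 1)) powr (- (gamma + \<eta>)) < phi"
    using chernoff_parameters[OF \<eta>(1)] by blast
  define a b where "a = x\<^sup>2 / (x + 1)" and "b = y\<^sup>2 / (y + 1)"
  have y1: "1 < y" using y phi_gt_1 by simp
  have a: "0 < a" "a < 1"
  proof -
    have "x * (x - 1) < phi * (phi - 1)" using x by (intro mult_strict_mono) auto
    then have "x * x < x + 1" using phi_sq by (simp add: algebra_simps)
    then show "0 < a" "a < 1" using x by (simp_all add: a_def power2_eq_square)
  qed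
  have b: "1 < b"
  proof -
    have "phi * (phi - 1) < y * (y - 1)" using y phi_gt_1 by (intro mult_strict_mono) auto
    then have "y + 1 < y * y" using phi_sq by (simp add: algebra_simps)
    then show "1 < b" using y1 by (simp add: b_def power2_eq_square)
  qed
  define q1 q2 where "q1 = x * a powr (- (gamma - \<eta>))" and "q2 = y * b powr (- (gamma + \<eta>))"
  define q where "q = max q1 q2"
  define B where "B = x ^ s + y ^ s * b ^ u"
  have q12: "0 < q1" "0 < q2" using x y1 a b by (auto simp: q1_def q2_def)
  have main: "real (n choose (N - n)) \<le> z ^ N * (z\<^sup>2 / (z + 1)) powr (- real n)"
    if "n \<le> N" "0 < z" for n N and z :: real
  proof -
    have "real (n choose (N - n)) \<le> ((z + 1) / z) ^ n * z ^ (N - n)" by (rule choose_le_power[OF that(2)])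
    also have "\<dots> = z ^ N * (1 / (z\<^sup>2 / (z + 1)) ^ n)"
      using that by (simp add: power_divide power_diff power_mult_distrib power2_eq_square field_simps)
    also have "1 / (z\<^sup>2 / (z + 1)) ^ n = (z\<^sup>2 / (z + 1)) powr (- real n)"
      using that by (simp add: powr_minus powr_realpow divide_inverse)
    finally show ?thesis .
  qed
  have bound: "real (n choose (g + s - t - n)) \<le> B * q ^ g"
    if n: "n \<le> g + s - t" and t: "t \<le> g + s" and dev: "\<bar>real (n + u) - gamma * real g\<bar> \<ge> \<eta> * real g" for n g
  proof -
    have N: "z ^ (g + s - t) \<le> z ^ g * z ^ s" if "1 < z" for z :: real
      using that by (simp flip: power_add)
    consider "real (n + u) \<le> (gamma - \<eta>) * real g" | "(gamma + \<eta>) * real g \<le> real (n + u)"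
      using dev by (fastforce simp: abs_if algebra_simps split: if_splits)
    then show ?thesis
    proof cases
      case 1
      have "real (n choose (g + s - t - n)) \<le> x ^ (g + s - t) * a powr (- real n)"
        using main[OF n, of x] x by (simp add: a_def)
      also have "\<dots> \<le> (x ^ g * x ^ s) * a powr (- (gamma - \<eta>) * real g)"
        using 1 a x by (intro mult_mono N powr_mono') (auto simp: algebra_simps)
      also have "\<dots> = x ^ s * q1 ^ g"
        using a by (simp add: q1_def power_mult_distrib powr_power_nat)
      also have "\<dots> \<le> B * q ^ g"
        using q12 y1 b x by (intro mult_mono power_mono) (auto simp: B_def q_def)
      finally show ?thesis .
    next
      case 2
      have "real (n choose (g + s - t - n)) \<le> y ^ (g + s - t) * b powr (- real n)"
        using main[OF n, of y] y1 by (simp add: b_def)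
      also have "\<dots> \<le> (y ^ g * y ^ s) * b powr (real u + (- (gamma + \<eta>) * real g))"
        using 2 b y1 by (intro mult_mono N powr_mono) (auto simp: algebra_simps)
      also have "\<dots> = y ^ s * b ^ u * q2 ^ g"
        using b by (simp add: q2_def power_mult_distrib powr_power_nat powr_add powr_realpow)
      also have "\<dots> \<le> B * q ^ g"
        using q12 y1 b x by (intro mult_mono power_mono) (auto simp: B_def q_def)
      finally show ?thesis .
    qed
  qed
  show ?thesis
  proof (rule that[of q B])
    show "0 < q" "q < phi" using q12 qx qy by (auto simp: q_def q1_def q2_def a_def b_def)
    show "0 \<le> B" using x y1 b by (simp add: B_def)
  qed (rule bound)
qed

section \<open>Diagonal sums restricted to a window around \<open>gamma * g\<close>\<close>

definition window :: "real \<Rightarrow> nat \<Rightarrow> nat set" where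
  "window \<eta> g = {m. \<bar>real m - gamma * real g\<bar> < \<eta> * real g}"

lemma finite_window [simp]: "finite (window \<eta> g)"
proof -
  have "m \<le> nat \<lceil>(gamma + \<eta>) * real g\<rceil>" if "m \<in> window \<eta> g" for m
  proof -
    have "real m < (gamma + \<eta>) * real g" using that by (auto simp: window_def abs_if algebra_simps split: if_splits)
    then show ?thesis by linarith
  qed
  then have "window \<eta> g \<subseteq> {..nat \<lceil>(gamma + \<eta>) * real g\<rceil>}" by auto
  then show ?thesis by (rule finite_subset) simp
qed

lemma eventually_linear_ge:
  fixes c :: real
  assumes "0 < c"
  shows "\<forall>\<^sub>F g in sequentially. b \<le> c * real g"
  using assms by real_asymp

lemma fib_shift_asymptotics:
  "(\<lambda>g. real (fib (Suc (g + s - t))) / phi ^ g) \<longlonglongrightarrow> phi ^ (s + 1) / (phi ^ t * sqrt 5)"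
proof -
  have "filterlim (\<lambda>g. Suc (g + s - t)) at_top sequentially"
    unfolding filterlim_at_top
  proof
    fix Z show "\<forall>\<^sub>F g in sequentially. Z \<le> Suc (g + s - t)"
      using eventually_ge_at_top[of "Z + t"] by eventually_elim auto
  qed
  from filterlim_compose[OF fib_asymptotics this]
  have "(\<lambda>g. real (fib (Suc (g + s - t))) / (phi ^ Suc (g + s - t) / sqrt 5)) \<longlonglongrightarrow> 1"
    by (simp add: phi_def)
  then have "(\<lambda>g. real (fib (Suc (g + s - t))) / (phi ^ Suc (g + s - t) / sqrt 5) * (phi ^ (s + 1) / (phi ^ t * sqrt 5)))
      \<longlonglongrightarrow> 1 * (phi ^ (s + 1) / (phi ^ t * sqrt 5))"
    by (intro tendsto_mult_right)
  moreover have "\<forall>\<^sub>F g in sequentially.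
      real (fib (Suc (g + s - t))) / (phi ^ Suc (g + s - t) / sqrt 5) * (phi ^ (s + 1) / (phi ^ t * sqrt 5))
      = real (fib (Suc (g + s - t))) / phi ^ g"
    using eventually_ge_at_top[of t]
  proof eventually_elim
    case (elim g)
    have "phi ^ Suc (g + s - t) * phi ^ t = phi ^ g * phi ^ (s + 1)"
      using elim by (simp flip: power_add)
    then show ?case using phi_pos by (simp add: field_simps)
  qed
  ultimately show ?thesis by (simp add: filterlim_cong[OF refl refl])
qed

text \<open>The complete diagonal is a Fibonacci number. At most \<open>(g + 1) * (s + 1)\<close>
  terms fall outside the window, each bounded by \<open>B * q ^ g\<close> with
  \<open>q < phi\<close>.\<close>

lemma window_sum_asymptotics:
  fixes \<eta> :: real
  assumes \<eta>: "0 < \<eta>" "\<eta> \<le> 0.1"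
  shows "(\<lambda>g. (\<Sum>m\<in>window \<eta> g. real ((m - u) choose (g + s - t - (m - u)))) / phi ^ g)
     \<longlonglongrightarrow> phi ^ (s + 1) / (phi ^ t * sqrt 5)"
proof -
  define N where "N g = g + s - t" for g
  have "\<eta> < gamma" using \<eta> gamma_bounds by simp
  from choose_off_window_le[OF \<eta>(1) this, of s t u]
  obtain q B where q: "0 < q" "q < phi" "0 \<le> B" and off:
    "\<And>n g. n \<le> N g \<Longrightarrow> t \<le> g + s \<Longrightarrow> \<bar>real (n + u) - gamma * real g\<bar> \<ge> \<eta> * real g
       \<Longrightarrow> real (n choose (N g - n)) \<le> B * q ^ g"
    unfolding N_def by blast
  define W where "W g = (\<Sum>m\<in>window \<eta> g. real ((m - u) choose (N g - (m - u))))" for g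
  have c: "(0 :: real) < 0.6" "(0 :: real) < 0.1" by simp_all
  have E: "\<forall>\<^sub>F g in sequentially. norm (W g / phi ^ g - real (fib (Suc (N g))) / phi ^ g)
      \<le> (B * (real s + 1)) * ((real g + 1) ^ 1 * (q / phi) ^ g)"
    using eventually_linear_ge[OF c(1), of "real u"] eventually_linear_ge[OF c(2), of "real (t + u)"]
      eventually_ge_at_top[of t] eventually_gt_at_top[of 0]
  proof eventually_elim
    case (elim g)
    \<comment> \<open>The window lies between \<open>0.6 * g\<close> and \<open>0.9 * g\<close>, so
      for large \<open>g\<close> the subtraction \<open>m - u\<close> is not truncated and stays on
      the diagonal.\<close>
    have win: "u \<le> m \<and> m - u \<le> N g" if "m \<in> window \<eta> g" for m
    proof -
      have w: "\<bar>real m - gamma * real g\<bar> < 0.1 * real g"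
        using that mult_right_mono[OF \<eta>(2), of "real g"] by (simp add: window_def)
      have w': "0.7 * real g \<le> gamma * real g" "gamma * real g \<le> 0.8 * real g"
        using gamma_bounds mult_right_mono[of "0.7" gamma "real g"] mult_right_mono[of gamma "0.8" "real g"]
        by simp_all
      have "0.6 * real g < real m" using w w' by linarith
      moreover have "real m < 0.9 * real g" using w w' by linarith
      ultimately have "real u < real m" "real (m + t) < real g" using elim by auto
      then show ?thesis by (auto simp: N_def)
    qed
    define V where "V = (\<lambda>m. m - u) ` window \<eta> g"
    have inj: "inj_on (\<lambda>m. m - u) (window \<eta> g)"
    proof (rule inj_onI)
      fix m m' assume "m \<in> window \<eta> g" "m' \<in> window \<eta> g" "m - u = m' - u"
      then show "m = m'" using win[of m] win[of m'] by (metis le_add_diff_inverse)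
    qed
    have "W g = (\<Sum>n\<in>V. real (n choose (N g - n)))"
      unfolding W_def V_def by (simp add: sum.reindex[OF inj])
    moreover have "real (fib (Suc (N g))) = (\<Sum>n\<le>N g. real (n choose (N g - n)))"
      by (simp flip: sum_choose_diagonal)
    moreover have "V \<subseteq> {..N g}" using win by (auto simp: V_def)
    ultimately have "real (fib (Suc (N g))) - W g = (\<Sum>n\<in>{..N g} - V. real (n choose (N g - n)))"
      by (simp add: sum_diff)
    moreover have "(\<Sum>n\<in>{..N g} - V. real (n choose (N g - n))) \<le> (\<Sum>n\<in>{..N g} - V. B * q ^ g)"
    proof (rule sum_mono)
      fix n assume n: "n \<in> {..N g} - V"
      then have "n + u \<notin> window \<eta> g" unfolding V_def by (metis Diff_iff add_diff_cancel_right' image_eqI)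
      then show "real (n choose (N g - n)) \<le> B * q ^ g"
        using n elim by (intro off) (auto simp: window_def not_less)
    qed
    moreover have "(\<Sum>n\<in>{..N g} - V. B * q ^ g) \<le> ((real g + 1) * (real s + 1)) * (B * q ^ g)"
    proof -
      have "card ({..N g} - V) \<le> card {..N g}" by (rule card_mono) auto
      then have "card ({..N g} - V) \<le> (g + 1) * (s + 1)" by (simp add: N_def)
      then have "real (card ({..N g} - V)) \<le> (real g + 1) * (real s + 1)"
        by (metis (no_types, lifting) of_nat_1 of_nat_add of_nat_le_iff of_nat_mult)
      then show ?thesis using q by (simp add: mult_right_mono)
    qed
    moreover have "0 \<le> (\<Sum>n\<in>{..N g} - V. real (n choose (N g - n)))" by (rule sum_nonneg) simp
    ultimately have "\<bar>W g - real (fib (Suc (N g)))\<bar> \<le> ((real g + 1) * (real s + 1)) * (B * q ^ g)"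
      by linarith
    then have "\<bar>W g - real (fib (Suc (N g)))\<bar> / phi ^ g \<le> ((real g + 1) * (real s + 1)) * (B * q ^ g) / phi ^ g"
      using phi_pos by (intro divide_right_mono) auto
    also have "\<dots> = (B * (real s + 1)) * ((real g + 1) ^ 1 * (q / phi) ^ g)"
      by (simp only: power_divide power_one_right times_divide_eq_right mult_ac)
    finally show ?case
      using phi_pos by (simp only: real_norm_def diff_divide_distrib[symmetric] abs_divide power_abs)
  qed
  have "(\<lambda>g. (B * (real s + 1)) * ((real g + 1) ^ 1 * (q / phi) ^ g)) \<longlonglongrightarrow> (B * (real s + 1)) * 0"
    using q phi_pos by (intro tendsto_mult_left poly_times_geometric_tendsto_0) auto
  then have L: "(\<lambda>g. (B * (real s + 1)) * ((real g + 1) ^ 1 * (q / phi) ^ g)) \<longlonglongrightarrow> 0"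
    by (simp only: mult_zero_right)
  have "(\<lambda>g. W g / phi ^ g - real (fib (Suc (N g))) / phi ^ g) \<longlonglongrightarrow> 0"
    by (rule Lim_null_comparison[OF E L])
  from tendsto_add[OF this fib_shift_asymptotics[of s t]]
  show ?thesis unfolding W_def N_def by (simp only: diff_add_cancel add_0_left)
qed

section \<open>Semigroups whose Frobenius number is close to twice the multiplicity\<close>

text \<open>When \<open>K < m\<close>, a semigroup of multiplicity \<open>m\<close> containing everything above \<open>2 m + K\<close> consists of a
  pattern in \<open>[m, m + K]\<close> and \<open>[2 m, 2 m + K]\<close> and an arbitrary subset of \<open>middle m K\<close>.\<close>

definition tame :: "nat \<Rightarrow> nat \<Rightarrow> nat set set" where
  "tame K g = {S \<in> semigroups_of_genus g. \<forall>x>2 * mult_of S + K. x \<in> S}"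

definition upper :: "nat \<Rightarrow> nat \<Rightarrow> nat set \<Rightarrow> nat set" where
  "upper m K S = {b. b \<le> K \<and> 2 * m + b \<in> S}"

definition patterns :: "nat \<Rightarrow> (nat set \<times> nat set) set" where
  "patterns K = {(A, B). A \<subseteq> {..K} \<and> B \<subseteq> {..K} \<and> 0 \<in> A \<and> (\<forall>a\<in>A. \<forall>b\<in>A. a + b \<le> K \<longrightarrow> a + b \<in> B)}"

definition pattern_class :: "nat \<Rightarrow> nat \<Rightarrow> nat \<Rightarrow> nat set \<times> nat set \<Rightarrow> nat set set" where
  "pattern_class g m K p = {S \<in> tame K g. mult_of S = m \<and> shape m K S = fst p \<and> upper m K S = snd p}"

definition middle :: "nat \<Rightarrow> nat \<Rightarrow> nat set" where
  "middle m K = {m + K<..<2 * m}"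

definition assemble :: "nat \<Rightarrow> nat \<Rightarrow> nat set \<times> nat set \<Rightarrow> nat set \<Rightarrow> nat set" where
  "assemble m K p E = {x. x = 0 \<or> (m \<le> x \<and> x \<le> m + K \<and> x - m \<in> fst p) \<or> (x \<in> middle m K \<and> x \<notin> E)
     \<or> (2 * m \<le> x \<and> x \<le> 2 * m + K \<and> x - 2 * m \<in> snd p) \<or> 2 * m + K < x}"

lemma finite_tame [simp]: "finite (tame K g)"
  by (rule finite_subset[of _ "semigroups_of_genus g"]) (auto simp: tame_def)

lemma finite_pattern_class [simp]: "finite (pattern_class g m K p)"
  by (rule finite_subset[of _ "tame K g"]) (auto simp: pattern_class_def)

lemma finite_patterns [simp]: "finite (patterns K)"
  by (rule finite_subset[of _ "Pow {..K} \<times> Pow {..K}"]) (auto simp: patterns_def)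

lemma region_cases:
  fixes x m K :: nat
  assumes "K < m"
  obtains "x = 0" | "0 < x" "x < m" | "m \<le> x" "x \<le> m + K" | "x \<in> middle m K"
    | "2 * m \<le> x" "x \<le> 2 * m + K" | "2 * m + K < x"
  unfolding middle_def greaterThanLessThan_iff by linarith

lemma pattern_class_eq_assemble:
  assumes S: "S \<in> pattern_class g m K p" and K: "K < m"
  shows "S = assemble m K p (middle m K - S)"
proof (rule set_eqI)
  fix x
  have Sg: "S \<in> semigroups_of_genus g" and m: "mult_of S = m" and F: "\<And>x. 2 * m + K < x \<Longrightarrow> x \<in> S"
    and p: "fst p = {a. a \<le> K \<and> m + a \<in> S}" "snd p = {b. b \<le> K \<and> 2 * m + b \<in> S}"
    using S by (auto simp: pattern_class_def tame_def shape_def upper_def)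
  note D = genus_semigroupD[OF Sg] and M = multD[OF Sg, unfolded m]
  show "x \<in> S \<longleftrightarrow> x \<in> assemble m K p (middle m K - S)"
    using region_cases[OF K, of x]
  proof cases
    case 1
    then show ?thesis using D(1) by (simp add: assemble_def)
  next
    case 2
    then show ?thesis using M(3)[of x] by (auto simp: assemble_def middle_def)
  next
    case 3
    then show ?thesis using K M(1) by (auto simp: assemble_def middle_def p)
  next
    case 4
    then show ?thesis using K M(1) by (auto simp: assemble_def middle_def)
  next
    case 5
    then show ?thesis using K M(1) by (auto simp: assemble_def middle_def p)
  next
    case 6
    then show ?thesis using F[of x] by (auto simp: assemble_def)
  qed
qed

text \<open>Nonzero elements are at least \<open>m\<close>, so two of them with sum at most
  \<open>2 * m + K\<close> both lie in \<open>[m, m + K]\<close>. Closure therefore concerns only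
  the pattern, and the set \<open>E\<close> of middle gaps is free.\<close>

lemma assemble_props:
  assumes p: "p \<in> patterns K" and E: "E \<subseteq> middle m K" and K: "K < m"
  shows "numerical_semigroup (assemble m K p E)"
    and "card (- assemble m K p E) + card (fst p) + card (snd p) = card E + (m + 2 * K + 1)"
    and "mult_of (assemble m K p E) = m"
    and "shape m K (assemble m K p E) = fst p" and "upper m K (assemble m K p E) = snd p"
    and "middle m K - assemble m K p E = E"
proof -
  let ?S = "assemble m K p E"
  have A: "fst p \<subseteq> {..K}" "0 \<in> fst p" and B: "snd p \<subseteq> {..K}"
    and AB: "\<And>a b. a \<in> fst p \<Longrightarrow> b \<in> fst p \<Longrightarrow> a + b \<le> K \<Longrightarrow> a + b \<in> snd p"
    using p by (auto simp: patterns_def)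
  have finA: "finite (fst p)" "finite (snd p)" using A B finite_subset by blast+
  have compl: "- ?S = {1..<m} \<union> ((+) m ` ({..K} - fst p) \<union> (E \<union> (+) (2 * m) ` ({..K} - snd p)))"
  proof (rule set_eqI)
    fix x
    show "x \<in> - ?S \<longleftrightarrow> x \<in> {1..<m} \<union> ((+) m ` ({..K} - fst p) \<union> (E \<union> (+) (2 * m) ` ({..K} - snd p)))"
      using region_cases[OF K, of x]
    proof cases
      case 3
      then have "x = m + (x - m)" "x - m \<le> K" by auto
      then have "x \<in> (+) m ` ({..K} - fst p) \<longleftrightarrow> x - m \<notin> fst p" by (auto simp: image_iff)
      then show ?thesis using 3 K E by (auto simp: assemble_def middle_def)
    next
      case 5
      then have "x = 2 * m + (x - 2 * m)" "x - 2 * m \<le> K" by auto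
      then have "x \<in> (+) (2 * m) ` ({..K} - snd p) \<longleftrightarrow> x - 2 * m \<notin> snd p" by (auto simp: image_iff)
      then show ?thesis using 5 K E by (auto simp: assemble_def middle_def)
    qed (use K E in \<open>auto simp: assemble_def middle_def\<close>)
  qed
  have finE: "finite E" using E by (rule finite_subset) (simp add: middle_def)
  have low: "x = 0 \<or> m \<le> x" if "x \<in> ?S" for x using that by (auto simp: assemble_def middle_def)
  have closed: "x + y \<in> ?S" if xy: "x \<in> ?S" "y \<in> ?S" for x y
  proof (cases "x = 0 \<or> y = 0 \<or> 2 * m + K < x + y")
    case True
    have "2 * m + K < z \<Longrightarrow> z \<in> ?S" for z by (simp add: assemble_def)
    then show ?thesis using True xy by auto
  next
    case False
    then have "m \<le> x" "m \<le> y" using low xy by auto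
    then have x: "x \<le> m + K" "x < 2 * m" and y: "y \<le> m + K" "y < 2 * m" using False K by auto
    have "x - m \<in> fst p" using xy(1) x \<open>m \<le> x\<close> K by (auto simp: assemble_def middle_def)
    moreover have "y - m \<in> fst p" using xy(2) y \<open>m \<le> y\<close> K by (auto simp: assemble_def middle_def)
    moreover have "(x - m) + (y - m) = x + y - 2 * m" using \<open>m \<le> x\<close> \<open>m \<le> y\<close> by simp
    moreover have "x + y - 2 * m \<le> K" using False by linarith
    ultimately have "x + y - 2 * m \<in> snd p" using AB[of "x - m" "y - m"] by simp
    moreover have "2 * m \<le> x + y" "x + y \<le> 2 * m + K" using \<open>m \<le> x\<close> \<open>m \<le> y\<close> False by auto
    ultimately show ?thesis by (simp add: assemble_def)
  qed
  have "finite (- ?S)" unfolding compl using finE by simp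
  then show "numerical_semigroup ?S"
    unfolding numerical_semigroup_def using closed by (auto simp: assemble_def)
  have "card (- ?S) = (m - 1) + (card ((+) m ` ({..K} - fst p)) + (card E + card ((+) (2 * m) ` ({..K} - snd p))))"
  proof -
    have "{1..<m} \<inter> ((+) m ` ({..K} - fst p) \<union> (E \<union> (+) (2 * m) ` ({..K} - snd p))) = {}"
      "(+) m ` ({..K} - fst p) \<inter> (E \<union> (+) (2 * m) ` ({..K} - snd p)) = {}"
      "E \<inter> (+) (2 * m) ` ({..K} - snd p) = {}"
      using E K by (auto simp: middle_def)
    then show ?thesis unfolding compl using finE by (simp add: card_Un_disjoint)
  qed
  also have "card ((+) m ` ({..K} - fst p)) = K + 1 - card (fst p)"
    using A finA by (subst card_image) (auto simp: card_Diff_subset)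
  also have "card ((+) (2 * m) ` ({..K} - snd p)) = K + 1 - card (snd p)"
    using B finA by (subst card_image) (auto simp: card_Diff_subset)
  finally show "card (- ?S) + card (fst p) + card (snd p) = card E + (m + 2 * K + 1)"
    using card_mono[OF _ A(1)] card_mono[OF _ B] K by simp
  have "m \<in> ?S" using A(2) by (simp add: assemble_def)
  then show "mult_of ?S = m"
    unfolding mult_of_def using K low by (intro Least_equality) auto
  show "shape m K ?S = fst p"
    using A K by (auto simp: shape_def assemble_def middle_def)
  show "upper m K ?S = snd p"
    using B K by (auto simp: upper_def assemble_def middle_def)
  show "middle m K - ?S = E"
    using E K by (auto simp: assemble_def middle_def)
qed

text \<open>The genus fixes the number of middle gaps. Prescribing \<open>C\<close> removes
  \<open>card C\<close> candidates from the upper index and leaves that number unchanged.\<close>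

lemma card_pattern_class:
  fixes g m K :: nat
  assumes p: "p \<in> patterns K" and K: "K < m" and C: "C \<subseteq> middle m K"
  defines "X \<equiv> {S \<in> pattern_class g m K p. C \<subseteq> S}" and "s \<equiv> card (fst p) + card (snd p)"
  shows "X \<noteq> {} \<Longrightarrow> m + 2 * K + 1 \<le> g + s"
    and "m + 2 * K + 1 \<le> g + s \<Longrightarrow> card X = (m - (1 + K + card C)) choose (g + s - (m + 2 * K + 1))"
proof -
  have cE: "g + s = card (middle m K - S) + (m + 2 * K + 1)" if "S \<in> pattern_class g m K p" for S
    using assemble_props(2)[OF p Diff_subset K, of S] pattern_class_eq_assemble[OF that K]
      genus_semigroupD(4)[of S g] that
    by (simp add: s_def pattern_class_def tame_def)
  show "m + 2 * K + 1 \<le> g + s" if "X \<noteq> {}"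
    using that cE by (auto simp: X_def)
  assume le: "m + 2 * K + 1 \<le> g + s"
  define r where "r = g + s - (m + 2 * K + 1)"
  have finM: "finite (middle m K)" "card (middle m K) = m - 1 - K" using K by (auto simp: middle_def)
  have "bij_betw (\<lambda>S. middle m K - S) X {E. E \<subseteq> middle m K - C \<and> card E = r}"
  proof (rule bij_betw_byWitness[where f' = "assemble m K p"])
    show "\<forall>S\<in>X. assemble m K p (middle m K - S) = S"
    proof
      fix S assume "S \<in> X"
      then show "assemble m K p (middle m K - S) = S"
        using pattern_class_eq_assemble[OF _ K, of S g p, symmetric] by (simp add: X_def)
    qed
    show "\<forall>E\<in>{E. E \<subseteq> middle m K - C \<and> card E = r}. middle m K - assemble m K p E = E"
      using assemble_props(6)[OF p _ K] by auto
    show "(\<lambda>S. middle m K - S) ` X \<subseteq> {E. E \<subseteq> middle m K - C \<and> card E = r}"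
      using cE by (auto simp: X_def r_def)
    show "assemble m K p ` {E. E \<subseteq> middle m K - C \<and> card E = r} \<subseteq> X"
    proof (rule image_subsetI)
      fix E assume "E \<in> {E. E \<subseteq> middle m K - C \<and> card E = r}"
      then have E: "E \<subseteq> middle m K" "E \<inter> C = {}" "card E = r" by auto
      note P = assemble_props[OF p E(1) K]
      have "card (- assemble m K p E) = g" using P(2) E(3) le by (simp add: r_def s_def)
      then have "assemble m K p E \<in> pattern_class g m K p"
        using P by (auto simp: pattern_class_def tame_def semigroups_of_genus_def genus_def assemble_def)
      moreover have "C \<subseteq> assemble m K p E" using C E(2) by (auto simp: assemble_def)
      ultimately show "assemble m K p E \<in> X" by (simp add: X_def)
    qed
  qed
  then have "card X = card {E. E \<subseteq> middle m K - C \<and> card E = r}" by (rule bij_betw_same_card)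
  also have "\<dots> = card (middle m K - C) choose r" using finM by (intro n_subsets) auto
  also have "card (middle m K - C) = m - (1 + K + card C)"
    using C finM by (simp add: card_Diff_subset finite_subset)
  finally show "card X = (m - (1 + K + card C)) choose (g + s - (m + 2 * K + 1))" by (simp add: r_def)
qed

text \<open>For the second claim: if \<open>mult_of S \<le> K\<close>, all gaps lie in
  \<open>{1..3 * K}\<close>, too few when \<open>3 * K < g\<close>.\<close>

lemma tame_pattern:
  assumes S: "S \<in> tame K g"
  shows "(shape (mult_of S) K S, upper (mult_of S) K S) \<in> patterns K"
    and "3 * K < g \<Longrightarrow> K < mult_of S"
proof -
  have Sg: "S \<in> semigroups_of_genus g" and F: "\<And>x. x > 2 * mult_of S + K \<Longrightarrow> x \<in> S"
    using S by (auto simp: tame_def)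
  note D = genus_semigroupD[OF Sg] and M = multD[OF Sg]
  have "2 * mult_of S + (a + b) \<in> S" if "mult_of S + a \<in> S" "mult_of S + b \<in> S" for a b
    using D(2)[OF that] by (simp add: mult_2 add_ac)
  then show "(shape (mult_of S) K S, upper (mult_of S) K S) \<in> patterns K"
    using M(2) by (auto simp: patterns_def shape_def upper_def)
  show "K < mult_of S" if g: "3 * K < g"
  proof (rule ccontr)
    assume "\<not> K < mult_of S"
    moreover have "- S \<subseteq> {1..2 * mult_of S + K}"
    proof
      fix x assume x: "x \<in> - S"
      then have "x \<noteq> 0" using D(1) by (cases "x = 0") auto
      moreover have "x \<le> 2 * mult_of S + K" using F[of x] x by (metis ComplD not_less)
      ultimately show "x \<in> {1..2 * mult_of S + K}" by simp
    qed
    then have "g \<le> 2 * mult_of S + K" using card_mono[of "{1..2 * mult_of S + K}" "- S"] D(4) by simp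
    ultimately show False using g by simp
  qed
qed

section \<open>Counting tame semigroups by pattern\<close>

text \<open>The number of middle gaps is written as \<open>N - n\<close> with
  \<open>n = m - (1 + K + c)\<close>, so that \<open>m\<close> runs along a diagonal; its index
  \<open>N\<close> drops by one for each of the \<open>c\<close> prescribed elements.\<close>

definition window_count :: "real \<Rightarrow> nat \<Rightarrow> nat \<Rightarrow> nat \<Rightarrow> nat" where
  "window_count \<eta> K c g = (\<Sum>p\<in>patterns K. \<Sum>m\<in>window \<eta> g.
     (m - (1 + K + c)) choose (g + (card (fst p) + card (snd p)) - (3 * K + 2 + c) - (m - (1 + K + c))))"

lemma card_tame_window:
  assumes K: "\<And>m. m \<in> window \<eta> g \<Longrightarrow> K < m \<and> m + 2 * K + 1 \<le> g"
    and C: "\<And>m. m \<in> window \<eta> g \<Longrightarrow> C \<subseteq> middle m K"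
  shows "card {S \<in> tame K g. mult_of S \<in> window \<eta> g \<and> C \<subseteq> S} = window_count \<eta> K (card C) g"
proof -
  let ?I = "patterns K \<times> window \<eta> g"
  let ?X = "\<lambda>q. {S \<in> pattern_class g (snd q) K (fst q). C \<subseteq> S}"
  have "{S \<in> tame K g. mult_of S \<in> window \<eta> g \<and> C \<subseteq> S} = (\<Union>q\<in>?I. ?X q)"
  proof (intro Set.equalityI subsetI)
    fix S assume S: "S \<in> {S \<in> tame K g. mult_of S \<in> window \<eta> g \<and> C \<subseteq> S}"
    then have "S \<in> ?X ((shape (mult_of S) K S, upper (mult_of S) K S), mult_of S)"
      by (simp add: pattern_class_def)
    moreover have "((shape (mult_of S) K S, upper (mult_of S) K S), mult_of S) \<in> ?I"
      using S tame_pattern(1)[of S K g] by simp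
    ultimately show "S \<in> (\<Union>q\<in>?I. ?X q)" by (rule UN_I[rotated])
  next
    fix S assume "S \<in> (\<Union>q\<in>?I. ?X q)"
    then obtain q where "q \<in> ?I" "S \<in> ?X q" by blast
    then show "S \<in> {S \<in> tame K g. mult_of S \<in> window \<eta> g \<and> C \<subseteq> S}"
      by (auto simp: pattern_class_def)
  qed
  then have "card {S \<in> tame K g. mult_of S \<in> window \<eta> g \<and> C \<subseteq> S} = card (\<Union>q\<in>?I. ?X q)" by simp
  also have "\<dots> = (\<Sum>q\<in>?I. card (?X q))"
    by (rule card_UN_disjoint) (auto simp: pattern_class_def)
  also have "\<dots> = (\<Sum>q\<in>?I. (snd q - (1 + K + card C)) choose
      (g + (card (fst (fst q)) + card (snd (fst q))) - (3 * K + 2 + card C) - (snd q - (1 + K + card C))))"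
  proof (rule sum.cong[OF refl])
    fix q assume q: "q \<in> ?I"
    define m where "m = snd q"
    have m: "m \<in> window \<eta> g" and p: "fst q \<in> patterns K" using q by (auto simp: m_def)
    have "card C \<le> card (middle m K)" by (rule card_mono[OF _ C[OF m]]) (simp add: middle_def)
    then have c: "1 + K + card C \<le> m" using K[OF m] by (auto simp: middle_def)
    have "card (?X q) = (m - (1 + K + card C)) choose (g + (card (fst (fst q)) + card (snd (fst q))) - (m + 2 * K + 1))"
      unfolding m_def using K[OF m] C[OF m] p by (intro card_pattern_class(2)) (auto simp: m_def)
    also have "g + (card (fst (fst q)) + card (snd (fst q))) - (m + 2 * K + 1)
        = g + (card (fst (fst q)) + card (snd (fst q))) - (3 * K + 2 + card C) - (m - (1 + K + card C))"
      using c by simp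
    finally show "card (?X q) = (snd q - (1 + K + card C)) choose
      (g + (card (fst (fst q)) + card (snd (fst q))) - (3 * K + 2 + card C) - (snd q - (1 + K + card C)))"
      by (simp add: m_def)
  qed
  also have "\<dots> = window_count \<eta> K (card C) g"
    unfolding window_count_def by (simp only: sum.cartesian_product case_prod_unfold)
  finally show ?thesis .
qed

lemma card_tame_le:
  assumes g: "3 * K < g"
  shows "card (tame K g) \<le> (\<Sum>p\<in>patterns K. fib (Suc (g + (card (fst p) + card (snd p)) - (3 * K + 2))))"
proof -
  define M where "M = {K<..g + 1}"
  have "tame K g \<subseteq> (\<Union>p\<in>patterns K. \<Union>m\<in>M. pattern_class g m K p)"
  proof
    fix S assume S: "S \<in> tame K g"
    then have "mult_of S \<in> M" using tame_pattern(2)[OF S g] mult_le[of S g] by (auto simp: M_def tame_def)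
    moreover have "S \<in> pattern_class g (mult_of S) K (shape (mult_of S) K S, upper (mult_of S) K S)"
      using S by (simp add: pattern_class_def)
    ultimately show "S \<in> (\<Union>p\<in>patterns K. \<Union>m\<in>M. pattern_class g m K p)"
      using tame_pattern(1)[OF S] by blast
  qed
  then have "card (tame K g) \<le> card (\<Union>p\<in>patterns K. \<Union>m\<in>M. pattern_class g m K p)"
    by (intro card_mono) (auto simp: M_def)
  also have "\<dots> \<le> (\<Sum>p\<in>patterns K. card (\<Union>m\<in>M. pattern_class g m K p))"
    by (rule card_UN_le) simp
  also have "\<dots> \<le> (\<Sum>p\<in>patterns K. \<Sum>m\<in>M. card (pattern_class g m K p))"
    by (intro sum_mono card_UN_le) (simp add: M_def)
  also have "\<dots> \<le> (\<Sum>p\<in>patterns K. fib (Suc (g + (card (fst p) + card (snd p)) - (3 * K + 2))))"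
  proof (rule sum_mono)
    fix p assume p: "p \<in> patterns K"
    define s where "s = card (fst p) + card (snd p)"
    define N where "N = g + s - (3 * K + 2)"
    define M' where "M' = {m \<in> M. pattern_class g m K p \<noteq> {}}"
    have le: "K < m \<and> m + 2 * K + 1 \<le> g + s" if "m \<in> M'" for m
      using card_pattern_class(1)[OF p, of m "{}" g] that by (auto simp: M'_def M_def s_def)
    have "(\<Sum>m\<in>M. card (pattern_class g m K p)) = (\<Sum>m\<in>M'. card (pattern_class g m K p))"
      by (rule sum.mono_neutral_right) (auto simp: M'_def M_def)
    also have "\<dots> = (\<Sum>m\<in>M'. (m - 1 - K) choose (N - (m - 1 - K)))"
    proof (rule sum.cong[OF refl])
      fix m assume "m \<in> M'"
      note l = le[OF this]
      have "card (pattern_class g m K p) = (m - (1 + K)) choose (g + s - (m + 2 * K + 1))"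
        using card_pattern_class(2)[OF p, of m "{}" g] l by (simp add: s_def)
      moreover have "g + s - (m + 2 * K + 1) = N - (m - 1 - K)" using l by (simp add: N_def)
      ultimately show "card (pattern_class g m K p) = (m - 1 - K) choose (N - (m - 1 - K))"
        by simp
    qed
    also have "\<dots> \<le> fib (Suc N)"
    proof (rule sum_choose_shift_le)
      show "finite M'" by (simp add: M'_def M_def)
      show "K < m \<and> m - 1 - K \<le> N" if "m \<in> M'" for m
        using le[OF that] by (auto simp: N_def)
    qed
    finally show "(\<Sum>m\<in>M. card (pattern_class g m K p)) \<le> fib (Suc (g + (card (fst p) + card (snd p)) - (3 * K + 2)))"
      by (simp add: N_def s_def)
  qed
  finally show ?thesis .
qed

definition pattern_mass :: "nat \<Rightarrow> real" where
  "pattern_mass K = (\<Sum>p\<in>patterns K. phi ^ (card (fst p) + card (snd p) + 1) / (phi ^ (3 * K + 2) * sqrt 5))"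

lemma window_count_asymptotics:
  fixes \<eta> :: real
  assumes "0 < \<eta>" "\<eta> \<le> 0.1"
  shows "(\<lambda>g. real (window_count \<eta> K c g) / phi ^ g) \<longlonglongrightarrow> pattern_mass K * (1 / phi) ^ c"
proof -
  have "(\<lambda>g. real (window_count \<eta> K c g) / phi ^ g)
     = (\<lambda>g. \<Sum>p\<in>patterns K. (\<Sum>m\<in>window \<eta> g. real ((m - (1 + K + c)) choose
          (g + (card (fst p) + card (snd p)) - (3 * K + 2 + c) - (m - (1 + K + c))))) / phi ^ g)"
    by (simp only: window_count_def of_nat_sum sum_divide_distrib)
  moreover have "\<dots> \<longlonglongrightarrow>
      (\<Sum>p\<in>patterns K. phi ^ (card (fst p) + card (snd p) + 1) / (phi ^ (3 * K + 2 + c) * sqrt 5))"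
    by (intro tendsto_sum window_sum_asymptotics assms)
  moreover have "(\<Sum>p\<in>patterns K. phi ^ (card (fst p) + card (snd p) + 1) / (phi ^ (3 * K + 2 + c) * sqrt 5))
      = pattern_mass K * (1 / phi) ^ c"
    unfolding pattern_mass_def sum_distrib_right
    by (rule sum.cong) (simp_all add: power_add power_divide)
  ultimately show ?thesis by simp
qed

text \<open>Complete diagonals bound all tame semigroups from above and have the same limit
  \<open>pattern_mass K\<close> as the window sums; hence multiplicities outside the window are
  negligible.\<close>

lemma card_tame_minus_window_asymptotics:
  fixes \<eta> :: real
  assumes \<eta>: "0 < \<eta>" "\<eta> \<le> 0.1" and \<delta>: "0 < \<delta>"
  shows "\<forall>\<^sub>F g in sequentially. real (card (tame K g)) - real (window_count \<eta> K 0 g) \<le> \<delta> * phi ^ g"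
proof -
  define T where "T g = (\<Sum>p\<in>patterns K. real (fib (Suc (g + (card (fst p) + card (snd p)) - (3 * K + 2)))) / phi ^ g)" for g
  have "T \<longlonglongrightarrow> pattern_mass K"
    unfolding T_def pattern_mass_def by (intro tendsto_sum fib_shift_asymptotics)
  from tendsto_diff[OF this window_count_asymptotics[OF \<eta>, of K 0]]
  have "(\<lambda>g. T g - real (window_count \<eta> K 0 g) / phi ^ g) \<longlonglongrightarrow> 0" by simp
  then have "\<forall>\<^sub>F g in sequentially. T g - real (window_count \<eta> K 0 g) / phi ^ g < \<delta>"
    by (rule order_tendstoD) (rule \<delta>)
  then show ?thesis
    using eventually_gt_at_top[of "3 * K"]
  proof eventually_elim
    case (elim g)
    have "real (card (tame K g)) \<le> real (\<Sum>p\<in>patterns K. fib (Suc (g + (card (fst p) + card (snd p)) - (3 * K + 2))))"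
      using card_tame_le[OF elim(2)] by (rule of_nat_mono)
    also have "\<dots> = T g * phi ^ g"
      using phi_pos by (simp add: T_def sum_divide_distrib[symmetric])
    finally have "real (card (tame K g)) - real (window_count \<eta> K 0 g)
        \<le> (T g - real (window_count \<eta> K 0 g) / phi ^ g) * phi ^ g"
      using phi_pos by (simp add: left_diff_distrib)
    also have "\<dots> \<le> \<delta> * phi ^ g" using elim phi_pos by (intro mult_right_mono) auto
    finally show ?case .
  qed
qed

section \<open>The limit theorem\<close>

lemma pattern_mass_0_pos: "0 < pattern_mass 0"
proof -
  have "({0}, {0}) \<in> patterns 0" by (simp add: patterns_def)
  then show ?thesis
    unfolding pattern_mass_def using phi_pos by (intro sum_pos2[of _ "({0}, {0})"]) auto
qed

lemma f1_values:
  "x < gamma \<Longrightarrow> f1 x = 0" "gamma < x \<Longrightarrow> x < 2 * gamma \<Longrightarrow> f1 x = 1 / phi" "2 * gamma < x \<Longrightarrow> f1 x = 1"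
  using gamma_bounds by (auto simp: f1_def inverse_phi) (simp add: phi_def field_simps)

lemma window_eventually:
  fixes \<eta> :: real
  assumes \<eta>: "0 < \<eta>" "\<eta> \<le> 0.1"
  shows "\<forall>\<^sub>F g in sequentially. \<forall>m\<in>window \<eta> g. K < m \<and> m + 2 * K + 1 \<le> g"
proof -
  have c: "(0 :: real) < 0.5" "(0 :: real) < 0.1" by simp_all
  show ?thesis
    using eventually_linear_ge[OF c(1), of "real K"] eventually_linear_ge[OF c(2), of "real (2 * K + 1)"]
      eventually_gt_at_top[of 0]
  proof eventually_elim
    case (elim g)
    show ?case
    proof
      fix m assume m: "m \<in> window \<eta> g"
      have w: "\<bar>real m - gamma * real g\<bar> < 0.1 * real g"
        using m mult_right_mono[OF \<eta>(2), of "real g"] by (simp add: window_def)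
      have w': "0.7 * real g \<le> gamma * real g" "gamma * real g \<le> 0.8 * real g"
        using gamma_bounds mult_right_mono[of "0.7" gamma "real g"] mult_right_mono[of gamma "0.8" "real g"]
        by simp_all
      have "0 < real g" using elim by simp
      then have "real K < real m" using w w' elim by linarith
      moreover have "real m + real (2 * K + 1) \<le> real g" using w w' elim by linarith
      then have "real (m + 2 * K + 1) \<le> real g" by simp
      ultimately show "K < m \<and> m + 2 * K + 1 \<le> g" by (simp only: of_nat_less_iff of_nat_le_iff)
    qed
  qed
qed

theorem theorem6p6:
  fixes l :: nat and \<epsilon>1 \<epsilon>2 :: real
  assumes "\<epsilon>1 > 0" and "\<epsilon>2 > 0"
  shows "\<exists>M > 0. \<forall>g :: nat. real g > M \<longrightarrow>
           (\<forall>C :: nat set.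
              (\<forall>n\<in>C. 1 \<le> n \<and> real n \<le> 2 * real g \<and>
                 (real n < (gamma - \<epsilon>1) * g
                  \<or> ((gamma + \<epsilon>1) * g < real n \<and> real n < (2 * gamma - \<epsilon>1) * g)
                  \<or> (2 * gamma + \<epsilon>1) * g < real n))
              \<and> finite C \<and> card C = l \<longrightarrow>
              \<bar>prob_genus g (\<lambda>S. C \<subseteq> S) - (\<Prod>n\<in>C. f1 (real n / real g))\<bar> < \<epsilon>2)"
proof -
  \<comment> \<open>Doubling the window and adding \<open>K \<le> \<eta> * g\<close> moves a
    threshold by at most \<open>3 * \<eta> * g < \<epsilon>1 * g\<close>, so points of
    \<open>C\<close> stay clear of it.\<close>
  define \<eta> where "\<eta> = min 0.1 (\<epsilon>1 / 4)"
  have \<eta>: "0 < \<eta>" "\<eta> \<le> 0.1" "4 * \<eta> \<le> \<epsilon>1" using assms by (auto simp: \<eta>_def)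
  \<comment> \<open>\<open>\<delta>\<close> must be fixed before the tail bound supplies
    \<open>K\<close>, so the reference mass is taken from the patterns with
    \<open>K = 0\<close>.\<close>
  define \<kappa> where "\<kappa> = pattern_mass 0"
  have \<kappa>: "0 < \<kappa>" by (simp add: \<kappa>_def pattern_mass_0_pos)
  \<comment> \<open>The total error \<open>3 * \<delta>\<close> has to stay below
    \<open>\<epsilon>2 * \<kappa> / 2\<close>.\<close>
  define \<delta> where "\<delta> = \<epsilon>2 * \<kappa> / 8"
  have \<delta>: "0 < \<delta>" using assms \<kappa> by (simp add: \<delta>_def)
  obtain K where tail: "\<forall>\<^sub>F g in sequentially.
      real (card {S \<in> semigroups_of_genus g. \<exists>x>2 * mult_of S + K. x \<notin> S}) \<le> \<delta> * phi ^ g"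
    using tail_bound[OF \<delta>] by blast
  have "(\<lambda>g. real (window_count \<eta> 0 0 g) / phi ^ g) \<longlonglongrightarrow> \<kappa>"
    using window_count_asymptotics[OF \<eta>(1,2), of 0 0] by (simp add: \<kappa>_def)
  then have lower: "\<forall>\<^sub>F g in sequentially. \<kappa> / 2 < real (window_count \<eta> 0 0 g) / phi ^ g"
    by (rule order_tendstoD) (use \<kappa> in simp)
  \<comment> \<open>Uniformity in \<open>C\<close>: the window count sees \<open>C\<close> only
    through the number of its middle points, which is at most \<open>l\<close>, so finitely many
    limits suffice.\<close>
  have ratio: "\<forall>\<^sub>F g in sequentially. \<forall>c\<in>{..l}.
      \<bar>real (window_count \<eta> K c g) / phi ^ g - (1 / phi) ^ c * (real (window_count \<eta> K 0 g) / phi ^ g)\<bar> < \<delta>"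
  proof (rule eventually_ball_finite)
    show "\<forall>c\<in>{..l}. \<forall>\<^sub>F g in sequentially.
      \<bar>real (window_count \<eta> K c g) / phi ^ g - (1 / phi) ^ c * (real (window_count \<eta> K 0 g) / phi ^ g)\<bar> < \<delta>"
    proof
      fix c
      have "(\<lambda>g. \<bar>real (window_count \<eta> K c g) / phi ^ g - (1 / phi) ^ c * (real (window_count \<eta> K 0 g) / phi ^ g)\<bar>)
        \<longlonglongrightarrow> \<bar>pattern_mass K * (1 / phi) ^ c - (1 / phi) ^ c * (pattern_mass K * (1 / phi) ^ 0)\<bar>"
        by (intro tendsto_rabs tendsto_diff tendsto_mult_left window_count_asymptotics \<eta>)
      then show "\<forall>\<^sub>F g in sequentially.
        \<bar>real (window_count \<eta> K c g) / phi ^ g - (1 / phi) ^ c * (real (window_count \<eta> K 0 g) / phi ^ g)\<bar> < \<delta>"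
        by (rule order_tendstoD) (use \<delta> in simp)
    qed
  qed simp
  have "\<forall>\<^sub>F g in sequentially. (\<forall>C :: nat set.
              (\<forall>n\<in>C. 1 \<le> n \<and> real n \<le> 2 * real g \<and>
                 (real n < (gamma - \<epsilon>1) * g
                  \<or> ((gamma + \<epsilon>1) * g < real n \<and> real n < (2 * gamma - \<epsilon>1) * g)
                  \<or> (2 * gamma + \<epsilon>1) * g < real n))
              \<and> finite C \<and> card C = l \<longrightarrow>
              \<bar>prob_genus g (\<lambda>S. C \<subseteq> S) - (\<Prod>n\<in>C. f1 (real n / real g))\<bar> < \<epsilon>2)"
    using tail lower ratio card_tame_minus_window_asymptotics[OF \<eta>(1,2) \<delta>, of K]
      window_eventually[OF \<eta>(1,2), of 0] window_eventually[OF \<eta>(1,2), of K]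
      eventually_linear_ge[OF \<eta>(1), of "real K"] eventually_gt_at_top[of 0]
  proof eventually_elim
    case (elim g)
    define C1 C2 where "C1 C = {n \<in> C. real n < gamma * g}"
      and "C2 C = {n \<in> C. gamma * g < real n \<and> real n < 2 * gamma * g}" for C :: "nat set"
    define SG where "SG = semigroups_of_genus g"
    define G where "G = {S \<in> tame K g. mult_of S \<in> window \<eta> g}"
    define X where "X c = real (window_count \<eta> K c g)" for c
    define R where "R = real (card (SG - G))"
    have g: "0 < real g" using elim by simp
    have finSG: "finite SG" by (simp add: SG_def)
    have GS: "G \<subseteq> SG" by (auto simp: G_def SG_def tame_def)
    have phig: "0 < phi ^ g" using phi_pos by simp
    have G_card: "real (card {S \<in> G. D \<subseteq> S}) = X (card D)"
      if "\<And>m. m \<in> window \<eta> g \<Longrightarrow> D \<subseteq> middle m K" for D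
      using card_tame_window[of \<eta> g K D] elim(6) that by (simp add: G_def X_def conj_assoc)
    have X0: "real (card G) = X 0" using G_card[of "{}"] by simp
    have SG_split: "real (card SG) = X 0 + R"
      using card_Diff_subset[OF finite_subset[OF GS finSG] GS] card_mono[OF finSG GS] X0
      by (simp add: R_def of_nat_diff)
    have SG_G: "SG - G = {S \<in> SG. \<exists>x>2 * mult_of S + K. x \<notin> S} \<union> (tame K g - G)"
      by (auto simp: SG_def tame_def G_def)
    have "card (SG - G) \<le> card {S \<in> SG. \<exists>x>2 * mult_of S + K. x \<notin> S} + card (tame K g - G)"
      unfolding SG_G by (rule card_Un_le)
    also have "card (tame K g - G) = card (tame K g) - card G"
      by (rule card_Diff_subset) (auto simp: G_def)
    finally have "R \<le> real (card {S \<in> SG. \<exists>x>2 * mult_of S + K. x \<notin> S}) + (real (card (tame K g)) - X 0)"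
      using card_mono[of "tame K g" G] X0 by (simp add: R_def G_def)
    \<comment> \<open>One \<open>\<delta>\<close> for semigroups that are not tame, one for tame
      ones with multiplicity outside the window.\<close>
    then have R: "R \<le> 2 * \<delta> * phi ^ g"
      using elim(1,4) by (simp add: SG_def X_def)
    have R0: "0 \<le> R" by (simp add: R_def)
    have "real (window_count \<eta> 0 0 g) \<le> real (card SG)"
    proof -
      have "card {S \<in> tame 0 g. mult_of S \<in> window \<eta> g \<and> {} \<subseteq> S} = window_count \<eta> 0 (card ({} :: nat set)) g"
        by (rule card_tame_window) (use elim(5) in auto)
      moreover have "card {S \<in> tame 0 g. mult_of S \<in> window \<eta> g \<and> {} \<subseteq> S} \<le> card SG"
        by (rule card_mono[OF finSG]) (auto simp: SG_def tame_def)
      ultimately show ?thesis by simp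
    qed
    moreover have "\<kappa> / 2 * phi ^ g < real (window_count \<eta> 0 0 g)"
      using elim(2) phig by (simp add: pos_less_divide_eq)
    ultimately have big: "\<kappa> / 2 * phi ^ g < real (card SG)" by linarith
    have SGpos: "0 < real (card SG)" using big \<kappa> phig by (meson less_trans mult_pos_pos half_gt_zero)
    have small: "3 * \<delta> * phi ^ g < \<epsilon>2 * real (card SG)"
    proof -
      have "3 * \<delta> * phi ^ g < \<epsilon>2 * (\<kappa> / 2 * phi ^ g)"
        using assms \<kappa> phig by (simp add: \<delta>_def)
      also have "\<dots> < \<epsilon>2 * real (card SG)" using big assms by simp
      finally show ?thesis .
    qed
    have win: "(gamma - \<eta>) * g < real m \<and> real m < (gamma + \<eta>) * g" if "m \<in> window \<eta> g" for m
      using that by (auto simp: window_def abs_less_iff algebra_simps)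
    have eg: "4 * (\<eta> * g) \<le> \<epsilon>1 * g" using mult_right_mono[OF \<eta>(3), of "real g"] by simp
    have \<eta>g: "0 < \<eta> * g" using \<eta> g by simp
    show ?case
    proof (intro allI impI, elim conjE)
      fix C :: "nat set"
      assume C: "\<forall>n\<in>C. 1 \<le> n \<and> real n \<le> 2 * real g \<and>
                 (real n < (gamma - \<epsilon>1) * g
                  \<or> ((gamma + \<epsilon>1) * g < real n \<and> real n < (2 * gamma - \<epsilon>1) * g)
                  \<or> (2 * gamma + \<epsilon>1) * g < real n)"
        and finC: "finite C" and cC: "card C = l"
      have \<epsilon>g: "0 < \<epsilon>1 * g" using assms g by simp
      have gg: "0 < gamma * g" using gamma_bounds g by simp
      have split: "1 \<le> n \<and> (n \<in> C1 C \<and> real n < gamma * g - \<epsilon>1 * g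
          \<or> n \<in> C2 C \<and> gamma * g + \<epsilon>1 * g < real n \<and> real n < 2 * gamma * g - \<epsilon>1 * g
          \<or> 2 * gamma * g + \<epsilon>1 * g < real n)" if "n \<in> C" for n
        using bspec[OF C that] that \<epsilon>g gg unfolding C1_def C2_def distrib_right left_diff_distrib by auto
      define N where "N = real (card {S \<in> SG. C \<subseteq> S})"
      have prob: "prob_genus g (\<lambda>S. C \<subseteq> S) = N / real (card SG)"
        by (simp add: prob_genus_def N_def SG_def)
      have N_split: "real (card {S \<in> G. C \<subseteq> S}) \<le> N \<and> N \<le> real (card {S \<in> G. C \<subseteq> S}) + R"
      proof -
        have "card {S \<in> G. C \<subseteq> S} \<le> card {S \<in> SG. C \<subseteq> S}"
          using GS finSG by (intro card_mono) auto
        moreover have "card {S \<in> SG. C \<subseteq> S} \<le> card ({S \<in> G. C \<subseteq> S} \<union> (SG - G))"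
          using GS finSG finite_subset[OF GS finSG] by (intro card_mono) auto
        then have "card {S \<in> SG. C \<subseteq> S} \<le> card {S \<in> G. C \<subseteq> S} + card (SG - G)"
          using card_Un_le[of "{S \<in> G. C \<subseteq> S}" "SG - G"] by linarith
        ultimately show ?thesis by (simp add: N_def R_def flip: of_nat_add)
      qed
      have "\<bar>N - (\<Prod>n\<in>C. f1 (real n / real g)) * real (card SG)\<bar> \<le> 3 * \<delta> * phi ^ g"
      proof (cases "C1 C = {}")
        case False
        then obtain n where n: "n \<in> C1 C" by blast
        have nC: "n \<in> C" and ng: "real n < gamma * g" using n by (auto simp: C1_def)
        have "real n / real g < gamma" using ng g by (simp add: pos_divide_less_eq)
        then have "(\<Prod>n\<in>C. f1 (real n / real g)) = 0"
          using f1_values(1) nC finC by (intro prod_zero) auto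
        \<comment> \<open>A point of \<open>C1 C\<close> is positive and lies below every
          multiplicity in the window.\<close>
        moreover have empty: "{S \<in> G. C \<subseteq> S} = {}"
        proof -
          have "n \<notin> S" if S: "S \<in> G" for S
          proof (rule multD(3))
            show "S \<in> semigroups_of_genus g" using S GS by (auto simp: SG_def)
            show "0 < n" using split[OF nC] by simp
            have "(gamma - \<eta>) * g < real (mult_of S)" using S win by (auto simp: G_def)
            moreover have "real n < gamma * g - \<epsilon>1 * g"
              using split[OF nC] ng n \<epsilon>g gg by (auto simp: C1_def C2_def)
            ultimately show "n < mult_of S" using eg \<eta>g by (simp add: left_diff_distrib)
          qed
          then show ?thesis using nC by auto
        qed
        moreover have "0 \<le> N" "N \<le> R" using N_split unfolding empty by simp_all
        moreover have "0 < \<delta> * phi ^ g" using \<delta> phig by simp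
        ultimately show ?thesis using R by simp
      next
        case True
        let ?c = "card (C2 C)"
        have fac: "f1 (real n / real g) = (if n \<in> C2 C then 1 / phi else 1)" if "n \<in> C" for n
        proof (cases "n \<in> C2 C")
          case True
          then have "gamma < real n / real g" "real n / real g < 2 * gamma"
            using g by (auto simp: C2_def pos_divide_less_eq pos_less_divide_eq)
          then show ?thesis using f1_values(2) True by simp
        next
          case False
          then have "2 * gamma * g + \<epsilon>1 * g < real n" using split[OF that] True \<open>C1 C = {}\<close> by auto
          then have "2 * gamma < real n / real g" using g \<epsilon>g by (simp add: pos_less_divide_eq)
          then show ?thesis using f1_values(3) False by simp
        qed
        have C2C: "C2 C \<subseteq> C" by (auto simp: C2_def)
        have "(\<Prod>n\<in>C. f1 (real n / real g)) = (\<Prod>n\<in>C. if n \<in> C2 C then 1 / phi else 1)"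
          using fac by (rule prod.cong[OF refl])
        also have "\<dots> = (\<Prod>n\<in>C2 C. 1 / phi)"
          using C2C finC by (intro prod.mono_neutral_cong_right) auto
        finally have prod: "(\<Prod>n\<in>C. f1 (real n / real g)) = (1 / phi) ^ ?c" by simp
        have cl: "?c \<le> l" using card_mono[OF finC C2C] cC by simp
        have mid: "C2 C \<subseteq> middle m K" if m: "m \<in> window \<eta> g" for m
        proof
          fix n assume n: "n \<in> C2 C"
          then have "gamma * g + \<epsilon>1 * g < real n" "real n < 2 * gamma * g - \<epsilon>1 * g"
            using split[of n] C2C \<epsilon>g by (auto simp: C1_def C2_def)
          then have "real m + real K < real n \<and> real n < 2 * real m"
            using win[OF m] eg \<eta>g elim(7) unfolding left_diff_distrib distrib_right by linarith
          then have "m + K < n \<and> n < 2 * m" by linarith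
          then show "n \<in> middle m K" by (simp add: middle_def)
        qed
        \<comment> \<open>The remaining points exceed \<open>2 * mult_of S + K\<close> and belong to
          every tame semigroup of \<open>G\<close>, so they impose no condition.\<close>
        have "{S \<in> G. C \<subseteq> S} = {S \<in> G. C2 C \<subseteq> S}"
        proof -
          have "n \<in> S" if S: "S \<in> G" and n: "n \<in> C" "n \<notin> C2 C" for S n
          proof -
            have "2 * gamma * g + \<epsilon>1 * g < real n" using split[OF n(1)] n(2) True by auto
            moreover have "real (mult_of S) < (gamma + \<eta>) * g" using S win by (auto simp: G_def)
            ultimately have "2 * real (mult_of S) + real K < real n"
              using eg \<eta>g elim(7) unfolding distrib_right by linarith
            then have "2 * mult_of S + K < n" by linarith
            then show ?thesis using S by (auto simp: G_def tame_def)
          qed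
          then show ?thesis using C2C by blast
        qed
        then have N: "X ?c \<le> N" "N \<le> X ?c + R" using N_split G_card[OF mid] by auto
        define a where "a = (1 / phi) ^ ?c"
        have a: "0 \<le> a" "a \<le> 1" using phi_ge_1 by (auto simp: a_def power_le_one)
        have "\<bar>X ?c / phi ^ g - a * (X 0 / phi ^ g)\<bar> < \<delta>"
          using elim(3) cl by (simp add: X_def a_def)
        moreover have "X ?c / phi ^ g - a * (X 0 / phi ^ g) = (X ?c - a * X 0) / phi ^ g"
          by (simp add: diff_divide_distrib)
        ultimately have "\<bar>X ?c - a * X 0\<bar> / phi ^ g < \<delta>" using phig by (simp add: abs_divide)
        then have 1: "\<bar>X ?c - a * X 0\<bar> < \<delta> * phi ^ g" using phig by (simp add: pos_divide_less_eq)
        have 2: "0 \<le> a * R" "a * R \<le> R" using a R0 by (auto intro: mult_left_le_one_le)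
        \<comment> \<open>\<open>N - X ?c\<close> and \<open>a * R\<close> both lie in
          \<open>[0, R]\<close>, so together they cost at most
          \<open>R \<le> 2 * \<delta> * phi ^ g\<close>; the third \<open>\<delta>\<close> comes
          from the ratio of window counts.\<close>
        have "\<bar>N - (a * X 0 + a * R)\<bar> \<le> 3 * \<delta> * phi ^ g"
          using 1 2 N R by linarith
        then show ?thesis by (simp add: prod SG_split a_def distrib_left)
      qed
      also note small
      finally have "\<bar>N - (\<Prod>n\<in>C. f1 (real n / real g)) * real (card SG)\<bar> / real (card SG) < \<epsilon>2"
        using SGpos by (simp add: pos_divide_less_eq)
      moreover have "N / real (card SG) - (\<Prod>n\<in>C. f1 (real n / real g))
          = (N - (\<Prod>n\<in>C. f1 (real n / real g)) * real (card SG)) / real (card SG)"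
        using SGpos by (simp add: diff_divide_distrib)
      ultimately show "\<bar>prob_genus g (\<lambda>S. C \<subseteq> S) - (\<Prod>n\<in>C. f1 (real n / real g))\<bar> < \<epsilon>2"
        unfolding prob using SGpos by (simp only: abs_divide)
    qed
  qed
  then obtain g0 where g0: "\<And>g. g0 \<le> g \<Longrightarrow> (\<forall>C :: nat set.
              (\<forall>n\<in>C. 1 \<le> n \<and> real n \<le> 2 * real g \<and>
                 (real n < (gamma - \<epsilon>1) * g
                  \<or> ((gamma + \<epsilon>1) * g < real n \<and> real n < (2 * gamma - \<epsilon>1) * g)
                  \<or> (2 * gamma + \<epsilon>1) * g < real n))
              \<and> finite C \<and> card C = l \<longrightarrow>
              \<bar>prob_genus g (\<lambda>S. C \<subseteq> S) - (\<Prod>n\<in>C. f1 (real n / real g))\<bar> < \<epsilon>2)"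
    unfolding eventually_sequentially by blast
  show ?thesis
  proof (intro exI[of _ "real g0 + 1"] conjI allI)
    fix g :: nat
    show "real g0 + 1 < real g \<longrightarrow> (\<forall>C :: nat set.
              (\<forall>n\<in>C. 1 \<le> n \<and> real n \<le> 2 * real g \<and>
                 (real n < (gamma - \<epsilon>1) * g
                  \<or> ((gamma + \<epsilon>1) * g < real n \<and> real n < (2 * gamma - \<epsilon>1) * g)
                  \<or> (2 * gamma + \<epsilon>1) * g < real n))
              \<and> finite C \<and> card C = l \<longrightarrow>
              \<bar>prob_genus g (\<lambda>S. C \<subseteq> S) - (\<Prod>n\<in>C. f1 (real n / real g))\<bar> < \<epsilon>2)"
    proof
      assume "real g0 + 1 < real g"
      then have "g0 \<le> g" by linarith
      then show "\<forall>C :: nat set.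
              (\<forall>n\<in>C. 1 \<le> n \<and> real n \<le> 2 * real g \<and>
                 (real n < (gamma - \<epsilon>1) * g
                  \<or> ((gamma + \<epsilon>1) * g < real n \<and> real n < (2 * gamma - \<epsilon>1) * g)
                  \<or> (2 * gamma + \<epsilon>1) * g < real n))
              \<and> finite C \<and> card C = l \<longrightarrow>
              \<bar>prob_genus g (\<lambda>S. C \<subseteq> S) - (\<Prod>n\<in>C. f1 (real n / real g))\<bar> < \<epsilon>2" by (rule g0)
    qed
  qed simp
qed

end
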